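(* Let $N\ge 2$, $0<s<1$. Assume $f\in C^1(\mathbb{R})$ is such that $f'(t)>0$ for all $t>0$, and that one of the following holds: (a) $f(0)\neq 0$; (b) $f(0)=0$ and $f'(0)>0$. Then the problem $$(-\Delta)^s u = f(u)\ \text{ in } \mathbb{R}^N_+,\qquad u=0\ \text{ in } \mathbb{R}^N\setminus\mathbb{R}^N_+$$ does not admit any bounded, nonnegative, nontrivial (i.e. $u\not\equiv0$) classical solution.
   Context: Notation: $x=(x',x_N)\in\mathbb{R}^{N-1}\times\mathbb{R}$ and $\mathbb{R}^N_+=\{x\in\mathbb{R}^N: x_N>0\}$. The fractional Laplacian is $(-\Delta)^s u(x)=\mathrm{P.V.}\int_{\mathbb{R}^N}\frac{u(x)-u(y)}{|x-y|^{N+2s}}\,dy$ (normalization constant omitted), equivalently, for bounded, sufficiently smooth functions, $(-\Delta)^s u(x)=\frac12\int_{\mathbb{R}^N}\frac{2u(x)-u(x+y)-u(x-y)}{|y|^{N+2s}}\,dy$. A bounded classical solution is a bounded function $u:\mathbb{R}^N\to\mathbb{R}$, continuous in $\mathbb{R}^N$, of class $C^{2s+\beta}$ (locally) in $\mathbb{R}^N_+$ for some $\beta\in(0,1)$, satisfying the equation pointwise in $\mathbb{R}^N_+$ and vanishing in $\mathbb{R}^N\setminus\mathbb{R}^N_+$. *)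

theory Defs
  imports "HOL-Analysis.Analysis"
begin

text \<open>
  \<open>\<real>\<^sup>N\<close> is rendered as the product \<open>(real^'m) \<times> real\<close> of points \<open>(x', x\<^sub>N)\<close>, with \<open>N = CARD('m) + 1\<close>;
  the product norm is the Euclidean one. As \<open>'m\<close> ranges over the nonempty finite types,
  \<open>N\<close> ranges over exactly the integers \<open>\<ge> 2\<close>.
\<close>

lemma DIM_product_ge_2:
  "DIM((real^'m::finite) \<times> real) = CARD('m) + 1" "DIM((real^'m::finite) \<times> real) \<ge> 2"
  by (auto simp: Suc_le_eq)

definition half_space :: "('a \<times> real) set" where
  "half_space = {x. snd x > 0}"

text \<open>
  The principal value is the limit of the integrals over complements of small balls centred at \<open>x\<close>.
  It is stated as a relation, so that existence of the truncated integrals and of their limit is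
  part of the assertion that \<open>(-\<Delta>)\<^sup>s u(x) = v\<close>.
\<close>

definition has_frac_laplacian :: "real \<Rightarrow> ('a::euclidean_space \<Rightarrow> real) \<Rightarrow> 'a \<Rightarrow> real \<Rightarrow> bool" where
  "has_frac_laplacian s u x v \<longleftrightarrow>
     (let k = (\<lambda>y. (u x - u y) / norm (x - y) powr (real DIM('a) + 2 * s)) in
       (\<forall>\<epsilon>>0. set_integrable lborel (- ball x \<epsilon>) k) \<and>
       ((\<lambda>\<epsilon>. set_lebesgue_integral lborel (- ball x \<epsilon>) k) \<longlongrightarrow> v) (at_right 0))"

text \<open>
  Local \<open>C\<^sup>k\<^sup>,\<^sup>\<alpha>\<close> regularity on an open set: the partial derivatives up to order \<open>k\<close> exist and are
  continuous, and those of order \<open>k\<close> are \<open>\<alpha>\<close>-Hoelder on every compact subset. For \<open>\<alpha> = 0\<close> the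
  Hoelder bound is vacuous and this is \<open>C\<^sup>k\<close>.
\<close>

primrec holder_loc :: "nat \<Rightarrow> real \<Rightarrow> 'a::euclidean_space set \<Rightarrow> ('a \<Rightarrow> real) \<Rightarrow> bool" where
  "holder_loc 0 \<alpha> \<Omega> u \<longleftrightarrow> continuous_on \<Omega> u \<and>
     (\<forall>K. compact K \<and> K \<subseteq> \<Omega> \<longrightarrow>
        (\<exists>C. \<forall>x\<in>K. \<forall>y\<in>K. \<bar>u x - u y\<bar> \<le> C * dist x y powr \<alpha>))"
| "holder_loc (Suc k) \<alpha> \<Omega> u \<longleftrightarrow> (\<forall>x\<in>\<Omega>. u differentiable (at x)) \<and>
     (\<forall>b\<in>Basis. holder_loc k \<alpha> \<Omega> (\<lambda>x. frechet_derivative u (at x) b))"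

text \<open>The class \<open>C\<^sup>\<gamma>\<close> for real \<open>\<gamma> \<ge> 0\<close> is \<open>C\<^sup>k\<^sup>,\<^sup>\<alpha>\<close> with \<open>k = \<lfloor>\<gamma>\<rfloor>\<close> and \<open>\<alpha> = \<gamma> - \<lfloor>\<gamma>\<rfloor>\<close>.\<close>

definition C_loc :: "real \<Rightarrow> 'a::euclidean_space set \<Rightarrow> ('a \<Rightarrow> real) \<Rightarrow> bool" where
  "C_loc \<gamma> \<Omega> u \<longleftrightarrow> holder_loc (nat \<lfloor>\<gamma>\<rfloor>) (frac \<gamma>) \<Omega> u"

definition bounded_classical_solution ::
    "real \<Rightarrow> (real \<Rightarrow> real) \<Rightarrow> ((real^'m::finite) \<times> real \<Rightarrow> real) \<Rightarrow> bool" where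
  "bounded_classical_solution s f u \<longleftrightarrow>
     bounded (range u) \<and>
     continuous_on UNIV u \<and>
     (\<exists>\<beta>. 0 < \<beta> \<and> \<beta> < 1 \<and> C_loc (2 * s + \<beta>) half_space u) \<and>
     (\<forall>x\<in>half_space. has_frac_laplacian s u x (f (u x))) \<and>
     (\<forall>x. x \<notin> half_space \<longrightarrow> u x = 0)"

end

theory Submission
  imports Defs
begin

text \<open>
  Every estimate is obtained by touching a function near its infimum by a small multiple of the bump
  \<open>max 0 (1 - \<bar>y - x\<^sub>0\<bar>\<^sup>2 / R\<^sup>2)\<close> and comparing truncated integrals.

  If \<open>f 0 \<ge> 0\<close> then \<open>f t \<ge> c t\<close> on the range of \<open>u\<close>, and a nonnegative function \<open>v\<close> with
  \<open>(-\<Delta>)\<^sup>s v \<ge> c v\<close> on a half-space vanishes, since the first eigenvalue of a large ball is below \<open>c\<close>.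

  If \<open>f 0 < 0\<close>, moving planes give monotonicity in \<open>x\<^sub>N\<close>. Compactness of translates is replaced by two
  quantitative facts: \<open>u(x + h e\<^sub>N) - u(x) \<ge> - C h\<close>, and \<open>u\<close> has mass bounded below on every large ball in the
  half-space, because a region where \<open>u\<close> is small would force \<open>(-\<Delta>)\<^sup>s u = f(u) \<approx> f 0 < 0\<close> there while the tail
  of the integral is negligible. At a negative almost-minimum \<open>-m\<close> of \<open>u(x\<^sup>\<mu>) - u(x)\<close> the nonlocal equation makes the
  mass of \<open>u\<close> on such a ball \<open>O(m)\<close>, a contradiction once \<open>\<mu>\<close> is close to the critical plane. Monotonicity yields a
  positive lower bound of \<open>u\<close> far from the boundary, so \<open>v(x) = u(x + e\<^sub>N) - u(x)\<close> falls under the eigenvalue argument.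
\<close>

section \<open>The kernel of the fractional Laplacian\<close>

text \<open>Infima over the half-space need not be attained. Adding a bump of height
  \<open>\<delta>\<close> turns an almost-minimum into a contact point at the cost of an error
  \<open>\<delta> * R powr (- 2 * s) * kernel_const\<close>. Each contradiction then comes from a
  nonlocal gain: the gap between the function and its touching bump, integrated against the kernel
  over a chosen set away from the contact point. Two kinds of set recur. A cylinder of size
  \<open>\<rho>\<close> at distance about \<open>\<rho>\<close> has kernel times volume of order
  \<open>\<rho> powr (- 2 * s)\<close>, which beats the Lipschitz constant of \<open>f\<close> for
  small \<open>\<rho>\<close>; this replaces a narrow-region principle. A ball below the boundary,
  where \<open>u\<close> vanishes, sees the difference between a translate or reflection of
  \<open>u\<close> and \<open>u\<close> as that translate or reflection alone, so mass of
  \<open>u\<close> enters the estimate. When \<open>f 0 < 0\<close>, \<open>u\<close> itself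
  satisfies no inequality of eigenvalue type and zeros of \<open>u\<close> are not excluded by the
  strong maximum principle. Such an inequality holds for increments of \<open>u\<close>, but with a
  uniform constant only where \<open>u\<close> is bounded away from 0, since \<open>deriv f\<close>
  may degenerate at 0. Hence monotonicity and positivity have to come first.\<close>

definition frac_kernel :: "real \<Rightarrow> 'a::euclidean_space \<Rightarrow> real" where
  "frac_kernel s z = 1 / norm z powr (real DIM('a) + 2 * s)"

lemma frac_kernel_nonneg [simp]: "0 \<le> frac_kernel s z"
  by (simp add: frac_kernel_def)

lemma frac_kernel_measurable [measurable]: "frac_kernel s \<in> borel_measurable borel"
  unfolding frac_kernel_def by measurable

lemma frac_kernel_eqI:
  fixes z w :: "'a::euclidean_space"
  shows "norm z = norm w \<Longrightarrow> frac_kernel s z = frac_kernel s w"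
  by (simp add: frac_kernel_def)

lemma frac_kernel_antimono:
  fixes z w :: "'a::euclidean_space"
  assumes "0 < s" "z \<noteq> 0" "norm z \<le> norm w"
  shows "frac_kernel s w \<le> frac_kernel s z"
  unfolding frac_kernel_def using assms
  by (intro divide_left_mono powr_mono2 mult_pos_pos) auto

lemma frac_kernel_ge:
  fixes z :: "'a::euclidean_space"
  assumes "0 < s" "z \<noteq> 0" "norm z \<le> R"
  shows "R powr - (real DIM('a) + 2 * s) \<le> frac_kernel s z"
  unfolding frac_kernel_def powr_minus_divide using assms
  by (intro divide_left_mono powr_mono2 mult_pos_pos) auto

lemma frac_kernel_le:
  fixes z :: "'a::euclidean_space"
  assumes "0 < s" "0 < r" "r \<le> norm z"
  shows "frac_kernel s z \<le> r powr - (real DIM('a) + 2 * s)"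
  unfolding frac_kernel_def powr_minus_divide using assms
  by (intro divide_left_mono powr_mono2 mult_pos_pos) auto

lemma dyadic_upper:
  fixes t :: real assumes "1 \<le> t"
  obtains j :: nat where "2 ^ j \<le> t" "t < 2 ^ (j + 1)"
proof -
  have ex: "\<exists>n. t < 2 ^ n" using real_arch_pow[of 2 t] by simp
  define n where "n = (LEAST n. t < 2 ^ n)"
  have n: "t < 2 ^ n" unfolding n_def using ex by (rule LeastI_ex)
  have "n \<noteq> 0" using n assms by (cases n) auto
  then obtain j where j: "n = Suc j" using not0_implies_Suc by blast
  have "\<not> t < 2 ^ j" using not_less_Least[of j "\<lambda>n. t < 2 ^ n"] j unfolding n_def by simp
  then show ?thesis using that[of j] n j by simp
qed

text \<open>Dyadic annuli: the supremum on an annulus times the volume of an enclosing ball is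
  geometric in the index, with ratio \<open>2 powr (- 2 * s)\<close> outside the unit ball and
  \<open>2 powr (2 * s - 2)\<close> inside. The dimension bound gives \<open>p - 2 > 0\<close>, so
  the integrand decreases in the norm inside the unit ball.\<close>

lemma integrable_min_frac_kernel:
  assumes s: "0 < s" "s < 1" and n: "2 \<le> DIM('a::euclidean_space)"
  shows "integrable lborel (\<lambda>z::'a. min ((norm z)\<^sup>2) 1 * frac_kernel s z)"
proof -
  define p where "p = real DIM('a) + 2 * s"
  let ?F = "\<lambda>z::'a. min ((norm z)\<^sup>2) 1 * frac_kernel s z"
  define V where "V = unit_ball_vol (real DIM('a))"
  have V: "V \<ge> 0" unfolding V_def by simp
  define g where "g j z = ennreal (2 powr (- real j * p)) * indicator (ball (0::'a) (2 ^ (j+1))) z +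
      ennreal (2 powr (real (j+1) * (p - 2))) * indicator (ball (0::'a) ((1/2) ^ j)) z" for j :: nat and z
  have le: "ennreal (?F z) \<le> (\<Sum>j. g j z)" for z
  proof -
    have "\<exists>j. ennreal (?F z) \<le> g j z"
    proof (cases "z = 0")
      case True then show ?thesis by simp
    next
      case False
      then have nz: "norm z > 0" by simp
      show ?thesis
      proof (cases "1 \<le> norm z")
        case True
        then obtain j :: nat where j: "2 ^ j \<le> norm z" "norm z < 2 ^ (j + 1)" by (rule dyadic_upper)
        have "?F z \<le> frac_kernel s z" by (simp add: mult_left_le_one_le)
        also have "\<dots> \<le> (2 ^ j) powr - p" unfolding p_def using j s by (intro frac_kernel_le) auto
        also have "\<dots> = 2 powr (- real j * p)" by (simp add: powr_powr flip: powr_realpow)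
        finally have "ennreal (?F z) \<le> g j z" using j unfolding g_def
          by (auto simp: indicator_def intro!: add_increasing2 ennreal_leI)
        then show ?thesis by blast
      next
        case False
        then have l: "1 < 1 / norm z" "norm z < 1" using nz by (auto simp: field_simps)
        obtain j :: nat where j: "2 ^ j \<le> 1 / norm z" "1 / norm z < 2 ^ (j + 1)"
          using dyadic_upper[of "1 / norm z"] l by auto
        have F: "?F z = norm z powr (2 - p)"
        proof -
          have "(norm z)\<^sup>2 \<le> 1" using l by (simp add: power_le_one)
          then have "?F z = norm z powr 2 / norm z powr p" using nz
            by (simp add: frac_kernel_def p_def powr_numeral)
          then show ?thesis by (simp add: powr_diff)
        qed
        also have "\<dots> = (1 / norm z) powr (p - 2)" using nz
          by (simp add: powr_divide powr_diff field_simps)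
        also have "\<dots> \<le> (2 ^ (j+1)) powr (p - 2)" using j l s n by (intro powr_mono2) (auto simp: p_def)
        also have "\<dots> = 2 powr (real (j+1) * (p - 2))" by (simp add: powr_powr del: power_Suc flip: powr_realpow)
        finally have F': "?F z \<le> 2 powr (real (j+1) * (p - 2))" .
        show ?thesis
        proof (cases "norm z < (1/2)^j")
          case True
          then have "ennreal (?F z) \<le> g j z" using F' unfolding g_def
            by (auto simp: indicator_def intro!: add_increasing ennreal_leI)
          then show ?thesis by blast
        next
          \<comment> \<open>The balls in \<open>g\<close> are open, so a point with norm exactly
            \<open>(1/2)^j\<close> escapes the index \<open>j\<close>; the preceding index catches
            it with the same bound.\<close>
          case False
          then have eq: "norm z = (1/2)^j" using j nz by (auto simp: field_simps)
          then have "j \<noteq> 0" using l by (cases j) auto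
          then obtain i where i: "j = Suc i" using not0_implies_Suc by blast
          have "?F z = (1 / norm z) powr (p - 2)" using F nz
            by (simp add: powr_divide powr_diff field_simps)
          also have "1 / norm z = 2 ^ (i+1)" using eq i by (simp add: power_divide)
          also have "(2 ^ (i+1)) powr (p - 2) = 2 powr (real (i+1) * (p - 2))"
            by (simp add: powr_powr del: power_Suc flip: powr_realpow)
          finally have "?F z \<le> 2 powr (real (i+1) * (p - 2))" by simp
          moreover have "norm z < (1/2)^i"
          proof -
            have "norm z * 2 = (1/2)^i" using eq i by simp
            then show ?thesis using nz by linarith
          qed
          ultimately have "ennreal (?F z) \<le> g i z" unfolding g_def
            by (auto simp: indicator_def intro!: add_increasing ennreal_leI)
          then show ?thesis by blast
        qed
      qed
    qed
    then obtain j where "ennreal (?F z) \<le> g j z" by blast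
    also have "g j z \<le> (\<Sum>j. g j z)"
      using sum_le_suminf[of "\<lambda>j. g j z" "{j}"] by (simp add: summableI)
    finally show ?thesis .
  qed
  have two: "(\<integral>\<^sup>+z. a * indicator A z + b * indicator B z \<partial>lborel) = a * emeasure lborel A + b * emeasure lborel B"
    if [measurable]: "A \<in> sets borel" "B \<in> sets borel" for a b and A B :: "'a set"
    by (subst nn_integral_add) (auto simp: nn_integral_cmult_indicator)
  have two_meas: "(\<lambda>z. a * indicator A z + b * indicator B z) \<in> borel_measurable borel"
    if [measurable]: "A \<in> sets borel" "B \<in> sets borel" for a b :: ennreal and A B :: "'a set"
    by measurable
  have g_meas: "g j \<in> borel_measurable lborel" for j
    unfolding g_def measurable_lborel2 by (rule two_meas) simp_all
  define c where "c j = V * 2 ^ DIM('a) * (2 powr (- 2 * s)) ^ j + V * 2 powr (p - 2) * (2 powr (2 * s - 2)) ^ j" for j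
  have c: "0 \<le> c j" for j unfolding c_def using V by (intro add_nonneg_nonneg mult_nonneg_nonneg) simp_all
  have gint: "(\<integral>\<^sup>+z. g j z \<partial>lborel) =
      ennreal (V * 2 ^ DIM('a) * (2 powr (- 2 * s)) ^ j + V * 2 powr (p - 2) * (2 powr (2 * s - 2)) ^ j)" for j
  proof -
    have "(\<integral>\<^sup>+z. g j z \<partial>lborel) = ennreal (2 powr (- real j * p)) * emeasure lborel (ball (0::'a) (2 ^ (j+1)))
       + ennreal (2 powr (real (j+1) * (p - 2))) * emeasure lborel (ball (0::'a) ((1/2) ^ j))"
      unfolding g_def
      by (rule two) simp_all
    also have "\<dots> = ennreal (2 powr (- real j * p) * (V * (2 ^ (j+1)) ^ DIM('a)) +
        2 powr (real (j+1) * (p - 2)) * (V * ((1/2) ^ j) ^ DIM('a)))"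
    proof -
      have eb: "emeasure lborel (ball (0::'a) r) = ennreal (V * r ^ DIM('a))" if "0 \<le> r" for r
        using emeasure_ball[OF that, of "0::'a"] by (simp add: V_def)
      have "0 \<le> V * r ^ DIM('a)" if "0 \<le> r" for r :: real using V that by simp
      then show ?thesis
        by (simp only: eb zero_le_power zero_le_numeral zero_le_divide_1_iff ennreal_mult[symmetric]
            ennreal_plus[symmetric] powr_ge_zero mult_nonneg_nonneg)
    qed
    also have "2 powr (- real j * p) * (V * (2 ^ (j+1)) ^ DIM('a)) = V * 2 ^ DIM('a) * (2 powr (- 2 * s)) ^ j"
    proof -
      have a: "(2::real) ^ (j * DIM('a)) = 2 powr (real j * real DIM('a))"
        using powr_realpow[of 2 "j * DIM('a)"] by simp
      have "(2 powr (- 2 * s)) ^ j = 2 powr ((- 2 * s) * real j)" by (simp add: powr_power mult_ac)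
      also have "(- 2 * s) * real j = - real j * p + real j * real DIM('a)"
        by (simp add: p_def algebra_simps)
      also have "2 powr \<dots> = 2 powr (- real j * p) * 2 ^ (j * DIM('a))" unfolding powr_add a ..
      finally have b: "(2 powr (- 2 * s)) ^ j = 2 powr (- real j * p) * 2 ^ (j * DIM('a))" .
      have "(2::real) ^ (j+1) = 2 * 2 ^ j" by simp
      then have "((2::real) ^ (j+1)) ^ DIM('a) = 2 ^ DIM('a) * 2 ^ (j * DIM('a))"
        by (simp only: power_mult_distrib power_mult)
      then show ?thesis unfolding b by (simp only: mult_ac)
    qed
    also have "2 powr (real (j+1) * (p - 2)) * (V * ((1/2) ^ j) ^ DIM('a)) =
        V * 2 powr (p - 2) * (2 powr (2 * s - 2)) ^ j"
    proof -
      have a: "((1/2::real) ^ j) ^ DIM('a) = 2 powr (- (real j * real DIM('a)))"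
        using powr_realpow[of 2 "j * DIM('a)"] by (simp add: powr_minus_divide power_mult power_divide)
      have "(2 powr (2 * s - 2)) ^ j = 2 powr ((2 * s - 2) * real j)" by (simp add: powr_power mult_ac)
      then have "2 powr (p - 2) * (2 powr (2 * s - 2)) ^ j = 2 powr (p - 2 + (2 * s - 2) * real j)"
        by (simp only: powr_add)
      also have "p - 2 + (2 * s - 2) * real j = real (j+1) * (p - 2) + - (real j * real DIM('a))"
        by (simp add: p_def algebra_simps)
      also have "2 powr \<dots> = 2 powr (real (j+1) * (p - 2)) * ((1/2) ^ j) ^ DIM('a)"
        unfolding powr_add a ..
      finally show ?thesis by (simp only: mult_ac)
    qed
    finally show ?thesis .
  qed
  have "(\<integral>\<^sup>+z. ennreal (?F z) \<partial>lborel) \<le> (\<integral>\<^sup>+z. (\<Sum>j. g j z) \<partial>lborel)"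
    by (intro nn_integral_mono le)
  also have "\<dots> = (\<Sum>j. \<integral>\<^sup>+z. g j z \<partial>lborel)"
    by (intro nn_integral_suminf g_meas)
  also have "\<dots> < \<infinity>"
  proof -
    have "summable (\<lambda>j. V * 2 ^ DIM('a) * (2 powr (- 2 * s)) ^ j + V * 2 powr (p - 2) * (2 powr (2 * s - 2)) ^ j)"
      using s by (intro summable_add summable_mult summable_geometric)
        (auto simp: powr_less_one)
    then have "summable c" unfolding c_def .
    then have "(\<Sum>j. ennreal (c j)) = ennreal (\<Sum>j. c j)" by (intro suminf_ennreal2 c)
    then show ?thesis unfolding gint c_def[symmetric] by simp
  qed
  finally show ?thesis
    by (intro integrableI_nonneg) auto
qed

section \<open>Truncated integrals and touching by bumps\<close>

lemma lborel_distr_diff: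
  fixes c :: "'a::euclidean_space"
  shows "distr lborel borel (\<lambda>y. c - y) = lborel"
  by (subst (2) lborel_affine[of "-1" c]) (simp_all add: density_1)

lemma lborel_distr_Pair:
  fixes f :: "'b::euclidean_space \<Rightarrow> 'b" and g :: "'c::euclidean_space \<Rightarrow> 'c"
  assumes [measurable]: "f \<in> borel_measurable borel" "g \<in> borel_measurable borel"
    and "distr lborel borel f = lborel" "distr lborel borel g = lborel"
  shows "distr lborel borel (\<lambda>y. (f (fst y), g (snd y))) = lborel"
proof -
  have "lborel = distr lborel borel f \<Otimes>\<^sub>M distr lborel borel g"
    using assms(3,4) by (simp add: lborel_prod)
  also have "\<dots> = distr (lborel \<Otimes>\<^sub>M lborel) (borel \<Otimes>\<^sub>M borel) (\<lambda>(x, y). (f x, g y))"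
    using assms(4) by (intro pair_measure_distr) (auto simp: sigma_finite_lborel)
  also have "\<dots> = distr lborel borel (\<lambda>y. (f (fst y), g (snd y)))"
    by (simp add: lborel_prod borel_prod case_prod_beta')
  finally show ?thesis by simp
qed

lemma lborel_integral_invariant:
  fixes h :: "'a::euclidean_space \<Rightarrow> real"
  assumes "distr lborel borel T = lborel" "T \<in> borel_measurable borel" "h \<in> borel_measurable borel"
  shows "(\<integral>y. h (T y) \<partial>lborel) = (\<integral>y. h y \<partial>lborel)"
  using integral_distr[of T lborel borel h] assms by simp

lemma lborel_integrable_invariant:
  fixes h :: "'a::euclidean_space \<Rightarrow> real"
  assumes "distr lborel borel T = lborel" "T \<in> borel_measurable borel" "h \<in> borel_measurable borel"
  shows "integrable lborel (\<lambda>y. h (T y)) \<longleftrightarrow> integrable lborel h"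
  using integrable_distr_eq[of T lborel borel h] assms by simp

lemma set_integral_mono_set:
  fixes f :: "'a \<Rightarrow> real"
  assumes "set_integrable M A f" "B \<in> sets M" "B \<subseteq> A" "\<And>x. x \<in> A \<Longrightarrow> 0 \<le> f x"
  shows "(LINT x:B|M. f x) \<le> (LINT x:A|M. f x)"
proof -
  have "set_integrable M B f" using set_integrable_subset[OF assms(1-3)] .
  then show ?thesis using assms unfolding set_lebesgue_integral_def set_integrable_def
    by (intro integral_mono) (auto simp: indicator_def)
qed

text \<open>The weight bounds half the second difference of a bump of radius 1, so this integral
  bounds the Laplacian of that bump from above; radius \<open>R\<close> costs the factor
  \<open>R powr (- 2 * s)\<close> by scaling.\<close>

definition kernel_const :: "'a::euclidean_space itself \<Rightarrow> real \<Rightarrow> real" where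
  "kernel_const _ s = integral\<^sup>L lborel (\<lambda>z::'a. min ((norm z)\<^sup>2) 1 * frac_kernel s z)"

lemma kernel_const_nonneg: "0 \<le> kernel_const TYPE('a::euclidean_space) s"
  unfolding kernel_const_def by (intro integral_nonneg_AE) auto

lemma scaled_min_frac_kernel:
  assumes s: "0 < s" "s < 1" and n: "2 \<le> DIM('a::euclidean_space)" and R: "0 < R"
  shows "integrable lborel (\<lambda>z::'a. min ((norm z)\<^sup>2 / R\<^sup>2) 1 * frac_kernel s z)"
    and "integral\<^sup>L lborel (\<lambda>z::'a. min ((norm z)\<^sup>2 / R\<^sup>2) 1 * frac_kernel s z)
       = R powr (- 2 * s) * kernel_const TYPE('a) s"
proof -
  let ?F = "\<lambda>z::'a. min ((norm z)\<^sup>2 / R\<^sup>2) 1 * frac_kernel s z"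
  let ?F1 = "\<lambda>z::'a. min ((norm z)\<^sup>2) 1 * frac_kernel s z"
  let ?D = "density (distr lborel borel (\<lambda>x::'a. 0 + R *\<^sub>R x)) (\<lambda>_. ennreal (\<bar>R\<bar>^DIM('a)))"
  have D: "lborel = ?D" using lborel_affine[of R "0::'a"] R by simp
  have sc: "?F (0 + R *\<^sub>R z) = R powr - (real DIM('a) + 2 * s) * ?F1 z" for z
    unfolding powr_minus_divide using R
    by (simp add: frac_kernel_def powr_mult power_mult_distrib)
  show "integrable lborel ?F"
    by (subst D, subst integrable_density, simp, simp, simp, subst integrable_distr_eq, simp, simp,
        subst sc, use integrable_min_frac_kernel[OF s n] R in simp)
  have "(\<integral>z. ?F z \<partial>lborel) = (\<integral>z. R ^ DIM('a) *\<^sub>R ?F (0 + R *\<^sub>R z) \<partial>lborel)"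
    by (subst D, subst integral_density, simp, simp, use R in simp, subst integral_distr, simp, simp, use R in simp)
  also have "\<dots> = R ^ DIM('a) * R powr - (real DIM('a) + 2 * s) * kernel_const TYPE('a) s"
    unfolding sc kernel_const_def by simp
  also have "R ^ DIM('a) * R powr - (real DIM('a) + 2 * s) = R powr (- 2 * s)"
    using R by (simp add: powr_add[symmetric] flip: powr_realpow)
  finally show "integral\<^sup>L lborel (\<lambda>z::'a. min ((norm z)\<^sup>2 / R\<^sup>2) 1 * frac_kernel s z)
       = R powr (- 2 * s) * kernel_const TYPE('a) s" .
qed

text \<open>Off \<open>ball x r\<close> the weight \<open>min ((norm (x - y))\<^sup>2) 1\<close> is
  at least \<open>min (r\<^sup>2) 1\<close>, so a multiple of the integrable function of
  \<open>integrable_min_frac_kernel\<close> dominates.\<close>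

lemma set_integrable_frac_kernel:
  fixes x :: "'a::euclidean_space" and g :: "'a \<Rightarrow> real"
  assumes s: "0 < s" "s < 1" and n: "2 \<le> DIM('a)"
    and S [measurable]: "S \<in> sets borel" and r: "0 < r" "S \<inter> ball x r = {}"
    and g [measurable]: "g \<in> borel_measurable borel" and B: "\<And>y. \<bar>g y\<bar> \<le> B"
  shows "set_integrable lborel S (\<lambda>y. g y * frac_kernel s (x - y))"
proof -
  let ?F = "\<lambda>z::'a. min ((norm z)\<^sup>2) 1 * frac_kernel s z"
  define m where "m = min (r\<^sup>2) 1"
  have m: "0 < m" using r by (simp add: m_def)
  have "integrable lborel (\<lambda>y. B / m * ?F (x - y))"
    using integrable_min_frac_kernel[OF s n]
    by (intro integrable_mult_right) (subst lborel_integrable_invariant[OF lborel_distr_diff, where h="?F"], auto)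
  then show ?thesis unfolding set_integrable_def
  proof (rule Bochner_Integration.integrable_bound)
    show "AE y in lborel. norm (indicat_real S y *\<^sub>R (g y * frac_kernel s (x - y))) \<le> norm (B / m * ?F (x - y))"
    proof (rule AE_I2)
      fix y
      have B0: "0 \<le> B" using B[of y] by linarith
      show "norm (indicat_real S y *\<^sub>R (g y * frac_kernel s (x - y))) \<le> norm (B / m * ?F (x - y))"
      proof (cases "y \<in> S")
        case True
        then have "r \<le> norm (x - y)" using r by (auto simp: dist_norm disjoint_iff not_less)
        then have "r\<^sup>2 \<le> (norm (x - y))\<^sup>2" using r by (intro power_mono) auto
        then have "m \<le> min ((norm (x - y))\<^sup>2) 1" by (simp add: m_def)
        then have "\<bar>g y\<bar> * m \<le> B * min ((norm (x - y))\<^sup>2) 1" using B[of y] m B0 by (intro mult_mono) auto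
        then have "\<bar>g y\<bar> \<le> B / m * min ((norm (x - y))\<^sup>2) 1" using m by (simp add: field_simps)
        then have "\<bar>g y\<bar> * frac_kernel s (x - y) \<le> B / m * min ((norm (x - y))\<^sup>2) 1 * frac_kernel s (x - y)"
          by (intro mult_right_mono) auto
        then show ?thesis using True m B0 by (simp add: abs_mult mult.assoc)
      qed (use B0 m in \<open>simp add: abs_mult\<close>)
    qed
  qed simp
qed

section \<open>Paraboloid bumps, truncated Laplacians and contact inequalities\<close>

definition bump :: "'a::euclidean_space \<Rightarrow> real \<Rightarrow> 'a \<Rightarrow> real" where
  "bump x0 R y = max 0 (1 - (norm (y - x0))\<^sup>2 / R\<^sup>2)"

lemma bump_bounds: "0 \<le> bump x0 R y" "bump x0 R y \<le> 1"
  by (auto simp: bump_def)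

lemma bump_abs_le: "\<bar>bump x0 R y\<bar> \<le> 1"
  using bump_bounds[of x0 R y] by simp

lemma bump_self [simp]: "bump x0 R x0 = 1"
  by (simp add: bump_def)

lemma bump_measurable [measurable]: "bump x0 R \<in> borel_measurable borel"
  unfolding bump_def by measurable

lemma continuous_on_bump: "continuous_on A (bump x0 R)"
  unfolding bump_def divide_inverse by (intro continuous_intros)

lemma bump_pos_iff: "0 < R \<Longrightarrow> 0 < bump x0 R y \<longleftrightarrow> y \<in> ball x0 R"
  by (auto simp: bump_def dist_norm norm_minus_commute max_def abs_square_less_1 power2_less_imp_less
      divide_less_eq not_less le_divide_eq intro: power_strict_mono)

lemma bump_zero: "0 < R \<Longrightarrow> y \<notin> ball x0 R \<Longrightarrow> bump x0 R y = 0"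
  using bump_pos_iff[of R x0 y] bump_bounds(1)[of x0 R y] by auto

text \<open>The cut-off at 0 can only raise the bump at \<open>x + z\<close> and
  \<open>x - z\<close>, so the parallelogram law for the paraboloid survives as an inequality,
  despite the kink on the sphere. At \<open>x\<close> itself the cut-off must be inactive, hence
  \<open>x\<close> in the ball.\<close>

lemma bump_second_difference:
  assumes R: "0 < R" and x: "x \<in> ball x0 R"
  shows "2 * bump x0 R x - bump x0 R (x + z) - bump x0 R (x - z) \<le> 2 * min ((norm z)\<^sup>2 / R\<^sup>2) 1"
proof -
  define a where "a = x - x0"
  have q: "bump x0 R x = 1 - (norm a)\<^sup>2 / R\<^sup>2"
    using bump_pos_iff[OF R, of x0 x] x by (auto simp: bump_def a_def)
  have "bump x0 R (x + z) \<ge> 1 - (norm (a + z))\<^sup>2 / R\<^sup>2" "bump x0 R (x - z) \<ge> 1 - (norm (a - z))\<^sup>2 / R\<^sup>2"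
    by (auto simp: bump_def a_def algebra_simps)
  moreover have "(norm (a + z))\<^sup>2 + (norm (a - z))\<^sup>2 = 2 * (norm a)\<^sup>2 + 2 * (norm z)\<^sup>2"
    by (simp add: power2_norm_eq_inner inner_add inner_diff inner_commute)
  then have "(norm (a + z))\<^sup>2 / R\<^sup>2 + (norm (a - z))\<^sup>2 / R\<^sup>2 = 2 * ((norm a)\<^sup>2 / R\<^sup>2) + 2 * ((norm z)\<^sup>2 / R\<^sup>2)"
    by (simp add: add_divide_distrib[symmetric])
  ultimately have "2 * bump x0 R x - bump x0 R (x + z) - bump x0 R (x - z) \<le> 2 * ((norm z)\<^sup>2 / R\<^sup>2)"
    unfolding q by (smt (verit))
  moreover have "2 * bump x0 R x - bump x0 R (x + z) - bump x0 R (x - z) \<le> 2"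
    using bump_bounds[of x0 R] by (smt (verit))
  ultimately show ?thesis by simp
qed

text \<open>Averaging the integral with its image under \<open>T\<close> produces a second
  difference, which tames the singularity uniformly in the truncation. \<open>T\<close> is the point
  reflection in \<open>x\<close> for the full kernel, and a reflection of the horizontal variables
  alone for \<open>reflected_kernel\<close>, whose symmetry is only horizontal.\<close>

lemma bump_kernel_integral_le:
  fixes x :: "'a::euclidean_space" and k \<psi> :: "'a \<Rightarrow> real"
  assumes s: "0 < s" "s < 1" and n: "2 \<le> DIM('a)"
    and S [measurable]: "S \<in> sets borel" and r: "0 < r" "S \<inter> ball x r = {}"
    and k [measurable]: "k \<in> borel_measurable borel"
    and k_bd: "\<And>y. y \<in> S \<Longrightarrow> 0 \<le> k y" "\<And>y. y \<in> S \<Longrightarrow> k y \<le> frac_kernel s (x - y)"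
    and T: "distr lborel borel T = lborel" and T_meas [measurable]: "T \<in> borel_measurable borel"
    and inv: "\<And>y. T y \<in> S \<longleftrightarrow> y \<in> S" "\<And>y. k (T y) = k y"
    and \<psi> [measurable]: "\<psi> \<in> borel_measurable borel" and \<psi>_bd: "\<And>y. \<bar>\<psi> y\<bar> \<le> 1"
    and R: "0 < R"
    and second: "\<And>y. 2 * \<psi> x - \<psi> y - \<psi> (T y) \<le> 2 * min ((norm (x - y))\<^sup>2 / R\<^sup>2) 1"
  shows "(LINT y:S|lborel. (\<psi> x - \<psi> y) * k y) \<le> R powr (- 2 * s) * kernel_const TYPE('a) s"
proof -
  let ?h = "\<lambda>y. indicator S y * ((\<psi> x - \<psi> y) * k y)"
  let ?F = "\<lambda>z::'a. min ((norm z)\<^sup>2 / R\<^sup>2) 1 * frac_kernel s z"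
  have bd: "\<bar>\<psi> x - \<psi> y\<bar> \<le> 2" for y using \<psi>_bd[of x] \<psi>_bd[of y] by linarith
  have int: "integrable lborel ?h"
  proof (rule Bochner_Integration.integrable_bound)
    show "integrable lborel (\<lambda>y. indicator S y * (2 * frac_kernel s (x - y)))"
      using set_integrable_frac_kernel[OF s n S r, of "\<lambda>_. 2" 2] by (simp add: set_integrable_def)
    show "AE y in lborel. norm (?h y) \<le> norm (indicator S y * (2 * frac_kernel s (x - y)))"
      using bd k_bd by (intro AE_I2) (auto simp: indicator_def abs_mult intro!: mult_mono)
  qed simp
  then have intT: "integrable lborel (\<lambda>y. ?h (T y))"
    by (subst lborel_integrable_invariant[OF T T_meas, where h="?h"]) auto
  have intF: "integrable lborel (\<lambda>y. ?F (x - y))"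
    using scaled_min_frac_kernel(1)[OF s n R]
    by (subst lborel_integrable_invariant[OF lborel_distr_diff, where h="?F"]) auto
  have "2 * (\<integral>y. ?h y \<partial>lborel) = (\<integral>y. ?h y \<partial>lborel) + (\<integral>y. ?h (T y) \<partial>lborel)"
    by (subst lborel_integral_invariant[OF T T_meas, where h="?h"]) auto
  also have "\<dots> = (\<integral>y. ?h y + ?h (T y) \<partial>lborel)"
    using int intT by simp
  also have "\<dots> \<le> (\<integral>y. 2 * ?F (x - y) \<partial>lborel)"
  proof (rule integral_mono)
    fix y
    show "?h y + ?h (T y) \<le> 2 * ?F (x - y)"
    proof (cases "y \<in> S")
      case True
      then have "?h y + ?h (T y) = (2 * \<psi> x - \<psi> y - \<psi> (T y)) * k y"
        by (simp add: inv algebra_simps)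
      also have "\<dots> \<le> 2 * min ((norm (x - y))\<^sup>2 / R\<^sup>2) 1 * k y"
        using second k_bd True by (intro mult_right_mono) auto
      also have "\<dots> \<le> 2 * min ((norm (x - y))\<^sup>2 / R\<^sup>2) 1 * frac_kernel s (x - y)"
        using k_bd True by (intro mult_left_mono) auto
      finally show ?thesis by simp
    qed (simp add: inv)
  qed (use int intT intF in auto)
  also have "\<dots> = 2 * (R powr (- 2 * s) * kernel_const TYPE('a) s)"
    using lborel_integral_invariant[OF lborel_distr_diff[of x], of ?F] scaled_min_frac_kernel(2)[OF s n R]
    by simp
  finally show ?thesis by (simp add: set_lebesgue_integral_def)
qed

definition trunc_lap :: "real \<Rightarrow> ('a::euclidean_space \<Rightarrow> real) \<Rightarrow> real \<Rightarrow> 'a \<Rightarrow> real" where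
  "trunc_lap s v \<epsilon> x = (LINT y:-ball x \<epsilon>|lborel. (v x - v y) * frac_kernel s (x - y))"

text \<open>Only the limit is recorded: for bounded measurable functions the truncated integrals
  exist by \<open>trunc_lap_integrable\<close>.\<close>

definition pv_lap :: "real \<Rightarrow> ('a::euclidean_space \<Rightarrow> real) \<Rightarrow> 'a \<Rightarrow> real \<Rightarrow> bool" where
  "pv_lap s v x l \<longleftrightarrow> ((\<lambda>\<epsilon>. trunc_lap s v \<epsilon> x) \<longlongrightarrow> l) (at_right 0)"

lemma has_frac_laplacian_imp_pv_lap: "has_frac_laplacian s u x l \<Longrightarrow> pv_lap s u x l"
  by (simp add: has_frac_laplacian_def pv_lap_def trunc_lap_def frac_kernel_def Let_def)

lemma trunc_lap_integrable:
  fixes x :: "'a::euclidean_space" and v :: "'a \<Rightarrow> real"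
  assumes "0 < s" "s < 1" "2 \<le> DIM('a)" "v \<in> borel_measurable borel" "\<And>y. \<bar>v y\<bar> \<le> B"
    "S \<in> sets borel" "0 < r" "S \<inter> ball x r = {}"
  shows "set_integrable lborel S (\<lambda>y. (v x - v y) * frac_kernel s (x - y))"
proof (rule set_integrable_frac_kernel)
  fix y show "\<bar>v x - v y\<bar> \<le> 2 * B" using assms(5)[of x] assms(5)[of y] by linarith
qed (use assms in auto)

lemma trunc_lap_bump_le:
  fixes x :: "'a::euclidean_space"
  assumes s: "0 < s" "s < 1" and n: "2 \<le> DIM('a)"
    and R: "0 < R" and x: "x \<in> ball x0 R" and \<epsilon>: "0 < \<epsilon>"
  shows "trunc_lap s (bump x0 R) \<epsilon> x \<le> R powr (- 2 * s) * kernel_const TYPE('a) s"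
  unfolding trunc_lap_def
proof (rule bump_kernel_integral_le[OF s n _ \<epsilon>, where T="\<lambda>y. 2 *\<^sub>R x - y"])
  fix y
  have e: "x + (x - y) = 2 *\<^sub>R x - y" "x - (x - y) = y" by (simp_all add: scaleR_2)
  show "2 * bump x0 R x - bump x0 R y - bump x0 R (2 *\<^sub>R x - y) \<le> 2 * min ((norm (x - y))\<^sup>2 / R\<^sup>2) 1"
    using bump_second_difference[OF R x, of "x - y"] unfolding e by linarith
  show "2 *\<^sub>R x - y \<in> - ball x \<epsilon> \<longleftrightarrow> y \<in> - ball x \<epsilon>"
    by (simp add: dist_norm scaleR_2 norm_minus_commute)
  show "frac_kernel s (x - (2 *\<^sub>R x - y)) = frac_kernel s (x - y)"
    by (rule frac_kernel_eqI) (simp add: scaleR_2 norm_minus_commute)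
qed (use R in \<open>auto simp: lborel_distr_diff bump_abs_le\<close>)

text \<open>Split \<open>v x - v y\<close> into the bump part minus the gap. The bump part is
  bounded by \<open>trunc_lap_bump_le\<close>; the gap is nonnegative by contact, so its integral
  may be restricted to any convenient \<open>S\<close> away from \<open>x\<close>. Only truncated
  integrals of the bump occur, never its principal value.\<close>

lemma pv_lap_touch:
  fixes x :: "'a::euclidean_space" and v :: "'a \<Rightarrow> real"
  assumes s: "0 < s" "s < 1" and n: "2 \<le> DIM('a)"
    and v: "v \<in> borel_measurable borel" "\<And>y. \<bar>v y\<bar> \<le> B"
    and l: "pv_lap s v x l"
    and R: "0 < R" and x: "x \<in> ball x0 R" and \<delta>: "0 \<le> \<delta>"
    and touch: "\<And>y. v x - v y \<le> \<delta> * (bump x0 R x - bump x0 R y)"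
    and S: "S \<in> sets borel" "0 < r" "S \<inter> ball x r = {}"
  shows "l \<le> \<delta> * (R powr (- 2 * s) * kernel_const TYPE('a) s) -
    (LINT y:S|lborel. (\<delta> * (bump x0 R x - bump x0 R y) - (v x - v y)) * frac_kernel s (x - y))"
    (is "l \<le> ?M - (LINT y:S|lborel. ?G y * _)")
proof -
  have "\<forall>\<^sub>F \<epsilon> in at_right (0::real). \<epsilon> < r" "\<forall>\<^sub>F \<epsilon> in at_right (0::real). 0 < \<epsilon>"
    using S(2) by (auto simp: eventually_at_right_less intro: eventually_at_right_field[THEN iffD2])
  then have "\<forall>\<^sub>F \<epsilon> in at_right 0. trunc_lap s v \<epsilon> x \<le> ?M - (LINT y:S|lborel. ?G y * frac_kernel s (x - y))"
  proof eventually_elim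
    case (elim \<epsilon>)
    let ?A = "- ball x \<epsilon>"
    have A: "?A \<in> sets borel" "?A \<inter> ball x \<epsilon> = {}" by auto
    note iv = trunc_lap_integrable[OF s n v A(1) elim(2) A(2)]
    have ib: "set_integrable lborel ?A (\<lambda>y. (bump x0 R x - bump x0 R y) * frac_kernel s (x - y))"
      by (rule trunc_lap_integrable[OF s n _ _ A(1) elim(2) A(2), where B=1]) (auto simp: bump_abs_le)
    have iG: "set_integrable lborel ?A (\<lambda>y. ?G y * frac_kernel s (x - y))"
      using set_integral_diff(1)[OF set_integrable_mult_right[OF ib, of \<delta>] iv] by (simp add: algebra_simps)
    have "trunc_lap s v \<epsilon> x = (LINT y:?A|lborel. \<delta> * ((bump x0 R x - bump x0 R y) * frac_kernel s (x - y))
        - ?G y * frac_kernel s (x - y))"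
      unfolding trunc_lap_def by (simp add: algebra_simps)
    also have "\<dots> = \<delta> * (LINT y:?A|lborel. (bump x0 R x - bump x0 R y) * frac_kernel s (x - y))
        - (LINT y:?A|lborel. ?G y * frac_kernel s (x - y))"
      using set_integral_diff(2)[OF set_integrable_mult_right[OF ib, of \<delta>] iG] by simp
    finally have "trunc_lap s v \<epsilon> x = \<delta> * (LINT y:?A|lborel. (bump x0 R x - bump x0 R y) * frac_kernel s (x - y))
        - (LINT y:?A|lborel. ?G y * frac_kernel s (x - y))" .
    moreover have "(LINT y:?A|lborel. (bump x0 R x - bump x0 R y) * frac_kernel s (x - y))
        \<le> R powr (- 2 * s) * kernel_const TYPE('a) s"
    using trunc_lap_bump_le[OF s n R x elim(2)] by (simp add: trunc_lap_def)
    moreover have "(LINT y:S|lborel. ?G y * frac_kernel s (x - y)) \<le> (LINT y:?A|lborel. ?G y * frac_kernel s (x - y))"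
    proof (rule set_integral_mono_set[OF iG])
      show "S \<subseteq> - ball x \<epsilon>" using S(3) elim(1) by (auto simp: disjoint_iff)
      show "0 \<le> ?G y * frac_kernel s (x - y)" for y using touch[of y] by simp
    qed (use S in auto)
    ultimately show ?case using \<delta> by (smt (verit) mult_left_mono)
  qed
  then show ?thesis using l unfolding pv_lap_def by (intro tendsto_upperbound[OF l[unfolded pv_lap_def]]) auto
qed

text \<open>Minimize \<open>v - \<delta> * bump\<close> over the closed ball. The centre already
  reaches \<open>v x0 - \<delta>\<close>, while on the sphere and beyond the bump is 0 and
  \<open>v\<close> is larger; so the minimizer is interior and global.\<close>

lemma ball_touching_exists:
  fixes v :: "'a::euclidean_space \<Rightarrow> real"
  assumes v: "continuous_on UNIV v" and R: "0 < R" and \<delta>: "0 \<le> \<delta>"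
    and near: "\<And>y. y \<notin> ball x0 R \<Longrightarrow> v x0 - \<delta> < v y"
  shows "\<exists>x\<in>ball x0 R. v x \<le> v x0 \<and> (\<forall>y. v x - v y \<le> \<delta> * (bump x0 R x - bump x0 R y))"
proof -
  let ?g = "\<lambda>y. v y - \<delta> * bump x0 R y"
  have "continuous_on (cball x0 R) ?g"
    using continuous_on_subset[OF v] by (intro continuous_intros continuous_on_bump) auto
  then obtain x where x: "x \<in> cball x0 R" "\<And>y. y \<in> cball x0 R \<Longrightarrow> ?g x \<le> ?g y"
    using continuous_attains_inf[of "cball x0 R" ?g] R by auto
  have gx: "?g x \<le> v x0 - \<delta>" using x(2)[of x0] R by simp
  have xb: "x \<in> ball x0 R"
  proof (rule ccontr)
    assume "x \<notin> ball x0 R"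
    then show False using bump_zero[OF R, of x x0] gx near[of x] by simp
  qed
  have "?g x \<le> ?g y" for y
  proof (cases "y \<in> ball x0 R")
    case True then show ?thesis using x(2)[of y] by simp
  next
    case False then show ?thesis using bump_zero[OF R, of y x0] gx near[of y] by simp
  qed
  moreover have "v x \<le> v x0" using gx mult_left_le[OF bump_bounds(2)[of x0 R x] \<delta>] by linarith
  ultimately show ?thesis using xb by (auto simp: algebra_simps)
qed

section \<open>Supersolutions of an eigenvalue inequality\<close>

lemma set_integral_ge_const:
  fixes f :: "'a::euclidean_space \<Rightarrow> real"
  assumes S: "S \<in> sets borel" "bounded S" and f: "set_integrable lborel S f" and c: "\<And>y. y \<in> S \<Longrightarrow> c \<le> f y"
  shows "c * measure lborel S \<le> (LINT y:S|lborel. f y)"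
proof -
  have fin: "emeasure lborel S < \<infinity>" using emeasure_bounded_finite[OF S(2)] by simp
  have "(LINT y:S|lborel. c) = c * measure lborel S"
    using S fin by (subst set_integral_const) (auto simp: less_top)
  moreover have "(LINT y:S|lborel. c) \<le> (LINT y:S|lborel. f y)"
    using S fin c by (intro set_integral_mono f) (auto simp: set_integrable_def)
  ultimately show ?thesis by simp
qed

lemma set_integrable_bounded_set:
  fixes f :: "'a::euclidean_space \<Rightarrow> real"
  assumes S: "S \<in> sets borel" "bounded S" and f: "f \<in> borel_measurable borel" "\<And>y. y \<in> S \<Longrightarrow> \<bar>f y\<bar> \<le> B"
  shows "set_integrable lborel S f"
proof -
  have fin: "emeasure lborel S < \<infinity>" using emeasure_bounded_finite[OF S(2)] by simp
  have "integrable lborel (\<lambda>y. indicator S y * B)" using S fin by simp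
  then show ?thesis unfolding set_integrable_def
    by (rule Bochner_Integration.integrable_bound) (use S f in \<open>auto simp: indicator_def intro!: AE_I2 order.trans[OF f(2) abs_ge_self]\<close>)
qed

lemma kernel_integral_lower:
  fixes x :: "'a::euclidean_space" and G k :: "'a \<Rightarrow> real"
  assumes S: "S \<in> sets borel"
    and G: "set_integrable lborel S G" "set_integrable lborel S (\<lambda>y. G y * k y)" "\<And>y. y \<in> S \<Longrightarrow> 0 \<le> G y"
    and k: "\<And>y. y \<in> S \<Longrightarrow> m \<le> k y"
  shows "m * (LINT y:S|lborel. G y) \<le> (LINT y:S|lborel. G y * k y)"
proof -
  have "m * (LINT y:S|lborel. G y) = (LINT y:S|lborel. m * G y)" by simp
  also have "\<dots> \<le> (LINT y:S|lborel. G y * k y)"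
  proof (intro set_integral_mono)
    fix y assume "y \<in> S"
    then have "m * G y \<le> k y * G y" using G(3) k by (intro mult_right_mono) auto
    then show "m * G y \<le> G y * k y" by (simp add: mult.commute)
  qed (use G in auto)
  finally show ?thesis .
qed

lemma powr_neg_small:
  fixes e s R1 :: real
  assumes "0 < s" "0 < e"
  obtains R where "0 < R" "R1 \<le> R" "R powr (- 2 * s) < e"
proof -
  have "((\<lambda>x. x powr (- 2 * s)) \<longlongrightarrow> 0) at_top"
    using assms by (intro tendsto_neg_powr filterlim_ident) auto
  then have "\<forall>\<^sub>F x in at_top. x powr (- 2 * s) < e" using assms by (intro order_tendstoD(2))
  moreover have "\<forall>\<^sub>F x::real in at_top. 0 < x" by (rule eventually_gt_at_top)
  moreover have "\<forall>\<^sub>F x::real in at_top. R1 \<le> x" by (rule eventually_ge_at_top)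
  ultimately have "\<forall>\<^sub>F x in at_top. 0 < x \<and> R1 \<le> x \<and> x powr (- 2 * s) < e" by eventually_elim simp
  then obtain R where "0 < R \<and> R1 \<le> R \<and> R powr (- 2 * s) < e"
    using eventually_happens trivial_limit_at_top_linorder by blast
  then show ?thesis using that by blast
qed

text \<open>A zero is a global minimum, so contact holds with \<open>\<delta> = 0\<close>; the gap
  is then \<open>v\<close> itself, and positive mass of \<open>v\<close> near \<open>y\<close> would
  make \<open>l\<close> negative.\<close>

lemma strong_maximum_principle:
  fixes v :: "'a::euclidean_space \<Rightarrow> real"
  assumes s: "0 < s" "s < 1" and n: "2 \<le> DIM('a)"
    and cont: "continuous_on UNIV v" and B: "\<And>y. \<bar>v y\<bar> \<le> B" and nn: "\<And>y. 0 \<le> v y"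
    and l: "pv_lap s v x l" "0 \<le> l" and x: "v x = 0"
  shows "v y = 0"
proof (rule ccontr)
  assume "v y \<noteq> 0"
  then have vy: "0 < v y" using nn[of y] by simp
  have meas: "v \<in> borel_measurable borel" using cont by (rule borel_measurable_continuous_onI)
  have "y \<noteq> x" using vy x by auto
  define d where "d = dist x y"
  have d: "0 < d" using \<open>y \<noteq> x\<close> by (simp add: d_def)
  have "isCont v y" using cont by (simp add: continuous_on_eq_continuous_at)
  then obtain \<rho>0 where \<rho>0: "0 < \<rho>0" "\<And>z. dist z y < \<rho>0 \<Longrightarrow> dist (v z) (v y) < v y / 2"
    using vy unfolding continuous_at_eps_delta by (metis half_gt_zero)
  define \<rho> where "\<rho> = min \<rho>0 (d/2)"
  have \<rho>: "0 < \<rho>" "\<rho> \<le> d / 2" using \<rho>0 d by (auto simp: \<rho>_def)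
  let ?S = "ball y \<rho>"
  have low: "v y / 2 \<le> v z" if "z \<in> ?S" for z
  proof -
    have "\<bar>v z - v y\<bar> < v y / 2" using \<rho>0(2)[of z] that by (simp add: \<rho>_def dist_commute dist_real_def abs_minus_commute)
    then show ?thesis by linarith
  qed
  have far: "?S \<inter> ball x (d/2) = {}"
  proof -
    have "\<not> dist x z < d / 2" if "dist y z < \<rho>" for z
      using dist_triangle[of x y z] that \<rho> by (auto simp: d_def dist_commute)
    then show ?thesis by auto
  qed
  have near: "dist x z \<le> 2 * d" if "z \<in> ?S" for z
    using dist_triangle[of x z y] that \<rho> d by (auto simp: d_def)
  have iS: "set_integrable lborel ?S v"
    using meas B by (intro set_integrable_bounded_set) auto
  have iK: "set_integrable lborel ?S (\<lambda>z. v z * frac_kernel s (x - z))"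
    using d far by (intro set_integrable_frac_kernel[OF s n _ _ _ meas B]) auto
  have "l \<le> 0 * (1 powr (- 2 * s) * kernel_const TYPE('a) s) -
    (LINT z:?S|lborel. (0 * (bump x 1 x - bump x 1 z) - (v x - v z)) * frac_kernel s (x - z))"
  proof (rule pv_lap_touch[OF s n meas B l(1)])
    show "v x - v z \<le> 0 * (bump x 1 x - bump x 1 z)" for z using x nn[of z] by simp
  qed (use d far in auto)
  then have "(LINT z:?S|lborel. v z * frac_kernel s (x - z)) \<le> 0" using l(2) x by simp
  moreover have "(2 * d) powr - (real DIM('a) + 2 * s) * (LINT z:?S|lborel. v z) \<le> (LINT z:?S|lborel. v z * frac_kernel s (x - z))"
  proof (rule kernel_integral_lower[OF _ iS iK])
    fix z assume z: "z \<in> ?S"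
    have "x \<noteq> z" using z far d by (auto simp: disjoint_iff)
    then show "(2 * d) powr - (real DIM('a) + 2 * s) \<le> frac_kernel s (x - z)"
      using near[OF z] s by (intro frac_kernel_ge) (auto simp: dist_norm)
  qed (use nn in auto)
  moreover have "v y / 2 * measure lborel ?S \<le> (LINT z:?S|lborel. v z)"
    by (rule set_integral_ge_const[OF _ _ iS low]) auto
  moreover have "0 < v y / 2 * measure lborel ?S" using vy content_ball_pos[OF \<rho>(1), of y] by simp
  ultimately show False using d
    by (smt (verit) mult_pos_pos powr_gt_zero)
qed

text \<open>Touch \<open>v\<close> from below by the largest multiple \<open>\<tau>\<close> of the
  square of a bump \<open>\<psi>\<close>. A multiple of \<open>\<psi>\<close> itself would give only
  \<open>c * \<psi> \<le> r * T\<close> at contact, no contradiction near the sphere. For the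
  square, \<open>\<psi>(x)^2 - \<psi>(y)^2 = 2 \<psi>(x) (\<psi>(x) - \<psi>(y)) - (\<psi>(x) -
  \<psi>(y))^2\<close>: the linear term carries a factor \<open>\<psi>(x)\<close>, and the last term
  is a gain that stays positive at the sphere.\<close>

lemma half_space_eigenvalue_Liouville:
  fixes v :: "'b::euclidean_space \<times> real \<Rightarrow> real"
  assumes s: "0 < s" "s < 1"
    and cont: "continuous_on UNIV v" and B: "\<And>y. \<bar>v y\<bar> \<le> B" and nn: "\<And>y. 0 \<le> v y"
    and c: "0 < c" and super: "\<And>x. H < snd x \<Longrightarrow> \<exists>l. pv_lap s v x l \<and> c * v x \<le> l"
  shows "v y = 0"
proof (cases "\<exists>x. H < snd x \<and> v x = 0")
  case True
  then obtain x where x: "H < snd x" "v x = 0" by blast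
  then obtain l where "pv_lap s v x l" "0 \<le> l" using super[of x] by auto
  then show ?thesis using strong_maximum_principle[OF s _ cont B nn _ _ x(2)] by (simp add: Suc_le_eq)
next
  case False
  then have pos: "0 < v x" if "H < snd x" for x using nn[of x] that by (metis order_le_imp_less_or_eq)
  let ?N = "DIM('b \<times> real)"
  have n: "2 \<le> ?N" by (simp add: Suc_le_eq)
  have meas: "v \<in> borel_measurable borel" using cont by (rule borel_measurable_continuous_onI)
  define p where "p = real ?N + 2 * s"
  define T where "T = kernel_const TYPE('b \<times> real) s"
  have T: "0 \<le> T" unfolding T_def by (rule kernel_const_nonneg)
  define V where "V = measure lborel (ball (0::'b \<times> real) 1)"
  have V: "0 < V" unfolding V_def by (rule content_ball_pos) simp
  \<comment> \<open>Chosen so that \<open>q * r\<close> is the kernel bound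
    \<open>(2 * R) powr - p\<close> times \<open>1/4\<close> times the volume of the ball of radius
    \<open>R/2\<close>: there \<open>\<psi>\<close> exceeds a contact value below \<open>1/4\<close>
    by at least \<open>1/2\<close>.\<close>
  define q where "q = 2 powr - p / 4 * V * (1/2) ^ ?N"
  have q: "0 < q" using V by (simp add: q_def)
  \<comment> \<open>The first bound excludes contact in the core (\<open>r1\<close>), the second
    contact near the sphere (\<open>r2\<close>); the added ones cover \<open>T = 0\<close>.\<close>
  define e where "e = min (c / (8 * (T + 1))) (c * q / (T\<^sup>2 + 1))"
  have e: "0 < e" using c q T by (auto simp: e_def intro!: divide_pos_pos mult_pos_pos add_nonneg_pos)
  obtain R where R: "0 < R" and Re: "R powr (- 2 * s) < e" using powr_neg_small[OF s(1) e] by blast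
  define r where "r = R powr (- 2 * s)"
  have r: "0 < r" using R by (simp add: r_def)
  have r1: "2 * T * r < c / 4"
  proof -
    have "r < c / (8 * (T + 1))" using Re by (simp add: e_def r_def)
    then have "8 * (T + 1) * r < c" using T by (simp add: field_simps)
    then show ?thesis using r by (simp add: algebra_simps)
  qed
  have r2: "T\<^sup>2 * r < c * q"
  proof -
    have "r < c * q / (T\<^sup>2 + 1)" using Re by (simp add: e_def r_def)
    moreover have "0 < T\<^sup>2 + 1" by (simp add: add_nonneg_pos)
    ultimately have "r * (T\<^sup>2 + 1) < c * q" by (simp only: pos_less_divide_eq)
    then show ?thesis using r by (simp add: algebra_simps)
  qed
  define x0 :: "'b \<times> real" where "x0 = (0, H + R + 1)"
  let ?\<psi> = "bump x0 R"
  have up: "H < snd x" if "x \<in> cball x0 R" for x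
    using that dist_snd_le[of x0 x] by (auto simp: x0_def dist_real_def)
  \<comment> \<open>Maximizing \<open>\<psi>^2 / v\<close> is the same as finding the largest
    \<open>\<tau>\<close> with \<open>\<tau> * \<psi>^2 \<le> v\<close>; the maximizer is the
    contact point.\<close>
  have "continuous_on (cball x0 R) (\<lambda>x. (?\<psi> x)\<^sup>2 / v x)"
    using continuous_on_subset[OF cont] up pos by (intro continuous_intros continuous_on_bump) (auto simp: less_le)
  then obtain x1 where x1: "x1 \<in> cball x0 R" "\<And>y. y \<in> cball x0 R \<Longrightarrow> (?\<psi> y)\<^sup>2 / v y \<le> (?\<psi> x1)\<^sup>2 / v x1"
    using continuous_attains_sup[of "cball x0 R" "\<lambda>x. (?\<psi> x)\<^sup>2 / v x"] R by auto
  have v1: "0 < v x1" using up[OF x1(1)] pos by simp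
  have "0 < (?\<psi> x0)\<^sup>2 / v x0" using pos[of x0] R by (simp add: x0_def)
  also have "\<dots> \<le> (?\<psi> x1)\<^sup>2 / v x1" using x1(2)[of x0] R by simp
  finally have "?\<psi> x1 \<noteq> 0" by auto
  then have psi1: "0 < ?\<psi> x1" using bump_bounds(1)[of x0 R x1] by simp
  then have x1b: "x1 \<in> ball x0 R" using bump_pos_iff[OF R] by blast
  define \<tau> where "\<tau> = v x1 / (?\<psi> x1)\<^sup>2"
  have \<tau>: "0 < \<tau>" using v1 psi1 by (simp add: \<tau>_def)
  have v1\<tau>: "v x1 = \<tau> * (?\<psi> x1)\<^sup>2" using psi1 by (simp add: \<tau>_def)
  have below: "\<tau> * (?\<psi> y)\<^sup>2 \<le> v y" for y
  proof (cases "y \<in> cball x0 R")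
    case True
    then have "0 < v y" using up pos by blast
    then show ?thesis using x1(2)[OF True] v1 psi1 by (simp add: \<tau>_def field_simps)
  next
    case False
    then show ?thesis using bump_zero[OF R, of y x0] nn[of y] by simp
  qed
  \<comment> \<open>The gain from the squared difference, needed only when the contact point is
    close to the sphere.\<close>
  define Z where "Z = (if ?\<psi> x1 \<le> 1/4 then q * r else 0)"
  obtain l where l: "pv_lap s v x1 l" "c * v x1 \<le> l" using super up[OF x1(1)] by blast
  have bd2: "\<bar>(?\<psi> x1 - ?\<psi> y)\<^sup>2\<bar> \<le> 1" for y
  proof -
    have "\<bar>?\<psi> x1 - ?\<psi> y\<bar> \<le> 1" using bump_bounds[of x0 R] by (smt (verit))
    then show ?thesis by (simp add: abs_square_le_1)
  qed
  have trunc: "trunc_lap s v \<epsilon> x1 \<le> \<tau> * (2 * ?\<psi> x1 * (r * T) - Z)" if \<epsilon>: "0 < \<epsilon>" "\<epsilon> < R/4" for \<epsilon>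
  proof -
    let ?A = "- ball x1 \<epsilon>"
    let ?k = "\<lambda>y. frac_kernel s (x1 - y)"
    have A: "?A \<in> sets borel" "?A \<inter> ball x1 \<epsilon> = {}" by auto
    note iv = trunc_lap_integrable[OF s n meas B A(1) \<epsilon>(1) A(2)]
    have ib: "set_integrable lborel ?A (\<lambda>y. (?\<psi> x1 - ?\<psi> y) * ?k y)"
      by (rule trunc_lap_integrable[OF s n _ bump_abs_le A(1) \<epsilon>(1) A(2)]) simp
    have iq: "set_integrable lborel ?A (\<lambda>y. (?\<psi> x1 - ?\<psi> y)\<^sup>2 * ?k y)"
      using bd2 by (intro set_integrable_frac_kernel[OF s n A(1) \<epsilon>(1) A(2)]) auto
    have i2: "set_integrable lborel ?A (\<lambda>y. 2 * ?\<psi> x1 * ((?\<psi> x1 - ?\<psi> y) * ?k y))"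
      using ib by simp
    have "trunc_lap s v \<epsilon> x1 \<le>
       (LINT y:?A|lborel. \<tau> * (2 * ?\<psi> x1 * ((?\<psi> x1 - ?\<psi> y) * ?k y) - (?\<psi> x1 - ?\<psi> y)\<^sup>2 * ?k y))"
      unfolding trunc_lap_def
    proof (rule set_integral_mono[OF iv])
      show "set_integrable lborel ?A (\<lambda>y. \<tau> * (2 * ?\<psi> x1 * ((?\<psi> x1 - ?\<psi> y) * ?k y) - (?\<psi> x1 - ?\<psi> y)\<^sup>2 * ?k y))"
        using set_integral_diff(1)[OF i2 iq] by simp
      fix y
      have "v x1 - v y \<le> \<tau> * (2 * ?\<psi> x1 * (?\<psi> x1 - ?\<psi> y) - (?\<psi> x1 - ?\<psi> y)\<^sup>2)"
        using below[of y] unfolding v1\<tau> by (simp add: algebra_simps power2_eq_square)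
      then have "(v x1 - v y) * ?k y \<le> \<tau> * (2 * ?\<psi> x1 * (?\<psi> x1 - ?\<psi> y) - (?\<psi> x1 - ?\<psi> y)\<^sup>2) * ?k y"
        by (intro mult_right_mono) auto
      then show "(v x1 - v y) * ?k y \<le> \<tau> * (2 * ?\<psi> x1 * ((?\<psi> x1 - ?\<psi> y) * ?k y) - (?\<psi> x1 - ?\<psi> y)\<^sup>2 * ?k y)"
        by (simp only: left_diff_distrib right_diff_distrib mult.assoc)
    qed
    also have "\<dots> = \<tau> * (2 * ?\<psi> x1 * trunc_lap s ?\<psi> \<epsilon> x1 - (LINT y:?A|lborel. (?\<psi> x1 - ?\<psi> y)\<^sup>2 * ?k y))"
      using set_integral_diff(2)[OF i2 iq] by (simp add: trunc_lap_def)
    also have "\<dots> \<le> \<tau> * (2 * ?\<psi> x1 * (r * T) - Z)"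
    proof -
      have "2 * ?\<psi> x1 * trunc_lap s ?\<psi> \<epsilon> x1 \<le> 2 * ?\<psi> x1 * (r * T)"
        using trunc_lap_bump_le[OF s n R x1b \<epsilon>(1)] psi1 by (intro mult_left_mono) (auto simp: r_def T_def)
      moreover have "Z \<le> (LINT y:?A|lborel. (?\<psi> x1 - ?\<psi> y)\<^sup>2 * ?k y)"
      proof (cases "?\<psi> x1 \<le> 1/4")
        case small: True
        let ?S = "ball x0 (R/2)"
        have psiS: "3/4 \<le> ?\<psi> y" if "y \<in> ?S" for y
        proof -
          have "norm (y - x0) \<le> R/2" using that by (simp add: dist_norm norm_minus_commute)
          then have "(norm (y - x0))\<^sup>2 \<le> (R/2)\<^sup>2" by (intro power_mono) auto
          then have "(norm (y - x0))\<^sup>2 / R\<^sup>2 \<le> 1/4" using R by (simp add: field_simps)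
          then have "3/4 \<le> 1 - (norm (y - x0))\<^sup>2 / R\<^sup>2" by linarith
          then show ?thesis unfolding bump_def by (rule max.coboundedI2)
        qed
        \<comment> \<open>The radius \<open>3/4 * R\<close> is not sharp but leaves the inner ball
          at distance at least \<open>R/4\<close> from the contact point; this is why
          \<open>\<epsilon> < R/4\<close> was required.\<close>
        have d1: "3/4 * R \<le> norm (x1 - x0)"
        proof (rule ccontr)
          assume "\<not> ?thesis"
          then have "(norm (x1 - x0))\<^sup>2 < (3/4 * R)\<^sup>2" by (intro power_strict_mono) auto
          then have "(norm (x1 - x0))\<^sup>2 / R\<^sup>2 < 9/16" using R by (simp add: field_simps)
          moreover have "1 - (norm (x1 - x0))\<^sup>2 / R\<^sup>2 \<le> ?\<psi> x1" unfolding bump_def by (rule max.cobounded2)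
          ultimately show False using small by linarith
        qed
        have SA: "?S \<subseteq> ?A"
        proof
          fix y assume "y \<in> ?S"
          then have "dist x0 y < R/2" by simp
          moreover have "norm (x1 - x0) \<le> dist x1 y + dist x0 y"
            using dist_triangle[of x1 x0 y] by (simp add: dist_norm norm_minus_commute)
          ultimately show "y \<in> ?A" using d1 \<epsilon> by simp
        qed
        have iS: "set_integrable lborel ?S (\<lambda>y. (?\<psi> x1 - ?\<psi> y)\<^sup>2)"
          using bd2 by (intro set_integrable_bounded_set) auto
        have iSk: "set_integrable lborel ?S (\<lambda>y. (?\<psi> x1 - ?\<psi> y)\<^sup>2 * ?k y)"
          by (rule set_integrable_subset[OF iq _ SA]) simp
        have "(LINT y:?A|lborel. (?\<psi> x1 - ?\<psi> y)\<^sup>2 * ?k y) \<ge> (LINT y:?S|lborel. (?\<psi> x1 - ?\<psi> y)\<^sup>2 * ?k y)"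
          by (rule set_integral_mono_set[OF iq _ SA]) auto
        moreover have "(LINT y:?S|lborel. (?\<psi> x1 - ?\<psi> y)\<^sup>2 * ?k y) \<ge> (2 * R) powr - p * (LINT y:?S|lborel. (?\<psi> x1 - ?\<psi> y)\<^sup>2)"
        proof (rule kernel_integral_lower[OF _ iS iSk])
          fix y assume y: "y \<in> ?S"
          have "dist x1 y \<le> dist x1 x0 + dist x0 y" by (rule dist_triangle)
          then have "norm (x1 - y) \<le> 2 * R" using y x1(1) R by (simp add: dist_norm norm_minus_commute)
          moreover have "x1 \<noteq> y" using SA y \<epsilon> by auto
          ultimately show "(2 * R) powr - p \<le> ?k y" using s unfolding p_def by (intro frac_kernel_ge) auto
        qed auto
        moreover have "(LINT y:?S|lborel. (?\<psi> x1 - ?\<psi> y)\<^sup>2) \<ge> 1/4 * measure lborel ?S"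
        proof (rule set_integral_ge_const[OF _ _ iS])
          fix y assume "y \<in> ?S"
          then have "1/2 \<le> ?\<psi> y - ?\<psi> x1" using psiS small by fastforce
          then have "(1/2)\<^sup>2 \<le> (?\<psi> y - ?\<psi> x1)\<^sup>2" by (intro power_mono) auto
          then show "1/4 \<le> (?\<psi> x1 - ?\<psi> y)\<^sup>2" by (simp add: power2_commute power_divide)
        qed auto
        moreover have "(2 * R) powr - p * (1/4 * measure lborel ?S) = q * r"
        proof -
          have m: "measure lborel ?S = (R/2) ^ ?N * V"
            unfolding V_def by (rule content_ball_conv_unit_ball) (use R in simp)
          have e1: "(2 * R) powr - p = 2 powr - p * R powr - p" using R by (simp only: powr_mult)
          have e2: "(R/2) ^ ?N = (1/2) ^ ?N * R powr real ?N"
            using R by (simp only: powr_realpow power_divide) simp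
          have "R powr - p * R powr real ?N = r" unfolding r_def p_def by (simp flip: powr_add)
          then have "q * r = q * (R powr - p * R powr real ?N)" by simp
          also have "\<dots> = 2 powr - p * R powr - p * (1/4 * ((1/2) ^ ?N * R powr real ?N * V))"
            unfolding q_def by (simp only: mult_ac divide_inverse mult_1_left)
          finally show ?thesis unfolding m e1 e2 by (rule sym)
        qed
        ultimately show ?thesis using small unfolding Z_def
          by (smt (verit) mult_left_mono powr_ge_zero)
      next
        case False
        have "0 \<le> (LINT y:?A|lborel. (?\<psi> x1 - ?\<psi> y)\<^sup>2 * ?k y)"
          unfolding set_lebesgue_integral_def by (intro integral_nonneg_AE) auto
        then show ?thesis using False by (simp add: Z_def)
      qed
      ultimately show ?thesis using \<tau> by (intro mult_left_mono) auto
    qed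
    finally show ?thesis .
  qed
  have "l \<le> \<tau> * (2 * ?\<psi> x1 * (r * T) - Z)"
  proof (rule tendsto_upperbound[OF l(1)[unfolded pv_lap_def]])
    have "\<forall>\<^sub>F \<epsilon> in at_right (0::real). 0 < \<epsilon> \<and> \<epsilon> < R/4"
      using R by (intro eventually_at_rightI[of 0 "R/4"]) auto
    then show "\<forall>\<^sub>F \<epsilon> in at_right 0. trunc_lap s v \<epsilon> x1 \<le> \<tau> * (2 * ?\<psi> x1 * (r * T) - Z)"
      by eventually_elim (simp add: trunc)
  qed simp
  then have "\<tau> * (c * (?\<psi> x1)\<^sup>2) \<le> \<tau> * (2 * ?\<psi> x1 * (r * T) - Z)"
    using l(2) by (simp add: v1\<tau> mult_ac)
  then have main: "c * (?\<psi> x1)\<^sup>2 \<le> 2 * ?\<psi> x1 * (r * T) - Z" using \<tau> by simp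
  show ?thesis
  proof (cases "?\<psi> x1 \<le> 1/4")
    case True
    \<comment> \<open>Completing the square absorbs the linear term into \<open>c * \<psi>^2\<close>
      up to \<open>T\<^sup>2 * r\<^sup>2 / c\<close>, of second order in \<open>r\<close>, whereas
      the gain \<open>q * r\<close> is of first order.\<close>
    have "0 \<le> (c * ?\<psi> x1 - T * r)\<^sup>2" by simp
    then have "c * (2 * ?\<psi> x1 * (r * T)) \<le> c * (c * (?\<psi> x1)\<^sup>2) + (T * r)\<^sup>2"
      by (simp add: power2_eq_square algebra_simps)
    moreover have "c * (c * (?\<psi> x1)\<^sup>2) \<le> c * (2 * ?\<psi> x1 * (r * T) - q * r)"
      using main c True by (intro mult_left_mono) (auto simp: Z_def)
    ultimately have "c * q * r \<le> T\<^sup>2 * r * r" by (simp add: power2_eq_square algebra_simps)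
    then have "c * q \<le> T\<^sup>2 * r" using r by simp
    then show ?thesis using r2 by simp
  next
    case False
    then have "?\<psi> x1 * (c * ?\<psi> x1) \<le> ?\<psi> x1 * (2 * T * r)"
      using main by (simp add: Z_def power2_eq_square algebra_simps)
    then have "c * ?\<psi> x1 \<le> 2 * T * r" using psi1 by simp
    moreover have "c * (1/4) \<le> c * ?\<psi> x1" using False c by (intro mult_left_mono) auto
    ultimately show ?thesis using r1 by simp
  qed
qed

section \<open>One-sided Lipschitz bound and mass bound\<close>

lemma lborel_distr_add:
  fixes c :: "'a::euclidean_space"
  shows "distr lborel borel (\<lambda>y. y + c) = lborel"
proof -
  have "(\<lambda>y. y + c) = (+) c" by (auto simp: add.commute)
  then show ?thesis by (simp add: lborel_distr_plus)
qed

lemma pv_lap_isometry: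
  fixes v :: "'a::euclidean_space \<Rightarrow> real" and T :: "'a \<Rightarrow> 'a"
  assumes T: "distr lborel borel T = lborel" and T_meas [measurable]: "T \<in> borel_measurable borel"
    and iso: "\<And>y. norm (T x - T y) = norm (x - y)"
    and v [measurable]: "v \<in> borel_measurable borel"
  shows "pv_lap s (\<lambda>y. v (T y)) x l \<longleftrightarrow> pv_lap s v (T x) l"
proof -
  have "trunc_lap s (\<lambda>y. v (T y)) \<epsilon> x = trunc_lap s v \<epsilon> (T x)" for \<epsilon>
  proof -
    let ?h = "\<lambda>z. indicator (- ball (T x) \<epsilon>) z * ((v (T x) - v z) * frac_kernel s (T x - z))"
    have h: "?h (T y) = indicator (- ball x \<epsilon>) y * ((v (T x) - v (T y)) * frac_kernel s (x - y))" for y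
      using frac_kernel_eqI[OF iso[of y], of s] iso[of y] by (auto simp: indicator_def dist_norm)
    have "trunc_lap s (\<lambda>y. v (T y)) \<epsilon> x = (\<integral>y. ?h (T y) \<partial>lborel)"
      unfolding h trunc_lap_def set_lebesgue_integral_def by simp
    also have "\<dots> = trunc_lap s v \<epsilon> (T x)"
      by (subst lborel_integral_invariant[OF T T_meas, of ?h]) (simp_all add: trunc_lap_def set_lebesgue_integral_def)
    finally show ?thesis .
  qed
  then show ?thesis by (simp add: pv_lap_def)
qed

lemma pv_lap_diff:
  fixes v w :: "'a::euclidean_space \<Rightarrow> real"
  assumes s: "0 < s" "s < 1" and n: "2 \<le> DIM('a)"
    and v: "v \<in> borel_measurable borel" "\<And>y. \<bar>v y\<bar> \<le> B"
    and w: "w \<in> borel_measurable borel" "\<And>y. \<bar>w y\<bar> \<le> B'"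
    and l: "pv_lap s v x l" "pv_lap s w x l'"
  shows "pv_lap s (\<lambda>y. v y - w y) x (l - l')"
proof -
  have "\<forall>\<^sub>F \<epsilon> in at_right 0. trunc_lap s v \<epsilon> x - trunc_lap s w \<epsilon> x = trunc_lap s (\<lambda>y. v y - w y) \<epsilon> x"
  proof (rule eventually_at_rightI[of 0 1])
    fix \<epsilon> :: real assume "\<epsilon> \<in> {0<..<1}"
    then have \<epsilon>: "0 < \<epsilon>" by simp
    have A: "- ball x \<epsilon> \<in> sets borel" "- ball x \<epsilon> \<inter> ball x \<epsilon> = {}" by auto
    show "trunc_lap s v \<epsilon> x - trunc_lap s w \<epsilon> x = trunc_lap s (\<lambda>y. v y - w y) \<epsilon> x"
      unfolding trunc_lap_def
      by (subst set_integral_diff(2)[OF trunc_lap_integrable[OF s n v A(1) \<epsilon> A(2)]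
            trunc_lap_integrable[OF s n w A(1) \<epsilon> A(2)], symmetric])
        (simp add: algebra_simps)
  qed simp
  then show ?thesis using l unfolding pv_lap_def
    by (intro Lim_transform_eventually[OF tendsto_diff]) auto
qed

lemma pv_lap_uminus: "pv_lap s v x l \<Longrightarrow> pv_lap s (\<lambda>y. - v y) x (- l)"
proof -
  have "trunc_lap s (\<lambda>y. - v y) \<epsilon> x = - trunc_lap s v \<epsilon> x" for \<epsilon>
  proof -
    have "trunc_lap s (\<lambda>y. - v y) \<epsilon> x = (LINT y:-ball x \<epsilon>|lborel. - ((v x - v y) * frac_kernel s (x - y)))"
      unfolding trunc_lap_def by (simp add: algebra_simps)
    then show ?thesis unfolding trunc_lap_def by (simp add: set_lebesgue_integral_def)
  qed
  then show "pv_lap s v x l \<Longrightarrow> pv_lap s (\<lambda>y. - v y) x (- l)"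
    unfolding pv_lap_def by (simp add: tendsto_minus)
qed

text \<open>A cylinder of size \<open>\<rho>\<close> at height \<open>\<rho>\<close> above
  \<open>x\<close>. The product shape makes the part lost under a vertical shift a slab of explicit
  volume, as \<open>vdiff_integral_ge\<close> requires.\<close>

definition probe :: "'b::euclidean_space \<times> real \<Rightarrow> real \<Rightarrow> ('b \<times> real) set" where
  "probe x \<rho> = ball (fst x) \<rho> \<times> {snd x + \<rho>..snd x + 2 * \<rho>}"

lemma borel_Times_interval [measurable]: "ball (a::'b::euclidean_space) \<rho> \<times> {c..d::real} \<in> sets borel"
  by (rule borel_Times) auto

lemma bounded_Times_interval: "bounded (ball (a::'b::euclidean_space) \<rho> \<times> {c..d::real})"
  by (intro bounded_Times) auto

lemma measure_Times_interval:
  assumes "0 \<le> \<rho>" "c \<le> d"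
  shows "measure lborel (ball (a::'b::euclidean_space) \<rho> \<times> {c..d::real}) =
    \<rho> ^ DIM('b) * measure lborel (ball (0::'b) 1) * (d - c)"
proof -
  have "emeasure lborel (ball a \<rho> \<times> {c..d}) = emeasure lborel (ball a \<rho>) * emeasure lborel {c..d}"
    by (subst lborel_prod[symmetric], subst lborel.emeasure_pair_measure_Times) auto
  then have "measure lborel (ball a \<rho> \<times> {c..d}) = measure lborel (ball a \<rho>) * (d - c)"
    using assms by (simp add: measure_def enn2real_mult)
  then show ?thesis using content_ball_conv_unit_ball[OF assms(1), of a] by simp
qed

lemma probe_sets [measurable]: "probe x \<rho> \<in> sets borel"
  unfolding probe_def by simp

lemma bounded_probe: "bounded (probe x \<rho>)"
  unfolding probe_def by (rule bounded_Times_interval)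

lemma probe_far:
  assumes "0 < \<rho>" shows "probe x \<rho> \<inter> ball x \<rho> = {}"
proof -
  have "\<not> dist x y < \<rho>" if "y \<in> probe x \<rho>" for y
    using dist_snd_le[of x y] that assms by (auto simp: probe_def dist_real_def)
  then show ?thesis by auto
qed

lemma probe_near:
  assumes "y \<in> probe x \<rho>" "0 < \<rho>" shows "norm (x - y) \<le> 3 * \<rho>"
proof -
  have "norm (x - y) \<le> norm (fst x - fst y) + norm (snd x - snd y)"
    using norm_Pair_le[of "fst x - fst y" "snd x - snd y"] by (simp add: minus_prod_def)
  then show ?thesis using assms by (auto simp: probe_def dist_norm)
qed

lemma probe_measure:
  assumes "0 < \<rho>"
  shows "measure lborel (probe (x::'b::euclidean_space \<times> real) \<rho>) = \<rho> ^ DIM('b) * measure lborel (ball (0::'b) 1) * \<rho>"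
  unfolding probe_def using assms by (subst measure_Times_interval) auto

text \<open>Kernel times volume of a probe scales like \<open>\<rho> powr (- 2 * s)\<close>, so thin probes defeat any fixed constant.\<close>

lemma probe_strength:
  assumes s: "0 < s"
  obtains \<rho> where "0 < \<rho>" "\<rho> \<le> 1/3"
    "\<And>x::'b::euclidean_space \<times> real. A \<le> (3 * \<rho>) powr - (real DIM('b \<times> real) + 2 * s) * measure lborel (probe x \<rho>)"
proof -
  define W where "W = measure lborel (ball (0::'b) 1)"
  define p where "p = real DIM('b \<times> real) + 2 * s"
  have W: "0 < W" unfolding W_def by (rule content_ball_pos) simp
  define e where "e = 3 powr - p * W / (\<bar>A\<bar> + 1)"
  have e: "0 < e" using W by (simp add: e_def)
  obtain R where R: "0 < R" "3 \<le> R" "R powr (- 2 * s) < e" using powr_neg_small[OF s e] by blast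
  define \<rho> where "\<rho> = 1 / R"
  have \<rho>: "0 < \<rho>" "\<rho> \<le> 1/3" using R by (auto simp: \<rho>_def field_simps)
  have "A \<le> (3 * \<rho>) powr - p * measure lborel (probe x \<rho>)" for x :: "'b \<times> real"
  proof -
    have "measure lborel (probe x \<rho>) = W * \<rho> powr real DIM('b \<times> real)"
      using \<rho> by (simp add: probe_measure W_def powr_realpow powr_add)
    then have "(3 * \<rho>) powr - p * measure lborel (probe x \<rho>) = 3 powr - p * W * (\<rho> powr - p * \<rho> powr real DIM('b \<times> real))"
      using \<rho> by (simp add: powr_mult)
    also have "\<rho> powr - p * \<rho> powr real DIM('b \<times> real) = \<rho> powr (- 2 * s)"
      unfolding p_def by (simp flip: powr_add)
    also have "\<dots> = 1 / R powr (- 2 * s)" using R by (simp add: \<rho>_def powr_divide)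
    finally have eq: "(3 * \<rho>) powr - p * measure lborel (probe x \<rho>) = 3 powr - p * W / R powr (- 2 * s)" by simp
    have "R powr (- 2 * s) * (\<bar>A\<bar> + 1) < 3 powr - p * W" using R(3) by (simp add: e_def field_simps)
    then have "\<bar>A\<bar> + 1 < 3 powr - p * W / R powr (- 2 * s)" using R by (simp add: field_simps)
    then show ?thesis unfolding eq by linarith
  qed
  then show ?thesis using that[of \<rho>] \<rho> unfolding p_def by blast
qed

lemma le_of_perturbation:
  fixes a b c m :: real
  assumes "0 < m" "\<And>\<delta>. 0 < \<delta> \<Longrightarrow> \<delta> < m \<Longrightarrow> a \<le> b + \<delta> * c"
  shows "a \<le> b"
proof (rule tendsto_lowerbound)
  show "((\<lambda>\<delta>. b + \<delta> * c) \<longlongrightarrow> b) (at_right 0)"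
    by (rule tendsto_eq_intros refl tendsto_ident_at | simp)+
  show "\<forall>\<^sub>F \<delta> in at_right 0. a \<le> b + \<delta> * c"
    using assms by (intro eventually_at_rightI[of 0 m]) auto
qed simp

text \<open>Inside its ball the paraboloid has slope at most \<open>2 / R\<close>, so for large
  \<open>R\<close> a bump hardly varies over a probe.\<close>

lemma bump_decrease_le:
  assumes R: "0 < R" and x: "x \<in> ball x0 R" and y: "norm (x - y) \<le> 1"
  shows "bump x0 R y - bump x0 R x \<le> 2 / R"
proof (cases "y \<in> ball x0 R")
  case False
  moreover have "0 \<le> 2 / R" using R by simp
  ultimately show ?thesis using bump_zero[OF R False] bump_bounds(1)[of x0 R x] by linarith
next
  case True
  let ?a = "norm (x - x0)" and ?b = "norm (y - x0)"
  have ab: "?a < R" "?b < R" using x True by (auto simp: dist_norm norm_minus_commute)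
  have "bump x0 R y = 1 - ?b\<^sup>2 / R\<^sup>2" using bump_pos_iff[OF R, of x0 y] True by (auto simp: bump_def)
  moreover have "bump x0 R x = 1 - ?a\<^sup>2 / R\<^sup>2" using bump_pos_iff[OF R, of x0 x] x by (auto simp: bump_def)
  ultimately have "bump x0 R y - bump x0 R x = (?a\<^sup>2 - ?b\<^sup>2) / R\<^sup>2" by (simp add: diff_divide_distrib)
  also have "?a\<^sup>2 - ?b\<^sup>2 = (?a - ?b) * (?a + ?b)" by (simp add: power2_eq_square algebra_simps)
  also have "\<dots> \<le> 1 * (?a + ?b)"
    using norm_triangle_ineq2[of "x - x0" "y - x0"] y by (intro mult_right_mono) auto
  also have "\<dots> \<le> 2 * R" using ab by simp
  finally have "bump x0 R y - bump x0 R x \<le> 2 * R / R\<^sup>2" using R by (simp add: divide_right_mono)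
  then show ?thesis using R by (simp add: power2_eq_square)
qed

section \<open>A fixed solution: vertical increments and mass\<close>

locale half_space_solution =
  fixes s :: real and f :: "real \<Rightarrow> real" and u :: "'b::euclidean_space \<times> real \<Rightarrow> real" and M L :: real
  assumes s: "0 < s" "s < 1"
    and cont_u: "continuous_on UNIV u"
    and u_nonneg: "\<And>x. 0 \<le> u x" and u_le: "\<And>x. u x \<le> M"
    and u_zero: "\<And>x. snd x \<le> 0 \<Longrightarrow> u x = 0"
    and pv: "\<And>x. 0 < snd x \<Longrightarrow> pv_lap s u x (f (u x))"
    and L: "0 < L" and lip: "\<And>a b. a \<in> {0..M} \<Longrightarrow> b \<in> {0..M} \<Longrightarrow> \<bar>f a - f b\<bar> \<le> L * \<bar>a - b\<bar>"
    and f_mono: "\<And>a b. 0 \<le> a \<Longrightarrow> a \<le> b \<Longrightarrow> b \<le> M \<Longrightarrow> f a \<le> f b"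
begin

lemma dim: "2 \<le> DIM('b \<times> real)"
  by (simp add: Suc_le_eq)

lemma M_nonneg: "0 \<le> M"
  using u_nonneg u_le order.trans by blast

lemma u_abs_le: "\<bar>u x\<bar> \<le> M"
  using u_nonneg[of x] u_le[of x] by simp

lemma u_meas [measurable]: "u \<in> borel_measurable borel"
  using cont_u by (rule borel_measurable_continuous_onI)

lemma u_range: "u x \<in> {0..M}"
  using u_nonneg u_le by simp

lemma u_integrable_on: "S \<in> sets borel \<Longrightarrow> bounded S \<Longrightarrow> set_integrable lborel S u"
  by (rule set_integrable_bounded_set[OF _ _ u_meas u_abs_le])

definition vdiff :: "real \<Rightarrow> 'b \<times> real \<Rightarrow> real" where
  "vdiff h x = u (x + (0, h)) - u x"

lemma cont_vdiff: "continuous_on UNIV (vdiff h)"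
  unfolding vdiff_def
  by (intro continuous_intros cont_u continuous_on_compose2[OF cont_u, of UNIV "\<lambda>x. x + (0, h)"]) auto

lemma vdiff_abs_le: "\<bar>vdiff h x\<bar> \<le> M"
  using u_nonneg[of x] u_le[of x] u_nonneg[of "x + (0,h)"] u_le[of "x + (0,h)"] by (simp add: vdiff_def)

lemma vdiff_meas [measurable]: "vdiff h \<in> borel_measurable borel"
  using cont_vdiff by (rule borel_measurable_continuous_onI)

lemma vdiff_pv:
  assumes "0 < snd x" "0 < h"
  shows "pv_lap s (vdiff h) x (f (u (x + (0, h))) - f (u x))"
proof -
  have "pv_lap s (\<lambda>y. u (y + (0, h))) x (f (u (x + (0, h))))"
    using pv[of "x + (0, h)"] assms by (subst pv_lap_isometry) (auto simp: lborel_distr_add)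
  from pv_lap_diff[OF s dim _ _ u_meas u_abs_le this pv[OF assms(1)], of M]
  show ?thesis using u_abs_le unfolding vdiff_def by simp
qed

text \<open>The integral is the mass of \<open>u\<close> on the raised cylinder \<open>?P\<close>
  minus that on \<open>?S\<close>. What \<open>?S\<close> loses lies in the bottom slab
  \<open>?Q\<close> of height \<open>h\<close>, hence a loss linear in \<open>h\<close>, without any
  modulus of continuity of \<open>u\<close>.\<close>

lemma vdiff_integral_ge:
  assumes h: "0 < h" and \<rho>: "0 < \<rho>"
  shows "- M * h * (\<rho> ^ DIM('b) * measure lborel (ball (0::'b) 1)) \<le> (LINT y:probe x \<rho>|lborel. vdiff h y)"
proof -
  define A where "A = ball (fst x) \<rho>"
  define a b where "a = snd x + \<rho>" and "b = snd x + 2 * \<rho>"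
  let ?S = "A \<times> {a..b}" and ?P = "A \<times> {a + h..b + h}" and ?Q = "A \<times> {a..a + h}"
  have P: "probe x \<rho> = ?S" by (simp add: probe_def A_def a_def b_def)
  have sets: "?S \<in> sets borel" "?P \<in> sets borel" "?Q \<in> sets borel"
    and bdd: "bounded ?S" "bounded ?P" "bounded ?Q"
    unfolding A_def by (auto intro: bounded_Times_interval)
  note i = u_integrable_on[OF sets(1) bdd(1)] u_integrable_on[OF sets(2) bdd(2)] u_integrable_on[OF sets(3) bdd(3)]
  have ind: "indicator ?P (y + (0, h)) = (indicator ?S y :: real)" for y
    by (cases y) (auto simp: indicator_def)
  have shift: "(LINT y:?S|lborel. u (y + (0, h))) = (LINT y:?P|lborel. u y)"
    using lborel_integral_invariant[OF lborel_distr_add[of "(0, h)"], of "\<lambda>z. indicator ?P z * u z"] sets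
    by (simp add: set_lebesgue_integral_def ind)
  have ishift: "set_integrable lborel ?S (\<lambda>y. u (y + (0, h)))"
    using sets bdd u_abs_le by (intro set_integrable_bounded_set) auto
  have "(LINT y:?S|lborel. u y) \<le> (LINT y:?P|lborel. u y) + (LINT y:?Q|lborel. u y)"
  proof -
    have "(LINT y:?S|lborel. u y) \<le> (\<integral>y. indicator ?P y *\<^sub>R u y + indicator ?Q y *\<^sub>R u y \<partial>lborel)"
      unfolding set_lebesgue_integral_def using i h unfolding set_integrable_def
      by (intro integral_mono) (auto simp: indicator_def u_nonneg)
    then show ?thesis using i(2,3) unfolding set_integrable_def set_lebesgue_integral_def by simp
  qed
  moreover have "(LINT y:?Q|lborel. u y) \<le> M * measure lborel ?Q"
  proof -
    have "- M * measure lborel ?Q \<le> (LINT y:?Q|lborel. - u y)"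
      using u_le u_abs_le by (intro set_integral_ge_const sets bdd set_integrable_bounded_set) auto
    then show ?thesis using set_integral_uminus[OF i(3)] by simp
  qed
  moreover have "measure lborel ?Q = \<rho> ^ DIM('b) * measure lborel (ball (0::'b) 1) * h"
    unfolding A_def using \<rho> h by (subst measure_Times_interval) auto
  moreover have "(LINT y:?S|lborel. vdiff h y) = (LINT y:?P|lborel. u y) - (LINT y:?S|lborel. u y)"
    unfolding vdiff_def by (subst set_integral_diff(2)[OF ishift i(1)]) (simp add: shift)
  ultimately show ?thesis unfolding P by (simp add: algebra_simps)
qed

text \<open>Near an infimum \<open>- m\<close> the equation gives a Laplacian at least
  \<open>- L * m\<close>. On a probe the gap has mass about \<open>m\<close> times the volume, up to
  the loss \<open>O(h)\<close> of \<open>vdiff_integral_ge\<close>. With probe strength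
  \<open>2 * L\<close> the gain exceeds \<open>L * m\<close> unless \<open>m = O(h)\<close>.\<close>

lemma vdiff_one_sided_Lipschitz: "\<exists>C>0. \<forall>h>0. \<forall>x. - C * h \<le> vdiff h x"
proof -
  define T where "T = kernel_const TYPE('b \<times> real) s"
  define k where "k \<rho> = (3 * \<rho>) powr - (real DIM('b \<times> real) + 2 * s)" for \<rho>
  define W where "W \<rho> = \<rho> ^ DIM('b) * measure lborel (ball (0::'b) 1)" for \<rho>
  obtain \<rho> where \<rho>: "0 < \<rho>" "\<rho> \<le> 1/3" and strength: "2 * L \<le> k \<rho> * (W \<rho> * \<rho>)"
    using probe_strength[OF s(1), of "2 * L", where 'b='b] unfolding k_def W_def
    by (metis probe_measure)
  have k: "0 < k \<rho>" using \<rho> by (simp add: k_def)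
  have W: "0 < W \<rho>" using \<rho> content_ball_pos[of 1 "0::'b"] by (simp add: W_def)
  \<comment> \<open>The probe estimate yields \<open>m \<le> 2 * M / \<rho> * h\<close>; the added 1
    keeps \<open>C\<close> positive when \<open>M = 0\<close>.\<close>
  define C where "C = 2 * M / \<rho> + 1"
  have C: "0 < C" using M_nonneg \<rho> by (simp add: C_def add_nonneg_pos)
  have "- C * h \<le> vdiff h x" if h: "0 < h" for h x
  proof (rule ccontr)
    assume neg: "\<not> - C * h \<le> vdiff h x"
    define m where "m = - Inf (range (vdiff h))"
    have bdd: "bdd_below (range (vdiff h))"
      using vdiff_abs_le[of h] by (intro bdd_belowI[of _ "- M"]) (auto simp: abs_le_iff minus_le_iff)
    have inf: "- m \<le> vdiff h y" for y unfolding m_def using bdd by (auto intro: cInf_lower)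
    have mC: "C * h < m" using inf[of x] neg by linarith
    then have m: "0 < m" using C h by (smt (verit) mult_pos_pos)
    have "k \<rho> * W \<rho> * (m * \<rho> - M * h) \<le> L * m"
    proof (rule le_of_perturbation[OF m])
      fix \<delta> :: real assume \<delta>: "0 < \<delta>" "\<delta> < m"
      obtain x0 where x0: "vdiff h x0 < - m + \<delta>"
        using cInf_lessD[of "range (vdiff h)" "- m + \<delta>"] \<delta> unfolding m_def by auto
      obtain x1 where x1: "x1 \<in> ball x0 1" "vdiff h x1 \<le> vdiff h x0"
        "\<And>y. vdiff h x1 - vdiff h y \<le> \<delta> * (bump x0 1 x1 - bump x0 1 y)"
        using ball_touching_exists[OF cont_vdiff, of 1 \<delta> x0 h] inf x0 \<delta>(1)
        by (smt (verit))
      have vneg: "vdiff h x1 < - m + \<delta>" using x1 x0 by linarith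
      have pos: "0 < snd x1"
      proof (rule ccontr)
        assume "\<not> 0 < snd x1"
        then have "u x1 = 0" by (intro u_zero) simp
        then have "0 \<le> vdiff h x1" using u_nonneg by (simp add: vdiff_def)
        then show False using vneg \<delta> by linarith
      qed
      let ?G = "\<lambda>y. \<delta> * (bump x0 1 x1 - bump x0 1 y) - (vdiff h x1 - vdiff h y)"
      let ?S = "probe x1 \<rho>"
      have touch: "f (u (x1 + (0, h))) - f (u x1) \<le> \<delta> * (1 powr (- 2 * s) * kernel_const TYPE('b \<times> real) s) -
          (LINT y:?S|lborel. ?G y * frac_kernel s (x1 - y))"
        using \<delta> x1 \<rho> probe_far[OF \<rho>(1), of x1]
        by (intro pv_lap_touch[OF s dim vdiff_meas vdiff_abs_le vdiff_pv[OF pos h], where r=\<rho>]) auto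
      have "\<bar>f (u (x1 + (0, h))) - f (u x1)\<bar> \<le> L * \<bar>vdiff h x1\<bar>"
        unfolding vdiff_def by (rule lip[OF u_range u_range])
      moreover have "\<bar>vdiff h x1\<bar> \<le> m" using inf[of x1] vneg \<delta> by linarith
      ultimately have lower: "- (L * m) \<le> f (u (x1 + (0, h))) - f (u x1)"
        using L by (smt (verit) mult_left_mono)
      have Gabs: "\<bar>?G y\<bar> \<le> \<delta> * 2 + 2 * M" for y
      proof -
        have "\<bar>bump x0 1 x1 - bump x0 1 y\<bar> \<le> 2" using bump_bounds[of x0 1] by (smt (verit))
        then have "\<bar>\<delta> * (bump x0 1 x1 - bump x0 1 y)\<bar> \<le> \<delta> * 2" using \<delta> by (simp add: abs_mult)
        then show ?thesis using vdiff_abs_le[of h x1] vdiff_abs_le[of h y] by linarith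
      qed
      have iG: "set_integrable lborel ?S ?G"
        using Gabs by (intro set_integrable_bounded_set bounded_probe) auto
      have iGk: "set_integrable lborel ?S (\<lambda>y. ?G y * frac_kernel s (x1 - y))"
        using Gabs \<rho> probe_far[OF \<rho>(1), of x1] by (intro set_integrable_frac_kernel[OF s dim]) auto
      have kG: "k \<rho> * (LINT y:?S|lborel. ?G y) \<le> (LINT y:?S|lborel. ?G y * frac_kernel s (x1 - y))"
      proof (rule kernel_integral_lower[OF _ iG iGk])
        fix y assume y: "y \<in> ?S"
        then have "x1 \<noteq> y" using probe_far[OF \<rho>(1), of x1] \<rho> by auto
        then show "k \<rho> \<le> frac_kernel s (x1 - y)"
          unfolding k_def using probe_near[OF y \<rho>(1)] s by (intro frac_kernel_ge) auto
        show "0 \<le> ?G y" using x1(3)[of y] by simp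
      qed simp
      have iv: "set_integrable lborel ?S (vdiff h)"
        by (intro set_integrable_bounded_set[OF _ bounded_probe vdiff_meas vdiff_abs_le]) simp
      \<comment> \<open>One \<open>\<delta>\<close> is lost because \<open>x1\<close> is only an
        almost-minimum, another because the bump at \<open>x1\<close> may fall below its value at
        \<open>y\<close>.\<close>
      have "(m - 2 * \<delta>) * measure lborel ?S \<le> (LINT y:?S|lborel. ?G y - vdiff h y)"
      proof (rule set_integral_ge_const[OF _ bounded_probe])
        show "set_integrable lborel ?S (\<lambda>y. ?G y - vdiff h y)" by (rule set_integral_diff(1)[OF iG iv])
        fix y
        have "- 1 \<le> bump x0 1 x1 - bump x0 1 y" using bump_bounds[of x0 1] by (smt (verit))
        then have "\<delta> * - 1 \<le> \<delta> * (bump x0 1 x1 - bump x0 1 y)" using \<delta> by (intro mult_left_mono) auto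
        then show "m - 2 * \<delta> \<le> ?G y - vdiff h y" using vneg by linarith
      qed simp
      moreover have "(LINT y:?S|lborel. ?G y - vdiff h y) = (LINT y:?S|lborel. ?G y) - (LINT y:?S|lborel. vdiff h y)"
        by (rule set_integral_diff(2)[OF iG iv])
      moreover have "measure lborel ?S = W \<rho> * \<rho>" unfolding W_def by (rule probe_measure[OF \<rho>(1)])
      moreover have "- M * h * W \<rho> \<le> (LINT y:?S|lborel. vdiff h y)"
        unfolding W_def by (rule vdiff_integral_ge[OF h \<rho>(1)])
      ultimately have "(m - 2 * \<delta>) * (W \<rho> * \<rho>) - M * h * W \<rho> \<le> (LINT y:?S|lborel. ?G y)" by simp
      then have "k \<rho> * ((m - 2 * \<delta>) * (W \<rho> * \<rho>) - M * h * W \<rho>) \<le> k \<rho> * (LINT y:?S|lborel. ?G y)"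
        using k by (intro mult_left_mono) auto
      also have "\<dots> \<le> L * m + \<delta> * T" using kG touch lower by (simp add: T_def)
      finally show "k \<rho> * W \<rho> * (m * \<rho> - M * h) \<le> L * m + \<delta> * (T + 2 * k \<rho> * W \<rho> * \<rho>)"
        by (simp add: algebra_simps)
    qed
    moreover have "2 * L * m \<le> k \<rho> * (W \<rho> * \<rho>) * m" using strength m by (intro mult_right_mono) auto
    ultimately have "k \<rho> * W \<rho> * (m * \<rho>) \<le> k \<rho> * W \<rho> * (2 * M * h)" by (simp add: algebra_simps)
    then have "m * \<rho> \<le> 2 * M * h" using k W by simp
    then have "m \<le> 2 * M / \<rho> * h" using \<rho> by (simp add: field_simps)
    then show False using mC h by (simp add: C_def algebra_simps)
  qed
  then show ?thesis using C by blast
qed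

text \<open>The equation is used twice at a point \<open>p\<close> where a bump touches
  \<open>u\<close> from above. Without a gain it gives \<open>u p > \<tau>\<close>, since
  \<open>f\<close> is too negative below \<open>\<tau>\<close>. With the gain on a probe it turns
  this point value into mass: little mass near \<open>p\<close> would leave a gap too large for the
  bound \<open>f (u p) \<le> f M\<close>.\<close>

lemma mass_lower_bound:
  assumes f0: "f 0 < 0"
  shows "\<exists>R>0. \<exists>\<eta>>0. \<forall>z. R \<le> snd z \<longrightarrow> \<eta> \<le> (LINT y:ball z (R + 1)|lborel. u y)"
proof -
  define T where "T = kernel_const TYPE('b \<times> real) s"
  have T: "0 \<le> T" unfolding T_def by (rule kernel_const_nonneg)
  define a where "a = - f 0"
  have a: "0 < a" using f0 by (simp add: a_def)
  \<comment> \<open>Larger than the oscillation of \<open>u\<close>, so a contact point exists in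
    every ball, whatever its centre.\<close>
  define \<delta> where "\<delta> = M + 1"
  have \<delta>: "0 < \<delta>" using M_nonneg by (simp add: \<delta>_def)
  \<comment> \<open>By the Lipschitz bound \<open>f\<close> stays below \<open>- a / 2\<close> on
    \<open>[0, \<tau>]\<close>.\<close>
  define \<tau> where "\<tau> = a / (2 * L)"
  have \<tau>: "0 < \<tau>" using a L by (simp add: \<tau>_def)
  have small: "f t \<le> - a / 2" if "0 \<le> t" "t \<le> \<tau>" "t \<le> M" for t
  proof -
    have "f t - f 0 \<le> L * t" using lip[of t 0] that M_nonneg by auto
    also have "L * t \<le> L * \<tau>" using that L by simp
    also have "L * \<tau> = a / 2" using L by (simp add: \<tau>_def)
    finally show ?thesis by (simp add: a_def)
  qed
  define Q where "Q = \<bar>f M\<bar> + a"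
  define k where "k \<rho> = (3 * \<rho>) powr - (real DIM('b \<times> real) + 2 * s)" for \<rho>
  \<comment> \<open>\<open>Q\<close> bounds the kernel-weighted gap. This strength forces the gap to
    have mass at most \<open>\<tau> / 4\<close> times the volume, against \<open>\<tau> / 2\<close>
    times the volume minus the mass of \<open>u\<close> available from below; the remaining quarter
    is \<open>\<eta>\<close>.\<close>
  obtain \<rho> where \<rho>: "0 < \<rho>" "\<rho> \<le> 1/3" and strength: "\<And>x::'b \<times> real. 4 * Q / \<tau> \<le> k \<rho> * measure lborel (probe x \<rho>)"
    using probe_strength[OF s(1), of "4 * Q / \<tau>", where 'b='b] unfolding k_def by metis
  have k: "0 < k \<rho>" using \<rho> by (simp add: k_def)
  \<comment> \<open>The lower bound on \<open>R\<close> keeps the variation of the bump over a probe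
    below \<open>\<tau> / 2\<close>; the other bound keeps the Laplacian of the bump below
    \<open>a / 2\<close>.\<close>
  obtain R where R: "0 < R" "4 * \<delta> / \<tau> \<le> R" "R powr (- 2 * s) < a / (2 * \<delta> * (T + 1))"
    using powr_neg_small[OF s(1), of "a / (2 * \<delta> * (T + 1))" "4 * \<delta> / \<tau>"] a \<delta> T by auto
  have small_T: "\<delta> * (R powr (- 2 * s) * T) < a / 2"
  proof -
    have "R powr (- 2 * s) * (2 * \<delta> * (T + 1)) < a" using R(3) \<delta> T by (simp add: pos_less_divide_eq)
    moreover have "0 \<le> R powr (- 2 * s) * \<delta>" using \<delta> by simp
    ultimately show ?thesis by (simp add: algebra_simps)
  qed
  define \<eta> where "\<eta> = \<tau> / 4 * measure lborel (probe (0::'b \<times> real) \<rho>)"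
  have vol: "measure lborel (probe x \<rho>) = measure lborel (probe (0::'b \<times> real) \<rho>)" for x :: "'b \<times> real"
    using \<rho> by (simp add: probe_measure)
  have \<eta>: "0 < \<eta>" using \<tau> \<rho> content_ball_pos[of 1 "0::'b"] by (simp add: \<eta>_def probe_measure)
  have "\<eta> \<le> (LINT y:ball z (R + 1)|lborel. u y)" if z: "R \<le> snd z" for z
  proof -
    have contm: "continuous_on UNIV (\<lambda>y. - u y)" using cont_u by (intro continuous_intros)
    have "\<exists>p\<in>ball z R. - u p \<le> - u z \<and> (\<forall>y. - u p - - u y \<le> \<delta> * (bump z R p - bump z R y))"
    proof (rule ball_touching_exists[OF contm R(1)])
      fix y show "- u z - \<delta> < - u y" using u_le[of y] u_nonneg[of z] by (simp add: \<delta>_def)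
    qed (use \<delta> in simp)
    then obtain p where p: "p \<in> ball z R" "\<And>y. - u p - - u y \<le> \<delta> * (bump z R p - bump z R y)" by blast
    have pos: "0 < snd p" using dist_snd_le[of z p] p(1) z by (simp add: dist_real_def)
    let ?G = "\<lambda>y. \<delta> * (bump z R p - bump z R y) - (- u p - - u y)"
    have meas: "(\<lambda>y. - u y) \<in> borel_measurable borel" by measurable
    have touch: "- f (u p) \<le> \<delta> * (R powr (- 2 * s) * kernel_const TYPE('b \<times> real) s) -
        (LINT y:S|lborel. ?G y * frac_kernel s (p - y))"
      if "S \<in> sets borel" "S \<inter> ball p \<rho> = {}" for S
      using that \<delta> p R \<rho> u_abs_le
      by (intro pv_lap_touch[OF s dim meas _ pv_lap_uminus[OF pv[OF pos]], where B=M and r=\<rho>]) auto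
    have "- f (u p) \<le> \<delta> * (R powr (- 2 * s) * T)"
      using touch[of "{}"] by (simp add: T_def set_lebesgue_integral_def)
    then have "- f (u p) < a / 2" using small_T by linarith
    then have up: "\<tau> < u p" using small[of "u p"] u_nonneg[of p] u_le[of p] by linarith
    let ?S = "probe p \<rho>"
    have Gabs: "\<bar>?G y\<bar> \<le> \<delta> * 2 + 2 * M" for y
    proof -
      have "\<bar>bump z R p - bump z R y\<bar> \<le> 2" using bump_bounds[of z R] by (smt (verit))
      then have "\<bar>\<delta> * (bump z R p - bump z R y)\<bar> \<le> \<delta> * 2" using \<delta> by (simp add: abs_mult)
      then show ?thesis using u_abs_le[of p] u_abs_le[of y] by linarith
    qed
    have iG: "set_integrable lborel ?S ?G"
      using Gabs by (intro set_integrable_bounded_set bounded_probe) auto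
    have iGk: "set_integrable lborel ?S (\<lambda>y. ?G y * frac_kernel s (p - y))"
      using Gabs \<rho> probe_far[OF \<rho>(1), of p] by (intro set_integrable_frac_kernel[OF s dim]) auto
    have kG: "k \<rho> * (LINT y:?S|lborel. ?G y) \<le> (LINT y:?S|lborel. ?G y * frac_kernel s (p - y))"
    proof (rule kernel_integral_lower[OF _ iG iGk])
      fix y assume y: "y \<in> ?S"
      then have "p \<noteq> y" using probe_far[OF \<rho>(1), of p] \<rho> by auto
      then show "k \<rho> \<le> frac_kernel s (p - y)"
        unfolding k_def using probe_near[OF y \<rho>(1)] s by (intro frac_kernel_ge) auto
      show "0 \<le> ?G y" using p(2)[of y] by simp
    qed simp
    have iu: "set_integrable lborel ?S u" by (intro u_integrable_on bounded_probe) simp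
    have "\<tau> / 2 * measure lborel ?S \<le> (LINT y:?S|lborel. ?G y + u y)"
    proof (rule set_integral_ge_const[OF _ bounded_probe])
      show "set_integrable lborel ?S (\<lambda>y. ?G y + u y)" by (rule set_integral_add(1)[OF iG iu])
      fix y assume y: "y \<in> ?S"
      have "norm (p - y) \<le> 1" using probe_near[OF y \<rho>(1)] \<rho> by simp
      then have "- (2 / R) \<le> bump z R p - bump z R y" using bump_decrease_le[OF R(1) p(1), of y] by simp
      then have "\<delta> * - (2 / R) \<le> \<delta> * (bump z R p - bump z R y)" using \<delta> by (intro mult_left_mono) auto
      moreover have "\<delta> * (2 / R) \<le> \<tau> / 2" using R(1,2) \<tau> by (simp add: field_simps)
      ultimately show "\<tau> / 2 \<le> ?G y + u y" using up by simp
    qed simp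
    then have G: "\<tau> / 2 * measure lborel ?S - (LINT y:?S|lborel. u y) \<le> (LINT y:?S|lborel. ?G y)"
      using set_integral_add(2)[OF iG iu] by simp
    have "(LINT y:?S|lborel. ?G y * frac_kernel s (p - y)) \<le> Q"
    proof -
      have "f (u p) \<le> f M" by (rule f_mono[OF u_nonneg u_le]) simp
      moreover have "- f (u p) \<le> \<delta> * (R powr (- 2 * s) * T) - (LINT y:?S|lborel. ?G y * frac_kernel s (p - y))"
        unfolding T_def by (rule touch[OF _ probe_far[OF \<rho>(1)]]) simp
      ultimately show ?thesis using small_T a unfolding Q_def by linarith
    qed
    then have "k \<rho> * (\<tau> / 2 * measure lborel ?S - (LINT y:?S|lborel. u y)) \<le> Q"
      using kG mult_left_mono[OF G, of "k \<rho>"] k by linarith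
    moreover have "Q \<le> k \<rho> * (\<tau> / 4 * measure lborel ?S)"
    proof -
      have "\<tau> / 4 * (4 * Q / \<tau>) \<le> \<tau> / 4 * (k \<rho> * measure lborel ?S)"
        using strength[of p] \<tau> by (intro mult_left_mono) auto
      then show ?thesis using \<tau> by (simp add: mult_ac)
    qed
    ultimately have "k \<rho> * (\<tau> / 2 * measure lborel ?S - (LINT y:?S|lborel. u y)) \<le> k \<rho> * (\<tau> / 4 * measure lborel ?S)"
      by linarith
    then have "\<tau> / 2 * measure lborel ?S - (LINT y:?S|lborel. u y) \<le> \<tau> / 4 * measure lborel ?S"
      using k by simp
    then have "\<eta> \<le> (LINT y:?S|lborel. u y)" unfolding \<eta>_def using vol[of p] by simp
    also have "\<dots> \<le> (LINT y:ball z (R + 1)|lborel. u y)"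
    proof (rule set_integral_mono_set)
      show "?S \<subseteq> ball z (R + 1)"
      proof
        fix y assume y: "y \<in> ?S"
        have "dist z y \<le> dist z p + dist p y" by (rule dist_triangle)
        also have "dist p y \<le> 1" using probe_near[OF y \<rho>(1)] \<rho> by (simp add: dist_norm)
        finally show "y \<in> ball z (R + 1)" using p(1) by simp
      qed
    qed (auto simp: u_nonneg intro: u_integrable_on)
    finally show ?thesis .
  qed
  then show ?thesis using R(1) \<eta> by blast
qed

end

section \<open>Reflection across a hyperplane\<close>

definition vreflect :: "real \<Rightarrow> 'b::euclidean_space \<times> real \<Rightarrow> 'b \<times> real" where
  "vreflect \<mu> y = (fst y, 2 * \<mu> - snd y)"

lemma vreflect_simps [simp]:
  "fst (vreflect \<mu> y) = fst y" "snd (vreflect \<mu> y) = 2 * \<mu> - snd y" "vreflect \<mu> (vreflect \<mu> y) = y"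
  by (auto simp: vreflect_def)

lemma vreflect_measurable [measurable]: "vreflect \<mu> \<in> borel_measurable borel"
  unfolding vreflect_def by (intro borel_measurable_continuous_onI continuous_intros)

lemma half_space_below_sets [measurable]: "{y::'b::euclidean_space \<times> real. snd y < \<mu>} \<in> sets borel"
  by (intro borel_open open_Collect_less continuous_intros)

lemma lborel_distr_vreflect: "distr lborel borel (vreflect \<mu>) = lborel"
  using lborel_distr_Pair[of "\<lambda>y::'a. y" "\<lambda>t. 2 * \<mu> - t"] lborel_distr_diff[of "2 * \<mu>"]
  by (simp add: vreflect_def[abs_def] distr_id2)

lemma norm_sq_prod: "(norm (z::'b::euclidean_space \<times> real))\<^sup>2 = (norm (fst z))\<^sup>2 + (snd z)\<^sup>2"
  by (simp add: norm_prod_def)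

lemma norm_vreflect_diff: "norm (vreflect \<mu> x - vreflect \<mu> y) = norm (x - y)"
  unfolding power2_eq_iff_nonneg[OF norm_ge_zero norm_ge_zero, symmetric] norm_sq_prod
  by (simp add: power2_commute)

lemma norm_vreflect_diff_left: "norm (x - vreflect \<mu> y) = norm (vreflect \<mu> x - y)"
  using norm_vreflect_diff[of \<mu> x "vreflect \<mu> y"] by simp

text \<open>The product is positive for points on the same side of the plane, and its size measures
  how much the kernel gains over its mirror image.\<close>

lemma norm_sq_vreflect:
  "(norm (vreflect \<mu> x - y))\<^sup>2 = (norm (x - y))\<^sup>2 + 4 * (\<mu> - snd x) * (\<mu> - snd y)"
  unfolding norm_sq_prod by (simp add: power2_eq_square algebra_simps)

lemma AE_snd_neq: "AE y in (lborel :: ('b::euclidean_space \<times> real) measure). snd y \<noteq> c"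
proof (rule AE_I[where N="UNIV \<times> {c}"])
  show "emeasure lborel (UNIV \<times> {c} :: ('b \<times> real) set) = 0"
    by (subst lborel_prod[symmetric], subst lborel.emeasure_pair_measure_Times) auto
  show "(UNIV \<times> {c} :: ('b \<times> real) set) \<in> sets lborel"
    unfolding sets_lborel by (rule borel_Times) auto
qed auto

text \<open>The kernel acting on an antisymmetric function once the part above the plane is folded
  onto the part below.\<close>

definition reflected_kernel :: "real \<Rightarrow> real \<Rightarrow> 'b::euclidean_space \<times> real \<Rightarrow> 'b \<times> real \<Rightarrow> real" where
  "reflected_kernel s \<mu> x y = frac_kernel s (x - y) - frac_kernel s (vreflect \<mu> x - y)"

lemma reflected_kernel_measurable [measurable]: "reflected_kernel s \<mu> x \<in> borel_measurable borel"
  unfolding reflected_kernel_def by measurable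

lemma reflected_kernel_bounds:
  assumes "0 < s" "snd x < \<mu>" "snd y < \<mu>" "x \<noteq> y"
  shows "0 \<le> reflected_kernel s \<mu> x y" "reflected_kernel s \<mu> x y \<le> frac_kernel s (x - y)"
proof -
  have "(norm (x - y))\<^sup>2 \<le> (norm (vreflect \<mu> x - y))\<^sup>2"
    unfolding norm_sq_vreflect using assms by simp
  then have "norm (x - y) \<le> norm (vreflect \<mu> x - y)" by (rule power2_le_imp_le) simp
  then show "0 \<le> reflected_kernel s \<mu> x y"
    unfolding reflected_kernel_def using frac_kernel_antimono[OF assms(1), of "x - y" "vreflect \<mu> x - y"] assms by simp
  show "reflected_kernel s \<mu> x y \<le> frac_kernel s (x - y)" by (simp add: reflected_kernel_def)
qed

text \<open>Below the plane the domain is \<open>A\<close>; above it, the mirror image of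
  \<open>A\<close> together with the ball around the reflected point, which the truncation at
  \<open>x\<close> does not remove. Folding the mirror image turns \<open>w y\<close> into
  \<open>- w y\<close>, and \<open>w x + w y = 2 * w x - (w x - w y)\<close> creates the reflected
  kernel and the zero-order term.\<close>

lemma trunc_lap_antisymmetric:
  fixes x :: "'b::euclidean_space \<times> real" and w :: "'b \<times> real \<Rightarrow> real"
  assumes s: "0 < s" "s < 1"
    and w [measurable]: "w \<in> borel_measurable borel" and B: "\<And>y. \<bar>w y\<bar> \<le> B"
    and anti: "\<And>y. w (vreflect \<mu> y) = - w y"
    and \<epsilon>: "0 < \<epsilon>" "\<epsilon> < \<mu> - snd x"
  defines "A \<equiv> {y. snd y < \<mu>} - ball x \<epsilon>"
  shows "trunc_lap s w \<epsilon> x =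
     (LINT y:A|lborel. (w x - w y) * reflected_kernel s \<mu> x y) +
     2 * w x * (LINT y:A|lborel. frac_kernel s (vreflect \<mu> x - y)) +
     (LINT y:ball (vreflect \<mu> x) \<epsilon>|lborel. (w x - w y) * frac_kernel s (x - y))"
proof -
  have n: "2 \<le> DIM('b \<times> real)" by (simp add: Suc_le_eq)
  let ?r = "vreflect \<mu>"
  let ?h = "\<lambda>y. (w x - w y) * frac_kernel s (x - y)"
  let ?U = "- ball x \<epsilon>"
  let ?B = "{y. ?r y \<in> A}"
  let ?b = "ball (?r x) \<epsilon>"
  have Asets [measurable]: "A \<in> sets borel" unfolding A_def by (intro sets.Diff half_space_below_sets) simp
  have Bsets [measurable]: "?B \<in> sets borel"
    using measurable_sets_borel[OF vreflect_measurable Asets, of \<mu>] by (simp add: vimage_def)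
  have b_above: "\<mu> < snd y" if "y \<in> ?b" for y
    using dist_snd_le[of "?r x" y] that \<epsilon> by (auto simp: dist_real_def)
  have above_far: "\<epsilon> < dist x y" if "\<mu> \<le> snd y" for y
    using dist_snd_le[of x y] that \<epsilon> by (auto simp: dist_real_def)
  have B_above: "\<mu> < snd y" if "y \<in> ?B" for y using that by (auto simp: A_def)
  have b_iff: "y \<in> ?b \<longleftrightarrow> ?r y \<in> ball x \<epsilon>" for y
    using norm_vreflect_diff_left[of x \<mu> y] by (simp add: dist_norm)
  have dA: "A \<inter> ball x \<epsilon> = {}" by (auto simp: A_def)
  have not_ball: "y \<notin> ball x \<epsilon>" if "\<mu> < snd y" for y using above_far[of y] that by simp
  have dB: "?B \<inter> ball x \<epsilon> = {}" and db: "?b \<inter> ball x \<epsilon> = {}"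
    using B_above b_above not_ball by blast+
  have dA': "A \<inter> ball (?r x) \<epsilon> = {}"
  proof -
    have "y \<notin> A" if "y \<in> ?b" for y using b_above[OF that] by (simp add: A_def)
    then show ?thesis by blast
  qed
  note iA = trunc_lap_integrable[OF s n w B Asets \<epsilon>(1) dA]
  note iB = trunc_lap_integrable[OF s n w B Bsets \<epsilon>(1) dB]
  have ib: "set_integrable lborel ?b ?h" by (rule trunc_lap_integrable[OF s n w B _ \<epsilon>(1) db]) simp
  have split: "indicator ?U y * ?h y = indicator A y * ?h y + (indicator ?B y * ?h y + indicator ?b y * ?h y)"
    if "snd y \<noteq> \<mu>" for y
  proof (cases "snd y < \<mu>")
    case True
    then have "y \<notin> ?B" "y \<notin> ?b" using B_above[of y] b_above[of y] by auto
    then show ?thesis using True by (auto simp: A_def indicator_def)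
  next
    case False
    then have gt: "\<mu> < snd y" using that by simp
    then have "y \<in> ?U" "y \<notin> A" using above_far[of y] by (auto simp: A_def)
    moreover have "y \<in> ?B \<longleftrightarrow> y \<notin> ?b" unfolding b_iff using gt by (simp add: A_def)
    ultimately show ?thesis by (simp add: indicator_def)
  qed
  have "trunc_lap s w \<epsilon> x = (\<integral>y. indicator ?U y * ?h y \<partial>lborel)"
    by (simp add: trunc_lap_def set_lebesgue_integral_def)
  also have "\<dots> = (\<integral>y. indicator A y * ?h y + (indicator ?B y * ?h y + indicator ?b y * ?h y) \<partial>lborel)"
  proof (rule integral_cong_AE)
    show "AE y in lborel. indicator ?U y * ?h y = indicator A y * ?h y + (indicator ?B y * ?h y + indicator ?b y * ?h y)"
      using AE_snd_neq split by (rule eventually_mono)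
    have [measurable]: "?U \<in> sets borel" "?b \<in> sets borel" by auto
    have [measurable]: "?h \<in> borel_measurable borel" by measurable
    show "(\<lambda>y. indicator ?U y * ?h y) \<in> borel_measurable lborel"
      by (intro borel_measurable_times borel_measurable_indicator) simp_all
    show "(\<lambda>y. indicator A y * ?h y + (indicator ?B y * ?h y + indicator ?b y * ?h y)) \<in> borel_measurable lborel"
      using Asets Bsets by (intro borel_measurable_add borel_measurable_times borel_measurable_indicator) simp_all
  qed
  also have "\<dots> = (LINT y:A|lborel. ?h y) + ((LINT y:?B|lborel. ?h y) + (LINT y:?b|lborel. ?h y))"
    using iA iB ib unfolding set_integrable_def set_lebesgue_integral_def by simp
  also have "(LINT y:?B|lborel. ?h y) = (LINT y:A|lborel. (w x + w y) * frac_kernel s (?r x - y))"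
  proof -
    let ?g = "\<lambda>y. indicator A y * ((w x + w y) * frac_kernel s (?r x - y))"
    have "indicator ?B y * ?h y = ?g (?r y)" for y
      using frac_kernel_eqI[OF norm_vreflect_diff[of \<mu> x y], of s] by (simp add: anti indicator_def)
    then have "(LINT y:?B|lborel. ?h y) = (\<integral>y. ?g (?r y) \<partial>lborel)"
      by (simp add: set_lebesgue_integral_def)
    also have "\<dots> = (\<integral>y. ?g y \<partial>lborel)"
      by (rule lborel_integral_invariant[OF lborel_distr_vreflect]) measurable
    finally show ?thesis by (simp add: set_lebesgue_integral_def)
  qed
  also have "(LINT y:A|lborel. ?h y) + ((LINT y:A|lborel. (w x + w y) * frac_kernel s (?r x - y)) + (LINT y:?b|lborel. ?h y))
      = (LINT y:A|lborel. (w x - w y) * reflected_kernel s \<mu> x y) +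
     2 * w x * (LINT y:A|lborel. frac_kernel s (?r x - y)) + (LINT y:?b|lborel. ?h y)"
  proof -
    have ik: "set_integrable lborel A (\<lambda>y. frac_kernel s (?r x - y))"
      using set_integrable_frac_kernel[OF s n Asets \<epsilon>(1) dA', of "\<lambda>_. 1" 1] by simp
    have ik': "set_integrable lborel A (\<lambda>y. (w x - w y) * frac_kernel s (?r x - y))"
    proof (rule set_integrable_frac_kernel[OF s n Asets \<epsilon>(1) dA'])
      show "\<bar>w x - w y\<bar> \<le> 2 * B" for y using B[of x] B[of y] by linarith
    qed measurable
    have "(LINT y:A|lborel. (w x + w y) * frac_kernel s (?r x - y)) =
        (LINT y:A|lborel. 2 * w x * frac_kernel s (?r x - y) - (w x - w y) * frac_kernel s (?r x - y))"
      by (simp add: algebra_simps)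
    also have "\<dots> = 2 * w x * (LINT y:A|lborel. frac_kernel s (?r x - y)) - (LINT y:A|lborel. (w x - w y) * frac_kernel s (?r x - y))"
      by (subst set_integral_diff(2)) (use ik ik' in auto)
    finally have e1: "(LINT y:A|lborel. (w x + w y) * frac_kernel s (?r x - y)) =
       2 * w x * (LINT y:A|lborel. frac_kernel s (?r x - y)) - (LINT y:A|lborel. (w x - w y) * frac_kernel s (?r x - y))" .
    have e2: "(LINT y:A|lborel. (w x - w y) * reflected_kernel s \<mu> x y) =
        (LINT y:A|lborel. ?h y) - (LINT y:A|lborel. (w x - w y) * frac_kernel s (?r x - y))"
      unfolding reflected_kernel_def right_diff_distrib by (rule set_integral_diff(2)[OF iA ik'])
    show ?thesis unfolding e1 e2 by simp
  qed
  finally show ?thesis .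
qed

text \<open>The analogue of \<open>pv_lap_touch\<close> with contact required only below the plane.
  The bump depends on the horizontal variables alone, so the horizontal reflection preserves both
  the region and the reflected kernel. There are two gains: the gap on \<open>S\<close>, and the
  zero-order term on \<open>S'\<close>, which has the right sign because
  \<open>w x \<le> 0\<close>.\<close>

lemma pv_lap_reflection_touch:
  fixes x :: "'b::euclidean_space \<times> real" and w :: "'b \<times> real \<Rightarrow> real"
  assumes s: "0 < s" "s < 1"
    and w [measurable]: "w \<in> borel_measurable borel" and B: "\<And>y. \<bar>w y\<bar> \<le> B"
    and anti: "\<And>y. w (vreflect \<mu> y) = - w y"
    and l: "pv_lap s w x l" and x: "snd x < \<mu>" "fst x \<in> ball x0 R" and R: "0 < R" and \<delta>: "0 \<le> \<delta>"
    and touch: "\<And>y. snd y < \<mu> \<Longrightarrow> w x - w y \<le> \<delta> * (bump x0 R (fst x) - bump x0 R (fst y))"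
    and wx: "w x \<le> 0"
    and S [measurable]: "S \<in> sets borel" and S_sub: "S \<subseteq> {y. snd y < \<mu>}" and r: "0 < r" "S \<inter> ball x r = {}"
    and S' [measurable]: "S' \<in> sets borel" and S'_sub: "S' \<subseteq> {y. snd y < \<mu>}" and r': "S' \<inter> ball x r = {}"
  shows "l \<le> \<delta> * (R powr (- 2 * s) * kernel_const TYPE('b \<times> real) s) -
    (LINT y:S|lborel. (\<delta> * (bump x0 R (fst x) - bump x0 R (fst y)) - (w x - w y)) * reflected_kernel s \<mu> x y) +
    2 * w x * (LINT y:S'|lborel. frac_kernel s (vreflect \<mu> x - y))"
    (is "l \<le> ?M - (LINT y:S|lborel. ?G y * _) + _" is "l \<le> ?bound")
proof -
  have n: "2 \<le> DIM('b \<times> real)" by (simp add: Suc_le_eq)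
  let ?D = "reflected_kernel s \<mu> x"
  let ?\<psi> = "\<lambda>y::'b \<times> real. bump x0 R (fst y)"
  let ?h = "\<lambda>y. (w x - w y) * frac_kernel s (x - y)"
  define d where "d = \<mu> - snd x"
  have d: "0 < d" using x by (simp add: d_def)
  \<comment> \<open>Bounds the integrand on the leftover ball around the reflected point, which lies
    above the plane and so at distance at least \<open>d\<close> from \<open>x\<close>; that term
    vanishes with the volume of the ball.\<close>
  define m where "m = 2 * B * d powr - (real DIM('b \<times> real) + 2 * s)"
  define V where "V = measure lborel (ball (0::'b \<times> real) 1)"
  have B0: "0 \<le> B" using B[of x] by linarith
  have trunc: "trunc_lap s w \<epsilon> x \<le> ?bound + m * (\<epsilon> ^ DIM('b \<times> real) * V)" if \<epsilon>: "0 < \<epsilon>" "\<epsilon> < d" "\<epsilon> < r" for \<epsilon>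
  proof -
    define A where "A = {y. snd y < \<mu>} - ball x \<epsilon>"
    let ?b = "ball (vreflect \<mu> x) \<epsilon>"
    have Asets [measurable]: "A \<in> sets borel" unfolding A_def by (intro sets.Diff half_space_below_sets) simp
    have dA: "A \<inter> ball x \<epsilon> = {}" by (auto simp: A_def)
    have b_above: "\<mu> < snd y" if "y \<in> ?b" for y
      using dist_snd_le[of "vreflect \<mu> x" y] that \<epsilon> by (auto simp: dist_real_def d_def)
    have dA': "A \<inter> ?b = {}" using b_above by (fastforce simp: A_def)
    have far: "d \<le> dist x y" if "\<mu> \<le> snd y" for y
      using dist_snd_le[of x y] that x by (auto simp: dist_real_def d_def)
    have xA: "x \<notin> A" using \<epsilon> by (simp add: A_def)
    have "ball x \<epsilon> \<subseteq> ball x r" using \<epsilon> by (simp add: subset_ball)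
    then have SA: "S \<subseteq> A" and S'A: "S' \<subseteq> A" using S_sub S'_sub r(2) r' unfolding A_def by blast+
    have Dbd: "0 \<le> ?D y" "?D y \<le> frac_kernel s (x - y)" if "y \<in> A" for y
    proof -
      have "x \<noteq> y" "snd y < \<mu>" using that xA by (auto simp: A_def)
      then show "0 \<le> ?D y" "?D y \<le> frac_kernel s (x - y)"
        using reflected_kernel_bounds[OF s(1) x(1), of y] by auto
    qed
    have iD: "set_integrable lborel A (\<lambda>y. g y * ?D y)"
      if [measurable]: "g \<in> borel_measurable borel" and gB: "\<And>y. \<bar>g y\<bar> \<le> C" for g C
    proof -
      have "set_integrable lborel A (\<lambda>y. C * frac_kernel s (x - y))"
        using gB by (intro set_integrable_frac_kernel[OF s n Asets \<epsilon>(1) dA, where B="\<bar>C\<bar>"]) auto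
      then show ?thesis unfolding set_integrable_def
      proof (rule Bochner_Integration.integrable_bound)
        show "AE y in lborel. norm (indicat_real A y *\<^sub>R (g y * ?D y)) \<le> norm (indicat_real A y *\<^sub>R (C * frac_kernel s (x - y)))"
        proof (rule AE_I2)
          fix y
          have "0 \<le> C" using gB[of y] by linarith
          then show "norm (indicat_real A y *\<^sub>R (g y * ?D y)) \<le> norm (indicat_real A y *\<^sub>R (C * frac_kernel s (x - y)))"
            using Dbd[of y] gB[of y] by (auto simp: indicator_def abs_mult intro!: mult_mono)
        qed
      qed measurable
    qed
    have \<psi>_diff: "\<bar>?\<psi> x - ?\<psi> y\<bar> \<le> 2" for y
      using bump_bounds[of x0 R "fst x"] bump_bounds[of x0 R "fst y"] by linarith
    have G_abs: "\<bar>?G y\<bar> \<le> \<delta> * 2 + 2 * B" for y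
    proof -
      have "\<bar>\<delta> * (?\<psi> x - ?\<psi> y)\<bar> \<le> \<delta> * 2" using \<psi>_diff[of y] \<delta> by (simp add: abs_mult mult_left_mono)
      then show ?thesis using B[of x] B[of y] by linarith
    qed
    have \<psi>_meas [measurable]: "?\<psi> \<in> borel_measurable borel"
      by (intro borel_measurable_continuous_onI continuous_on_compose2[OF continuous_on_bump[of UNIV]] continuous_intros) auto
    have i\<psi>: "set_integrable lborel A (\<lambda>y. (?\<psi> x - ?\<psi> y) * ?D y)" by (rule iD[OF _ \<psi>_diff]) measurable
    have iG: "set_integrable lborel A (\<lambda>y. ?G y * ?D y)" by (rule iD[OF _ G_abs]) measurable
    have ik: "set_integrable lborel A (\<lambda>y. frac_kernel s (vreflect \<mu> x - y))"
      using set_integrable_frac_kernel[OF s n Asets \<epsilon>(1) dA', of "\<lambda>_. 1" 1] by simp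
    have "(LINT y:A|lborel. (w x - w y) * ?D y) =
        (LINT y:A|lborel. \<delta> * ((?\<psi> x - ?\<psi> y) * ?D y) - ?G y * ?D y)"
      by (simp add: algebra_simps)
    also have "\<dots> = \<delta> * (LINT y:A|lborel. (?\<psi> x - ?\<psi> y) * ?D y) - (LINT y:A|lborel. ?G y * ?D y)"
      using set_integral_diff(2)[OF set_integrable_mult_right[OF i\<psi>, of \<delta>] iG] by simp
    also have "\<dots> \<le> ?M - (LINT y:S|lborel. ?G y * ?D y)"
    proof (rule diff_mono)
      have "(LINT y:A|lborel. (?\<psi> x - ?\<psi> y) * ?D y) \<le> R powr (- 2 * s) * kernel_const TYPE('b \<times> real) s"
      proof (rule bump_kernel_integral_le[OF s n Asets \<epsilon>(1) dA _ _ _ _ _ _ _ _ _ R,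
            where T="\<lambda>y. (2 *\<^sub>R fst x - fst y, snd y)"])
        show "(\<lambda>y. (2 *\<^sub>R fst x - fst y, snd y)) \<in> borel_measurable borel"
          by (intro borel_measurable_continuous_onI continuous_intros)
        show "distr lborel borel (\<lambda>y. (2 *\<^sub>R fst x - fst y, snd y)) = lborel"
          by (rule lborel_distr_Pair[of "\<lambda>z. 2 *\<^sub>R fst x - z" "\<lambda>t. t"]) (auto simp: lborel_distr_diff distr_id2)
        fix y :: "'b \<times> real"
        have nf: "norm (fst x - (2 *\<^sub>R fst x - fst y)) = norm (fst x - fst y)"
          by (simp add: scaleR_2 norm_minus_commute)
        have nm: "norm (x - (2 *\<^sub>R fst x - fst y, snd y)) = norm (x - y)"
             "norm (vreflect \<mu> x - (2 *\<^sub>R fst x - fst y, snd y)) = norm (vreflect \<mu> x - y)"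
          unfolding power2_eq_iff_nonneg[OF norm_ge_zero norm_ge_zero, symmetric] norm_sq_prod
          using nf by simp_all
        show "(2 *\<^sub>R fst x - fst y, snd y) \<in> A \<longleftrightarrow> y \<in> A"
          using nm(1) by (simp add: A_def dist_norm)
        show "?D (2 *\<^sub>R fst x - fst y, snd y) = ?D y"
          unfolding reflected_kernel_def frac_kernel_eqI[OF nm(1)] frac_kernel_eqI[OF nm(2)] by (rule refl)
        have e: "fst x + (fst x - fst y) = 2 *\<^sub>R fst x - fst y" "fst x - (fst x - fst y) = fst y"
          by (simp_all add: scaleR_2)
        have "norm (fst x - fst y) \<le> norm (x - y)" using norm_fst_le[of "fst x - fst y" "snd x - snd y"]
          by (simp add: minus_prod_def)
        then have "(norm (fst x - fst y))\<^sup>2 / R\<^sup>2 \<le> (norm (x - y))\<^sup>2 / R\<^sup>2"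
          by (intro divide_right_mono power_mono) auto
        then show "2 * ?\<psi> x - ?\<psi> y - ?\<psi> (2 *\<^sub>R fst x - fst y, snd y) \<le> 2 * min ((norm (x - y))\<^sup>2 / R\<^sup>2) 1"
          using bump_second_difference[OF R x(2), of "fst x - fst y"] unfolding e by auto
      qed (use Dbd in \<open>auto simp: bump_abs_le\<close>)
      then show "\<delta> * (LINT y:A|lborel. (?\<psi> x - ?\<psi> y) * ?D y) \<le> ?M" using \<delta> by (rule mult_left_mono)
      show "(LINT y:S|lborel. ?G y * ?D y) \<le> (LINT y:A|lborel. ?G y * ?D y)"
      proof (rule set_integral_mono_set[OF iG _ SA])
        fix y assume "y \<in> A"
        then show "0 \<le> ?G y * ?D y" using touch[of y] Dbd[of y] by (intro mult_nonneg_nonneg) (auto simp: A_def)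
      qed simp
    qed
    finally have p1: "(LINT y:A|lborel. (w x - w y) * ?D y) \<le> ?M - (LINT y:S|lborel. ?G y * ?D y)" .
    have "(LINT y:S'|lborel. frac_kernel s (vreflect \<mu> x - y)) \<le> (LINT y:A|lborel. frac_kernel s (vreflect \<mu> x - y))"
      by (rule set_integral_mono_set[OF ik _ S'A]) auto
    then have p2: "2 * w x * (LINT y:A|lborel. frac_kernel s (vreflect \<mu> x - y)) \<le> 2 * w x * (LINT y:S'|lborel. frac_kernel s (vreflect \<mu> x - y))"
      using wx by (intro mult_left_mono_neg) auto
    have p3: "(LINT y:?b|lborel. ?h y) \<le> m * (\<epsilon> ^ DIM('b \<times> real) * V)"
    proof -
      have "y \<notin> ball x \<epsilon>" if "y \<in> ?b" for y using b_above[OF that] far[of y] \<epsilon> by simp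
      then have bd: "?b \<inter> ball x \<epsilon> = {}" by blast
      have ib: "set_integrable lborel ?b ?h" by (rule trunc_lap_integrable[OF s n w B _ \<epsilon>(1) bd]) simp
      have "- m * measure lborel ?b \<le> (LINT y:?b|lborel. - ?h y)"
      proof (rule set_integral_ge_const)
        show "set_integrable lborel ?b (\<lambda>y. - ?h y)" using set_integrable_mult_right[OF ib, of "-1"] by simp
        fix y assume "y \<in> ?b"
        then have "d \<le> norm (x - y)" using far[of y] b_above[of y] by (simp add: dist_norm)
        then have "frac_kernel s (x - y) \<le> d powr - (real DIM('b \<times> real) + 2 * s)"
          by (rule frac_kernel_le[OF s(1) d])
        moreover have "w x - w y \<le> 2 * B" using B[of x] B[of y] by linarith
        ultimately have "?h y \<le> m" unfolding m_def using B0 by (intro mult_mono) auto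
        then show "- m \<le> - ?h y" by simp
      qed auto
      then have "(LINT y:?b|lborel. ?h y) \<le> m * measure lborel ?b"
        using set_integral_uminus[OF ib] by simp
      also have "measure lborel ?b = \<epsilon> ^ DIM('b \<times> real) * V"
        unfolding V_def by (rule content_ball_conv_unit_ball) (use \<epsilon> in simp)
      finally show ?thesis .
    qed
    have "trunc_lap s w \<epsilon> x = (LINT y:A|lborel. (w x - w y) * ?D y) +
       2 * w x * (LINT y:A|lborel. frac_kernel s (vreflect \<mu> x - y)) + (LINT y:?b|lborel. ?h y)"
      unfolding A_def by (rule trunc_lap_antisymmetric[OF s w B anti]) (use \<epsilon> in \<open>auto simp: d_def\<close>)
    then show ?thesis using p1 p2 p3 by linarith
  qed
  show ?thesis
  proof (rule tendsto_le[OF _ _ l[unfolded pv_lap_def]])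
    show "((\<lambda>\<epsilon>. ?bound + m * (\<epsilon> ^ DIM('b \<times> real) * V)) \<longlongrightarrow> ?bound) (at_right 0)"
      by (rule tendsto_eq_intros refl tendsto_ident_at | simp)+
    show "\<forall>\<^sub>F \<epsilon> in at_right 0. trunc_lap s w \<epsilon> x \<le> ?bound + m * (\<epsilon> ^ DIM('b \<times> real) * V)"
      using trunc d r(1) by (intro eventually_at_rightI[of 0 "min d r"]) auto
  qed simp
qed

text \<open>Negative values occur only in the slab between the boundary and the plane, so
  compactness is missing only horizontally and a horizontal bump suffices. The signs of
  \<open>w\<close> on the two faces keep the minimizer off them.\<close>

lemma slab_touching_exists:
  fixes w :: "'b::euclidean_space \<times> real \<Rightarrow> real"
  assumes w: "continuous_on UNIV w" and \<mu>: "0 < \<mu>" and R: "0 < R" and \<delta>: "0 \<le> \<delta>"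
    and below: "\<And>y. snd y \<le> 0 \<Longrightarrow> 0 \<le> w y" and plane: "\<And>y. snd y = \<mu> \<Longrightarrow> w y = 0"
    and x0: "snd x0 < \<mu>" "w x0 < 0"
    and near: "\<And>y. snd y < \<mu> \<Longrightarrow> w x0 - \<delta> < w y"
  shows "\<exists>x. 0 < snd x \<and> snd x < \<mu> \<and> fst x \<in> ball (fst x0) R \<and> w x \<le> w x0 \<and>
    (\<forall>y. snd y < \<mu> \<longrightarrow> w x - w y \<le> \<delta> * (bump (fst x0) R (fst x) - bump (fst x0) R (fst y)))"
proof -
  let ?\<psi> = "\<lambda>y::'b \<times> real. bump (fst x0) R (fst y)"
  let ?g = "\<lambda>y. w y - \<delta> * ?\<psi> y"
  let ?K = "cball (fst x0) R \<times> {0..\<mu>}"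
  have "continuous_on ?K ?g"
    by (intro continuous_intros continuous_on_subset[OF w] continuous_on_compose2[OF continuous_on_bump[of UNIV]]) auto
  moreover have "compact ?K" by (intro compact_Times) auto
  moreover have x0K: "x0 \<in> ?K" using x0 below[of x0] R by (cases x0) (auto simp: not_le[symmetric])
  ultimately obtain x where x: "x \<in> ?K" "\<And>y. y \<in> ?K \<Longrightarrow> ?g x \<le> ?g y"
    using continuous_attains_inf[of ?K ?g] by blast
  have gx: "?g x \<le> w x0 - \<delta>" using x(2)[OF x0K] by simp
  have \<delta>\<psi>: "\<delta> * ?\<psi> y \<le> \<delta>" "0 \<le> \<delta> * ?\<psi> y" for y
    using mult_left_le[OF bump_bounds(2)[of "fst x0" R "fst y"] \<delta>] \<delta> bump_bounds(1)[of "fst x0" R "fst y"] by auto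
  have wx: "w x \<le> w x0" using gx \<delta>\<psi>(1)[of x] by linarith
  have pos: "0 < snd x" using below[of x] wx x0(2) by (cases "snd x \<le> 0") auto
  have lt: "snd x < \<mu>" using plane[of x] wx x0(2) x(1) by (cases "snd x = \<mu>") (auto simp: mem_Times_iff)
  have xb: "fst x \<in> ball (fst x0) R"
  proof (rule ccontr)
    assume "fst x \<notin> ball (fst x0) R"
    then show False using bump_zero[OF R, of "fst x" "fst x0"] gx near[OF lt] by simp
  qed
  have "?g x \<le> ?g y" if y: "snd y < \<mu>" for y
  proof (cases "snd y \<le> 0")
    case True
    then show ?thesis using below[OF True] \<delta>\<psi>(1)[of y] gx x0(2) by linarith
  next
    case False
    show ?thesis
    proof (cases "fst y \<in> ball (fst x0) R")
      case True
      then show ?thesis using x(2)[of y] False y by (auto simp: mem_Times_iff)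
    next
      case False
      then show ?thesis using bump_zero[OF R, of "fst y" "fst x0"] gx near[OF y] by simp
    qed
  qed
  then have "\<forall>y. snd y < \<mu> \<longrightarrow> w x - w y \<le> \<delta> * (?\<psi> x - ?\<psi> y)" by (auto simp: algebra_simps)
  then show ?thesis using pos lt xb wx by blast
qed

section \<open>Moving planes\<close>

text \<open>With \<open>d\<close> and \<open>e\<close> the distances from \<open>y\<close> to
  \<open>x\<close> and to its mirror image, \<open>e^2 \<ge> d^2 + c\<close>. As
  \<open>d^2 / (d^2 + c)\<close> increases in \<open>d \<le> a\<close>, the ratio
  \<open>d / e\<close> is at most a fixed number below 1. The bound depends on \<open>x\<close>,
  \<open>y\<close> and \<open>\<mu>\<close> only through \<open>a\<close> and
  \<open>c\<close>.\<close>

lemma reflected_kernel_lower: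
  fixes x y :: "'b::euclidean_space \<times> real"
  assumes s: "0 < s" and c: "0 < c" "c \<le> 4 * (\<mu> - snd x) * (\<mu> - snd y)"
    and xy: "x \<noteq> y" "norm (x - y) \<le> a"
  defines "p \<equiv> real DIM('b \<times> real) + 2 * s"
  shows "a powr - p * (1 - sqrt (a\<^sup>2 / (a\<^sup>2 + c)) powr p) \<le> reflected_kernel s \<mu> x y"
proof -
  define d e where "d = norm (x - y)" and "e = norm (vreflect \<mu> x - y)"
  have d: "0 < d" "d \<le> a" using xy by (auto simp: d_def)
  have p: "0 < p" using s by (simp add: p_def add_nonneg_pos)
  define q where "q = a\<^sup>2 / (a\<^sup>2 + c)"
  have q: "0 < q" "q < 1" using d c by (auto simp: q_def add_pos_pos)
  have e2: "d\<^sup>2 + c \<le> e\<^sup>2" using c norm_sq_vreflect[of \<mu> x y] by (simp add: d_def e_def)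
  have "0 < e\<^sup>2" using e2 c(1) zero_le_power2[of d] by linarith
  then have "e \<noteq> 0" by auto
  then have e: "0 < e" by (simp add: e_def)
  have "d\<^sup>2 * c \<le> a\<^sup>2 * c" using d c by (intro mult_right_mono power_mono) auto
  then have "d\<^sup>2 * (a\<^sup>2 + c) \<le> a\<^sup>2 * (d\<^sup>2 + c)" by (simp add: algebra_simps)
  then have "d\<^sup>2 \<le> q * (d\<^sup>2 + c)"
    using d c by (simp add: q_def pos_le_divide_eq add_pos_pos)
  also have "\<dots> \<le> q * e\<^sup>2" using e2 q by (intro mult_left_mono) auto
  finally have "d\<^sup>2 \<le> (sqrt q * e)\<^sup>2" using q by (simp add: power_mult_distrib)
  then have "d \<le> sqrt q * e" by (rule power2_le_imp_le) (use q e in simp)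
  then have "d powr p \<le> (sqrt q * e) powr p" using d p by (intro powr_mono2) auto
  also have "\<dots> = sqrt q powr p * e powr p" using q e by (simp add: powr_mult)
  finally have de: "d powr p \<le> sqrt q powr p * e powr p" .
  have "sqrt q < 1" using q by simp
  then have th: "sqrt q powr p \<le> 1" using q p by (intro powr_le1) auto
  have "1 / e powr p \<le> sqrt q powr p * (1 / d powr p)"
    using de d e by (simp add: field_simps)
  moreover have "a powr - p * (1 - sqrt q powr p) \<le> 1 / d powr p * (1 - sqrt q powr p)"
  proof (rule mult_right_mono)
    have "d powr p \<le> a powr p" using d p by (intro powr_mono2) auto
    then show "a powr - p \<le> 1 / d powr p" using d by (simp add: powr_minus_divide frac_le)
  qed (use th in simp)
  moreover have "reflected_kernel s \<mu> x y = 1 / d powr p - 1 / e powr p"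
    by (simp add: reflected_kernel_def frac_kernel_def d_def e_def p_def)
  ultimately show ?thesis unfolding q_def by (simp add: algebra_simps)
qed

context half_space_solution
begin

section \<open>Reflected differences of the solution and the sweep of planes\<close>

lemma indicator_u_meas: "S \<in> sets borel \<Longrightarrow> (\<lambda>y. indicator S y * u y) \<in> borel_measurable borel"
  by (intro borel_measurable_times borel_measurable_indicator u_meas)

definition wdiff :: "real \<Rightarrow> 'b \<times> real \<Rightarrow> real" where
  "wdiff \<mu> y = u (vreflect \<mu> y) - u y"

lemma cont_wdiff: "continuous_on UNIV (wdiff \<mu>)"
  unfolding wdiff_def
  by (intro continuous_intros cont_u continuous_on_compose2[OF cont_u, of UNIV "vreflect \<mu>"])
     (auto simp: vreflect_def intro!: continuous_intros)

lemma wdiff_meas [measurable]: "wdiff \<mu> \<in> borel_measurable borel"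
  using cont_wdiff by (rule borel_measurable_continuous_onI)

lemma wdiff_abs_le: "\<bar>wdiff \<mu> y\<bar> \<le> M"
  using u_nonneg[of y] u_le[of y] u_nonneg[of "vreflect \<mu> y"] u_le[of "vreflect \<mu> y"] by (simp add: wdiff_def)

lemma wdiff_anti: "wdiff \<mu> (vreflect \<mu> y) = - wdiff \<mu> y"
  by (simp add: wdiff_def)

lemma wdiff_outside: "snd y \<le> 0 \<Longrightarrow> wdiff \<mu> y = u (vreflect \<mu> y)"
  by (simp add: wdiff_def u_zero)

lemma wdiff_plane: "snd y = \<mu> \<Longrightarrow> wdiff \<mu> y = 0"
  by (cases y) (simp add: wdiff_def vreflect_def)

lemma wdiff_eq_vdiff: "wdiff \<mu> x = vdiff (2 * (\<mu> - snd x)) x"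
  by (cases x) (simp add: wdiff_def vdiff_def vreflect_def)

lemma wdiff_pv:
  assumes "0 < snd x" "snd x < \<mu>"
  shows "pv_lap s (wdiff \<mu>) x (f (u (vreflect \<mu> x)) - f (u x))"
proof -
  have "pv_lap s (\<lambda>y. u (vreflect \<mu> y)) x (f (u (vreflect \<mu> x)))"
    using pv[of "vreflect \<mu> x"] assms
    by (subst pv_lap_isometry) (auto simp: lborel_distr_vreflect norm_vreflect_diff)
  moreover have "(\<lambda>y. u (vreflect \<mu> y)) \<in> borel_measurable borel"
    using measurable_compose[OF vreflect_measurable u_meas] by (simp add: comp_def)
  ultimately show ?thesis unfolding wdiff_def
    by (intro pv_lap_diff[OF s dim _ _ u_meas u_abs_le _ pv[OF assms(1)], where B=M] u_abs_le)
qed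

text \<open>Here \<open>- m\<close> plays the infimum of \<open>wdiff \<mu>\<close> below the plane.
  The clause over \<open>S\<close>, \<open>k\<close>, \<open>r\<close> is what remains of the
  equation at \<open>x\<close> once the bump has been estimated away, so later arguments need not
  mention it.\<close>

definition near_minimum :: "real \<Rightarrow> real \<Rightarrow> real \<Rightarrow> 'b \<times> real \<Rightarrow> bool" where
  "near_minimum \<rho> \<mu> m x \<longleftrightarrow> 0 < m \<and> 0 < snd x \<and> snd x + \<rho> \<le> \<mu> \<and> wdiff \<mu> x < - m / 2 \<and>
    (\<forall>S k r. S \<in> sets borel \<longrightarrow> bounded S \<longrightarrow> S \<subseteq> {y. snd y < \<mu>} \<longrightarrow> 0 < r \<longrightarrow> S \<inter> ball x r = {} \<longrightarrow>
       0 \<le> k \<longrightarrow> (\<forall>y\<in>S. k \<le> reflected_kernel s \<mu> x y) \<longrightarrow> k * (LINT y:S|lborel. wdiff \<mu> y) \<le> 2 * L * m)"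

text \<open>
  At a negative almost-minimum \<open>-m\<close> the antisymmetry forces a definite distance to the reflection plane,
  and the nonlocal equation bounds the weighted mass of \<open>wdiff\<close> on any fixed set by a multiple of \<open>m\<close>.
\<close>

lemma reflection_near_minimum:
  "\<exists>\<rho>>0. \<forall>\<mu>>0. \<forall>z. snd z < \<mu> \<longrightarrow> wdiff \<mu> z < 0 \<longrightarrow> (\<exists>m x. near_minimum \<rho> \<mu> m x)"
proof -
  define T where "T = kernel_const TYPE('b \<times> real) s"
  have T: "0 \<le> T" unfolding T_def by (rule kernel_const_nonneg)
  define p where "p = real DIM('b \<times> real) + 2 * s"
  obtain \<rho> where \<rho>: "0 < \<rho>"
    and strength: "\<And>x::'b \<times> real. L \<le> (3 * \<rho>) powr - p * measure lborel (probe x \<rho>)"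
    using probe_strength[OF s(1), of L, where 'b='b] unfolding p_def by metis
  show ?thesis
  proof (rule exI[of _ "\<rho>/2"], intro conjI allI impI)
    fix \<mu> z assume \<mu>: "0 < \<mu>" and z: "snd z < \<mu>" "wdiff \<mu> z < 0"
    let ?\<Sigma> = "{y::'b \<times> real. snd y < \<mu>}"
    define m where "m = - Inf (wdiff \<mu> ` ?\<Sigma>)"
    have bdd: "bdd_below (wdiff \<mu> ` ?\<Sigma>)"
      using wdiff_abs_le[of \<mu>] by (intro bdd_belowI[of _ "- M"]) (auto simp: abs_le_iff minus_le_iff)
    have inf: "- m \<le> wdiff \<mu> y" if "snd y < \<mu>" for y
      unfolding m_def using bdd that by (auto intro: cInf_lower)
    have m: "0 < m" using inf[OF z(1)] z(2) by linarith
    \<comment> \<open>Small enough that \<open>\<delta> * (2 * L + T) < L * m\<close>, which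
      contradicts \<open>2 * L * (m - \<delta>) \<le> L * m + \<delta> * T\<close> below and also
      yields \<open>2 * \<delta> < m\<close> and \<open>\<delta> * T < L * m\<close>.\<close>
    define \<delta> where "\<delta> = L * m / (2 * (2 * L + T + 1))"
    have den: "0 < 2 * L + T + 1" using L T by simp
    have \<delta>: "0 < \<delta>" using L m den by (simp add: \<delta>_def)
    have \<delta>2: "\<delta> * (2 * L + T) < L * m"
    proof -
      have "\<delta> * (2 * (2 * L + T + 1)) = L * m" using den by (simp add: \<delta>_def)
      moreover have "\<delta> * (2 * L + T) < \<delta> * (2 * (2 * L + T + 1))" using \<delta> L T by (intro mult_strict_left_mono) auto
      ultimately show ?thesis by simp
    qed
    have \<delta>m: "2 * \<delta> < m"
    proof -
      have "0 \<le> \<delta> * T" using \<delta> T by simp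
      then have "L * (2 * \<delta>) < L * m" using \<delta>2 by (simp add: algebra_simps)
      then show ?thesis using L by simp
    qed
    have \<delta>T: "\<delta> * T < L * m"
    proof -
      have "0 \<le> \<delta> * (2 * L)" using \<delta> L by simp
      then show ?thesis using \<delta>2 by (simp add: algebra_simps)
    qed
    have inf_lt: "Inf (wdiff \<mu> ` ?\<Sigma>) < - m + \<delta>" using \<delta> by (simp add: m_def)
    have "wdiff \<mu> ` ?\<Sigma> \<noteq> {}" using z(1) by blast
    from cInf_lessD[OF this inf_lt] obtain x0 where x0: "snd x0 < \<mu>" "wdiff \<mu> x0 < - m + \<delta>" by blast
    have "\<exists>x. 0 < snd x \<and> snd x < \<mu> \<and> fst x \<in> ball (fst x0) 1 \<and> wdiff \<mu> x \<le> wdiff \<mu> x0 \<and>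
       (\<forall>y. snd y < \<mu> \<longrightarrow> wdiff \<mu> x - wdiff \<mu> y \<le> \<delta> * (bump (fst x0) 1 (fst x) - bump (fst x0) 1 (fst y)))"
    proof (rule slab_touching_exists[OF cont_wdiff \<mu>])
      show "0 \<le> wdiff \<mu> y" if "snd y \<le> 0" for y using wdiff_outside[OF that] u_nonneg by simp
      show "wdiff \<mu> x0 - \<delta> < wdiff \<mu> y" if "snd y < \<mu>" for y using inf[OF that] x0(2) by linarith
    qed (use x0 \<delta> \<delta>m wdiff_plane in auto)
    then obtain x where x: "0 < snd x" "snd x < \<mu>" "fst x \<in> ball (fst x0) 1" "wdiff \<mu> x \<le> wdiff \<mu> x0"
      and touch: "\<And>y. snd y < \<mu> \<Longrightarrow> wdiff \<mu> x - wdiff \<mu> y \<le> \<delta> * (bump (fst x0) 1 (fst x) - bump (fst x0) 1 (fst y))"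
      by blast
    have wx: "wdiff \<mu> x < - m + \<delta>" using x(4) x0(2) by linarith
    have wx0: "wdiff \<mu> x \<le> 0" using wx \<delta> \<delta>m by linarith
    have lower: "- (L * m) \<le> f (u (vreflect \<mu> x)) - f (u x)"
    proof -
      have "\<bar>f (u (vreflect \<mu> x)) - f (u x)\<bar> \<le> L * \<bar>wdiff \<mu> x\<bar>"
        unfolding wdiff_def by (rule lip[OF u_range u_range])
      moreover have "\<bar>wdiff \<mu> x\<bar> \<le> m" using inf[OF x(2)] wx0 by linarith
      then have "L * \<bar>wdiff \<mu> x\<bar> \<le> L * m" using L by (intro mult_left_mono) auto
      ultimately show ?thesis by linarith
    qed
    let ?G = "\<lambda>y. \<delta> * (bump (fst x0) 1 (fst x) - bump (fst x0) 1 (fst y)) - (wdiff \<mu> x - wdiff \<mu> y)"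
    have main: "(LINT y:S|lborel. ?G y * reflected_kernel s \<mu> x y) -
        2 * wdiff \<mu> x * (LINT y:S'|lborel. frac_kernel s (vreflect \<mu> x - y)) \<le> L * m + \<delta> * T"
      if S: "S \<in> sets borel" "S \<subseteq> ?\<Sigma>" "0 < r" "S \<inter> ball x r = {}" and S': "S' \<in> sets borel" "S' \<subseteq> ?\<Sigma>" "S' \<inter> ball x r = {}"
      for S S' r
    proof -
      have "f (u (vreflect \<mu> x)) - f (u x) \<le> \<delta> * (1 powr (- 2 * s) * kernel_const TYPE('b \<times> real) s) -
        (LINT y:S|lborel. ?G y * reflected_kernel s \<mu> x y) +
        2 * wdiff \<mu> x * (LINT y:S'|lborel. frac_kernel s (vreflect \<mu> x - y))"
        by (rule pv_lap_reflection_touch[OF s wdiff_meas wdiff_abs_le wdiff_anti wdiff_pv[OF x(1,2)] x(2,3) _ _ touch wx0 S S'])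
          (use \<delta> in auto)
      then show ?thesis using lower by (simp add: T_def)
    qed
    have "snd x + \<rho> / 2 \<le> \<mu>"
    proof (rule ccontr)
      assume near: "\<not> ?thesis"
      define d where "d = \<mu> - snd x"
      have d: "0 < d" "2 * d < \<rho>" using near x by (auto simp: d_def)
      \<comment> \<open>A probe pointing down from the reflected point, which lies at height
        \<open>\<mu> + d\<close>. Since \<open>2 * d < \<rho>\<close> it is below the plane and
        stays \<open>\<rho> - 2 * d\<close> away from \<open>x\<close>; its strength
        \<open>L\<close> makes the zero-order term exceed the Lipschitz bound.\<close>
      let ?S' = "ball (fst x) \<rho> \<times> {\<mu> + d - 2 * \<rho>..\<mu> + d - \<rho>}"
      have far: "\<rho> - 2 * d \<le> dist x y" "\<rho> \<le> dist (vreflect \<mu> x) y" "snd y < \<mu>"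
        "norm (vreflect \<mu> x - y) \<le> 3 * \<rho>" if "y \<in> ?S'" for y
      proof -
        have y: "\<mu> + d - 2 * \<rho> \<le> snd y" "snd y \<le> \<mu> + d - \<rho>" "dist (fst x) (fst y) < \<rho>" using that by (auto simp: mem_Times_iff)
        show "\<rho> - 2 * d \<le> dist x y" using dist_snd_le[of x y] y by (simp add: dist_real_def d_def)
        show "\<rho> \<le> dist (vreflect \<mu> x) y" using dist_snd_le[of "vreflect \<mu> x" y] y by (simp add: dist_real_def d_def)
        show "snd y < \<mu>" using y d by linarith
        have "norm (vreflect \<mu> x - y) \<le> norm (fst x - fst y) + norm (2 * \<mu> - snd x - snd y)"
          using norm_Pair_le[of "fst x - fst y" "2 * \<mu> - snd x - snd y"]
          by (cases y) (simp add: vreflect_def)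
        also have "norm (2 * \<mu> - snd x - snd y) \<le> 2 * \<rho>" using y \<rho> by (simp add: d_def)
        finally show "norm (vreflect \<mu> x - y) \<le> 3 * \<rho>" using y(3) by (simp add: dist_norm)
      qed
      have dS: "?S' \<inter> ball x (\<rho> - 2 * d) = {}" using far(1) by (metis disjoint_iff linorder_not_less mem_ball)
      have dS': "?S' \<inter> ball (vreflect \<mu> x) \<rho> = {}" using far(2) by (metis disjoint_iff linorder_not_less mem_ball)
      have "(LINT y:{}|lborel. ?G y * reflected_kernel s \<mu> x y) -
        2 * wdiff \<mu> x * (LINT y:?S'|lborel. frac_kernel s (vreflect \<mu> x - y)) \<le> L * m + \<delta> * T"
        by (rule main[where r="\<rho> - 2 * d"]) (use d dS far(3) in auto)
      then have le: "2 * (- wdiff \<mu> x) * (LINT y:?S'|lborel. frac_kernel s (vreflect \<mu> x - y)) \<le> L * m + \<delta> * T"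
        by (simp add: set_lebesgue_integral_def)
      have "(3 * \<rho>) powr - p * measure lborel ?S' \<le> (LINT y:?S'|lborel. frac_kernel s (vreflect \<mu> x - y))"
      proof (rule set_integral_ge_const)
        show "set_integrable lborel ?S' (\<lambda>y. frac_kernel s (vreflect \<mu> x - y))"
          using set_integrable_frac_kernel[OF s dim _ \<rho> dS', of "\<lambda>_. 1" 1] by simp
        fix y assume y: "y \<in> ?S'"
        then have "vreflect \<mu> x \<noteq> y" using far(2)[OF y] \<rho> by auto
        then show "(3 * \<rho>) powr - p \<le> frac_kernel s (vreflect \<mu> x - y)"
          unfolding p_def using s far(4)[OF y] by (intro frac_kernel_ge) auto
      qed (auto intro: bounded_Times_interval)
      moreover have "measure lborel ?S' = measure lborel (probe x \<rho>)"
        using \<rho> by (simp add: measure_Times_interval probe_measure)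
      ultimately have "L \<le> (LINT y:?S'|lborel. frac_kernel s (vreflect \<mu> x - y))" using strength[of x] by simp
      then have "2 * (- wdiff \<mu> x) * L \<le> L * m + \<delta> * T"
        using le mult_left_mono[of L _ "2 * (- wdiff \<mu> x)"] wx0 by fastforce
      moreover have "L * (m - \<delta>) \<le> L * (- wdiff \<mu> x)" using wx L by (intro mult_left_mono) auto
      ultimately show False using \<delta>2 by (simp add: algebra_simps)
    qed
    moreover have "wdiff \<mu> x < - m / 2" using wx \<delta>m by linarith
    moreover have "k * (LINT y:S|lborel. wdiff \<mu> y) \<le> 2 * L * m"
      if S: "S \<in> sets borel" "bounded S" "S \<subseteq> ?\<Sigma>" "0 < r" "S \<inter> ball x r = {}"
        and k: "0 \<le> k" "\<forall>y\<in>S. k \<le> reflected_kernel s \<mu> x y" for S k r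
    proof -
      have \<psi>_meas [measurable]: "(\<lambda>y::'b \<times> real. bump (fst x0) 1 (fst y)) \<in> borel_measurable borel"
        by (intro borel_measurable_continuous_onI continuous_on_compose2[OF continuous_on_bump[of UNIV]] continuous_intros) auto
      have b1: "\<bar>bump (fst x0) 1 (fst x) - bump (fst x0) 1 (fst y)\<bar> \<le> 1" for y
        using bump_bounds[of "fst x0" 1 "fst x"] bump_bounds[of "fst x0" 1 "fst y"] by linarith
      have db: "\<bar>\<delta> * (bump (fst x0) 1 (fst x) - bump (fst x0) 1 (fst y))\<bar> \<le> \<delta>" for y
        using b1[of y] \<delta> by (simp add: abs_mult)
      have Gabs: "\<bar>?G y\<bar> \<le> \<delta> + 2 * M" for y
        using db[of y] wdiff_abs_le[of \<mu> x] wdiff_abs_le[of \<mu> y] by linarith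
      have iG: "set_integrable lborel S ?G" using Gabs S by (intro set_integrable_bounded_set) auto
      have xS: "x \<notin> S" using S(4,5) by auto
      have kbd: "\<bar>reflected_kernel s \<mu> x y\<bar> \<le> r powr - p" if "y \<in> S" for y
      proof -
        have "y \<notin> ball x r" using that S(5) by blast
        then have "r \<le> norm (x - y)" by (simp add: dist_norm)
        then have "frac_kernel s (x - y) \<le> r powr - p" unfolding p_def by (rule frac_kernel_le[OF s(1) S(4)])
        moreover have "snd y < \<mu>" "x \<noteq> y" using that S(3) xS by auto
        ultimately show ?thesis using reflected_kernel_bounds[OF s(1) x(2), of y] by auto
      qed
      have iGk: "set_integrable lborel S (\<lambda>y. ?G y * reflected_kernel s \<mu> x y)"
      proof (rule set_integrable_bounded_set[OF S(1,2)])
        show "\<bar>?G y * reflected_kernel s \<mu> x y\<bar> \<le> (\<delta> + 2 * M) * r powr - p" if "y \<in> S" for y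
          unfolding abs_mult using Gabs[of y] kbd[OF that] \<delta> M_nonneg by (intro mult_mono) auto
      qed measurable
      have iw: "set_integrable lborel S (wdiff \<mu>)"
        by (rule set_integrable_bounded_set[OF S(1,2) wdiff_meas wdiff_abs_le])
      \<comment> \<open>The depth \<open>- wdiff \<mu> x > m - \<delta>\<close> outweighs the
        variation \<open>\<delta>\<close> of the bump, so the gap dominates \<open>wdiff\<close>
        and, unlike it, is nonnegative throughout \<open>S\<close>.\<close>
      have "(LINT y:S|lborel. wdiff \<mu> y) \<le> (LINT y:S|lborel. ?G y)"
      proof (rule set_integral_mono[OF iw iG])
        fix y show "wdiff \<mu> y \<le> ?G y" using db[of y] wx \<delta>m by linarith
      qed
      then have "k * (LINT y:S|lborel. wdiff \<mu> y) \<le> k * (LINT y:S|lborel. ?G y)"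
        using k(1) by (rule mult_left_mono)
      also have "\<dots> \<le> (LINT y:S|lborel. ?G y * reflected_kernel s \<mu> x y)"
      proof (rule kernel_integral_lower[OF S(1) iG iGk])
        show "0 \<le> ?G y" if "y \<in> S" for y using touch[of y] that S(3) by auto
      qed (use k in auto)
      also have "\<dots> \<le> L * m + \<delta> * T"
        using main[OF S(1) S(3) S(4,5), of "{}"] by (simp add: set_lebesgue_integral_def)
      also have "\<dots> \<le> 2 * L * m" using \<delta>T by simp
      finally show ?thesis .
    qed
    ultimately show "\<exists>m x. near_minimum (\<rho> / 2) \<mu> m x"
      using m x(1) unfolding near_minimum_def by (intro exI[of _ m] exI[of _ x]) simp
  qed (use \<rho> in simp)
qed

text \<open>The one-sided Lipschitz bound makes the depth \<open>m\<close> of any negative part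
  \<open>O(\<mu> - \<mu>0)\<close>. The ball tested lies below the boundary, where
  \<open>wdiff\<close> is the reflected \<open>u\<close>; its integral is the mass of
  \<open>u\<close> on the mirror ball, at least \<open>\<eta>\<close>.\<close>

lemma reflection_step:
  assumes f0: "f 0 < 0" and \<mu>0: "0 < \<mu>0" and base: "\<And>x. snd x < \<mu>0 \<Longrightarrow> 0 \<le> wdiff \<mu>0 x"
  shows "\<exists>\<epsilon>>0. \<forall>\<mu>. \<mu>0 < \<mu> \<longrightarrow> \<mu> < \<mu>0 + \<epsilon> \<longrightarrow> (\<forall>x. snd x < \<mu> \<longrightarrow> 0 \<le> wdiff \<mu> x)"
proof -
  obtain \<rho> where \<rho>: "0 < \<rho>"
    and near: "\<And>\<mu> z. 0 < \<mu> \<Longrightarrow> snd z < \<mu> \<Longrightarrow> wdiff \<mu> z < 0 \<Longrightarrow> \<exists>m x. near_minimum \<rho> \<mu> m x"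
    using reflection_near_minimum by blast
  obtain C where C: "0 < C" "\<And>h x. 0 < h \<Longrightarrow> - C * h \<le> vdiff h x" using vdiff_one_sided_Lipschitz by blast
  obtain R \<eta> where R: "0 < R" and \<eta>: "0 < \<eta>" "\<And>z. R \<le> snd z \<Longrightarrow> \<eta> \<le> (LINT y:ball z (R + 1)|lborel. u y)"
    using mass_lower_bound[OF f0] by blast
  define p where "p = real DIM('b \<times> real) + 2 * s"
  \<comment> \<open>Bounds the distance from \<open>x\<close>, of height below
    \<open>\<mu>0 + 1\<close>, to any point of a ball of radius \<open>R + 1\<close> resting just
    under the boundary below \<open>x\<close>.\<close>
  define a where "a = \<mu>0 + 1 + 2 * (R + 1)"
  \<comment> \<open>\<open>x\<close> is at distance at least \<open>\<rho>\<close> from the plane,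
    and points of the ball, having negative height, at distance at least
    \<open>\<mu>0\<close>.\<close>
  define c where "c = 4 * \<rho> * \<mu>0"
  have a: "0 < a" and c: "0 < c" using \<mu>0 R \<rho> by (auto simp: a_def c_def)
  define k where "k = a powr - p * (1 - sqrt (a\<^sup>2 / (a\<^sup>2 + c)) powr p)"
  have k: "0 < k"
  proof -
    have "a\<^sup>2 / (a\<^sup>2 + c) < 1" using a c by (simp add: add_pos_pos)
    then have "sqrt (a\<^sup>2 / (a\<^sup>2 + c)) powr p < 1 powr p"
      using s a c by (intro powr_less_mono2) (auto simp: p_def add_nonneg_pos)
    then show ?thesis using a by (simp add: k_def)
  qed
  \<comment> \<open>Read off from
    \<open>k * \<eta> \<le> 2 * L * m < 8 * L * C * (\<mu> - \<mu>0)\<close>; the bound 1 justifies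
    the choice of \<open>a\<close>.\<close>
  define \<epsilon> where "\<epsilon> = min 1 (k * \<eta> / (8 * L * C))"
  have \<epsilon>: "0 < \<epsilon>" using k \<eta> L C by (simp add: \<epsilon>_def)
  have "0 \<le> wdiff \<mu> z" if \<mu>: "\<mu>0 < \<mu>" "\<mu> < \<mu>0 + \<epsilon>" and z: "snd z < \<mu>" for \<mu> z
  proof (rule ccontr)
    assume "\<not> 0 \<le> wdiff \<mu> z"
    then have "wdiff \<mu> z < 0" "0 < \<mu>" using \<mu>0 \<mu> by auto
    then obtain m x where nm: "near_minimum \<rho> \<mu> m x" using near z by blast
    then have m: "0 < m" and x: "0 < snd x" "snd x + \<rho> \<le> \<mu>" "wdiff \<mu> x < - m / 2"
      by (auto simp: near_minimum_def)
    have small: "k * (LINT y:S|lborel. wdiff \<mu> y) \<le> 2 * L * m"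
      if "S \<in> sets borel" "bounded S" "S \<subseteq> {y. snd y < \<mu>}" "0 < r" "S \<inter> ball x r = {}"
        "0 \<le> k" "\<forall>y\<in>S. k \<le> reflected_kernel s \<mu> x y" for S k r
      using nm that unfolding near_minimum_def by blast
    \<comment> \<open>Below \<open>\<mu>0\<close> the new mirror point is the old one raised by
      \<open>2 * (\<mu> - \<mu>0)\<close>, and the old difference is nonnegative. Otherwise
      \<open>x\<close> is itself within \<open>\<mu> - \<mu>0\<close> of the new plane.\<close>
    have "- C * (2 * (\<mu> - \<mu>0)) \<le> wdiff \<mu> x"
    proof (cases "snd x < \<mu>0")
      case True
      have "vreflect \<mu> x = vreflect \<mu>0 x + (0, 2 * (\<mu> - \<mu>0))" by (simp add: vreflect_def)
      then have "wdiff \<mu> x = vdiff (2 * (\<mu> - \<mu>0)) (vreflect \<mu>0 x) + wdiff \<mu>0 x"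
        by (simp add: wdiff_def vdiff_def)
      then show ?thesis using C(2)[of "2 * (\<mu> - \<mu>0)" "vreflect \<mu>0 x"] base[OF True] \<mu> by simp
    next
      case False
      have "- C * (2 * (\<mu> - \<mu>0)) \<le> - C * (2 * (\<mu> - snd x))" using False C(1) by simp
      also have "\<dots> \<le> wdiff \<mu> x" unfolding wdiff_eq_vdiff using x \<rho> by (intro C(2)) simp
      finally show ?thesis .
    qed
    then have m_small: "m < 4 * C * (\<mu> - \<mu>0)" using x(3) by (simp add: algebra_simps)
    define z1 where "z1 = (fst x, 2 * \<mu> + R + 1)"
    define z2 where "z2 = (fst x, - (R + 1))"
    let ?S = "ball z2 (R + 1)"
    have S_neg: "snd y < 0" if "y \<in> ?S" for y
      using dist_snd_le[of z2 y] that by (simp add: z2_def dist_real_def)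
    have S_below: "?S \<subseteq> {y. snd y < \<mu>}" using S_neg \<mu>0 \<mu> by fastforce
    have "y \<notin> ball x (snd x)" if "y \<in> ?S" for y
      using dist_snd_le[of x y] S_neg[OF that] x(1) by (simp add: dist_real_def)
    then have S_far: "?S \<inter> ball x (snd x) = {}" by blast
    have kS: "k \<le> reflected_kernel s \<mu> x y" if y: "y \<in> ?S" for y
      unfolding k_def p_def
    proof (rule reflected_kernel_lower[OF s(1) c])
      have "\<rho> * \<mu>0 \<le> (\<mu> - snd x) * (\<mu> - snd y)"
        using S_neg[OF y] x \<mu> \<mu>0 \<rho> by (intro mult_mono) auto
      then show "c \<le> 4 * (\<mu> - snd x) * (\<mu> - snd y)" unfolding c_def mult.assoc by linarith
      show "x \<noteq> y" using S_neg[OF y] x(1) by auto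
      have "dist x y \<le> dist x z2 + dist z2 y" by (rule dist_triangle)
      moreover have "dist x z2 = snd x + (R + 1)" using x(1) R
        by (cases x) (simp add: z2_def dist_Pair_Pair dist_real_def)
      ultimately show "norm (x - y) \<le> a" using y x \<mu> \<rho> by (simp add: a_def dist_norm \<epsilon>_def)
    qed
    have "k * (LINT y:?S|lborel. wdiff \<mu> y) \<le> 2 * L * m"
      by (rule small[OF _ _ S_below x(1) S_far]) (use k kS in auto)
    moreover have "(LINT y:?S|lborel. wdiff \<mu> y) = (LINT y:ball z1 (R + 1)|lborel. u y)"
    proof -
      let ?g = "\<lambda>y. indicator (ball z1 (R + 1)) y * u y"
      have iff: "vreflect \<mu> y \<in> ball z1 (R + 1) \<longleftrightarrow> y \<in> ?S" for y
        using norm_vreflect_diff[of \<mu> z2 y] by (simp add: dist_norm z1_def z2_def vreflect_def)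
      have "indicator ?S y * wdiff \<mu> y = ?g (vreflect \<mu> y)" for y
        using iff[of y] S_neg[of y] wdiff_outside[of y \<mu>] by (cases "y \<in> ?S") auto
      then have "(LINT y:?S|lborel. wdiff \<mu> y) = (\<integral>y. ?g (vreflect \<mu> y) \<partial>lborel)"
        by (simp add: set_lebesgue_integral_def)
      also have "\<dots> = (\<integral>y. ?g y \<partial>lborel)"
        by (rule lborel_integral_invariant[OF lborel_distr_vreflect vreflect_measurable indicator_u_meas]) simp
      finally show ?thesis by (simp add: set_lebesgue_integral_def)
    qed
    moreover have "\<eta> \<le> (LINT y:ball z1 (R + 1)|lborel. u y)"
      using \<mu> \<mu>0 by (intro \<eta>(2)) (simp add: z1_def)
    ultimately have "k * \<eta> \<le> 2 * L * m" using k by (smt (verit) mult_left_mono)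
    also have "\<dots> < 2 * L * (4 * C * (\<mu> - \<mu>0))" using m_small L by simp
    also have "\<dots> \<le> 2 * L * (4 * C * (k * \<eta> / (8 * L * C)))"
      using L C \<mu> by (intro mult_left_mono) (auto simp: \<epsilon>_def)
    also have "\<dots> = k * \<eta>" using L C by simp
    finally show False by simp
  qed
  then show ?thesis using \<epsilon> by blast
qed

text \<open>Moving planes through the infimum of the bad heights: it is positive, it is good itself
  by continuity in the plane, and \<open>reflection_step\<close> makes the heights just above it
  good as well.\<close>

lemma wdiff_nonneg:
  assumes f0: "f 0 < 0" and "0 < \<mu>" "snd x < \<mu>"
  shows "0 \<le> wdiff \<mu> x"
proof (rule ccontr)
  assume neg: "\<not> 0 \<le> wdiff \<mu> x"
  define Bad where "Bad = {\<mu>. 0 < \<mu> \<and> (\<exists>x. snd x < \<mu> \<and> wdiff \<mu> x < 0)}"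
  have "wdiff \<mu> x < 0" using neg by simp
  then have ne: "\<mu> \<in> Bad" unfolding Bad_def using assms(2,3) by blast
  \<comment> \<open>The sweep starts because a near-minimum lies in the half-space and at least
    \<open>\<rho>\<close> below its plane, so the plane has height above
    \<open>\<rho>\<close>.\<close>
  obtain \<rho> where \<rho>: "0 < \<rho>" "\<And>\<mu>. \<mu> \<in> Bad \<Longrightarrow> \<rho> \<le> \<mu>"
  proof -
    obtain \<rho> where \<rho>: "0 < \<rho>"
      and near: "\<And>\<mu> z. 0 < \<mu> \<Longrightarrow> snd z < \<mu> \<Longrightarrow> wdiff \<mu> z < 0 \<Longrightarrow> \<exists>m x. near_minimum \<rho> \<mu> m x"
      using reflection_near_minimum by blast
    have "\<rho> \<le> \<mu>" if bad: "\<mu> \<in> Bad" for \<mu>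
    proof -
      obtain z where "0 < \<mu>" "snd z < \<mu>" "wdiff \<mu> z < 0" using bad unfolding Bad_def by blast
      then obtain m x where "near_minimum \<rho> \<mu> m x" using near by blast
      then show ?thesis by (simp add: near_minimum_def)
    qed
    then show ?thesis using that \<rho> by blast
  qed
  define \<mu>0 where "\<mu>0 = Inf Bad"
  have bdd: "bdd_below Bad" using \<rho>(2) by (intro bdd_belowI)
  have \<mu>0: "0 < \<mu>0" using cInf_greatest[of Bad \<rho>] ne \<rho> by (force simp: \<mu>0_def)
  have base: "0 \<le> wdiff \<mu>0 y" if y: "snd y < \<mu>0" for y
  proof (rule ccontr)
    assume "\<not> 0 \<le> wdiff \<mu>0 y"
    moreover have "continuous_on UNIV (\<lambda>t. wdiff t y)"
      unfolding wdiff_def vreflect_def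
      by (intro continuous_intros continuous_on_compose2[OF cont_u]) auto
    then have "((\<lambda>t. wdiff t y) \<longlongrightarrow> wdiff \<mu>0 y) (at \<mu>0)" by (simp add: continuous_on_def)
    then have "((\<lambda>t. wdiff t y) \<longlongrightarrow> wdiff \<mu>0 y) (at_left \<mu>0)" by (rule tendsto_within_subset) simp
    ultimately have "\<forall>\<^sub>F t in at_left \<mu>0. wdiff t y < 0" by (intro order_tendstoD(2)) auto
    moreover have "\<forall>\<^sub>F t in at_left \<mu>0. max 0 (snd y) < t \<and> t < \<mu>0"
      using y \<mu>0 by (intro eventually_at_leftI[of "max 0 (snd y)"]) auto
    ultimately have "\<forall>\<^sub>F t in at_left \<mu>0. wdiff t y < 0 \<and> max 0 (snd y) < t \<and> t < \<mu>0"
      by eventually_elim simp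
    then obtain t where t: "wdiff t y < 0" "max 0 (snd y) < t" "t < \<mu>0"
      using eventually_happens'[OF trivial_limit_at_left_real] by blast
    then have "0 < t \<and> (\<exists>x. snd x < t \<and> wdiff t x < 0)" by (intro conjI exI[of _ y]) auto
    then have "t \<in> Bad" by (simp add: Bad_def)
    then have "\<mu>0 \<le> t" unfolding \<mu>0_def using bdd by (rule cInf_lower)
    then show False using t by simp
  qed
  obtain \<epsilon> where \<epsilon>: "0 < \<epsilon>" "\<And>\<mu> x. \<mu>0 < \<mu> \<Longrightarrow> \<mu> < \<mu>0 + \<epsilon> \<Longrightarrow> snd x < \<mu> \<Longrightarrow> 0 \<le> wdiff \<mu> x"
    using reflection_step[OF f0 \<mu>0 base] by blast
  obtain t where t: "t \<in> Bad" "t < \<mu>0 + \<epsilon>"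
    using cInf_lessD[of Bad "\<mu>0 + \<epsilon>"] ne \<epsilon>(1) unfolding \<mu>0_def by auto
  have "\<mu>0 \<le> t" unfolding \<mu>0_def using t(1) bdd by (rule cInf_lower)
  moreover obtain y where "snd y < t" "wdiff t y < 0" using t(1) by (auto simp: Bad_def)
  ultimately show False using base[of y] \<epsilon>(2)[of t y] t(2) by (cases "t = \<mu>0") auto
qed

text \<open>\<open>x\<close> and \<open>x + (0, h)\<close> are mirror images in the plane of height
  \<open>snd x + h / 2\<close>.\<close>

lemma vdiff_nonneg:
  assumes f0: "f 0 < 0" and h: "0 < h"
  shows "0 \<le> vdiff h x"
proof (cases "0 < snd x + h / 2")
  case True
  then show ?thesis using wdiff_nonneg[OF f0 True, of x] h by (simp add: wdiff_eq_vdiff)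
next
  case False
  then have "u x = 0" using h by (intro u_zero) simp
  then show ?thesis using u_nonneg by (simp add: vdiff_def)
qed

text \<open>For large \<open>h\<close>, \<open>vdiff h\<close> is nonnegative and, by monotonicity
  of \<open>f\<close>, superharmonic in the half-space. On a ball below the boundary it equals the
  raised \<open>u\<close> and has mass at least \<open>\<eta>\<close>, which forces a uniform lower
  bound at height 2. Monotonicity of \<open>u\<close> carries this bound upwards.\<close>

lemma uniform_positivity:
  assumes f0: "f 0 < 0"
  shows "\<exists>c>0. \<exists>H>0. \<forall>x. H \<le> snd x \<longrightarrow> c \<le> u x"
proof -
  obtain R \<eta> where R: "0 < R" and \<eta>: "0 < \<eta>" "\<And>z. R \<le> snd z \<Longrightarrow> \<eta> \<le> (LINT y:ball z (R + 1)|lborel. u y)"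
    using mass_lower_bound[OF f0] by blast
  define T where "T = kernel_const TYPE('b \<times> real) s"
  have T: "0 \<le> T" unfolding T_def by (rule kernel_const_nonneg)
  \<comment> \<open>\<open>2 * R + 5\<close> adds the distance at most 1 from the contact point to
    \<open>x0\<close>, \<open>R + 3\<close> from \<open>x0\<close> to the centre of the lower ball,
    and its radius \<open>R + 1\<close>.\<close>
  define k where "k = (2 * R + 5) powr - (real DIM('b \<times> real) + 2 * s)"
  have k: "0 < k" using R by (simp add: k_def)
  define h where "h = 2 * R + 2"
  have h: "0 < h" using R by (simp add: h_def)
  define c where "c = k * \<eta> / (T + 1)"
  have c: "0 < c" using k \<eta> T by (simp add: c_def)
  have low: "c \<le> vdiff h x0" if x0: "snd x0 = 2" for x0
  proof -
    define z2 where "z2 = (fst x0, - (R + 1))"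
    let ?S = "ball z2 (R + 1)"
    have S_neg: "snd y < 0" if "y \<in> ?S" for y
      using dist_snd_le[of z2 y] that by (simp add: z2_def dist_real_def)
    have mass: "\<eta> \<le> (LINT y:?S|lborel. vdiff h y)"
    proof -
      let ?z1 = "z2 + (0, h)"
      let ?g = "\<lambda>y. indicator (ball ?z1 (R + 1)) y * u y"
      have iff: "y + (0, h) \<in> ball ?z1 (R + 1) \<longleftrightarrow> y \<in> ?S" for y by (simp add: dist_norm)
      have "indicator ?S y * vdiff h y = ?g (y + (0, h))" for y
        using iff[of y] S_neg[of y] u_zero[of y] by (cases "y \<in> ?S") (auto simp: vdiff_def)
      then have "(LINT y:?S|lborel. vdiff h y) = (\<integral>y. ?g (y + (0, h)) \<partial>lborel)"
        by (simp add: set_lebesgue_integral_def)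
      also have "\<dots> = (\<integral>y. ?g y \<partial>lborel)"
        by (rule lborel_integral_invariant[OF lborel_distr_add _ indicator_u_meas])
          (auto intro!: borel_measurable_continuous_onI continuous_intros)
      also have "\<dots> = (LINT y:ball ?z1 (R + 1)|lborel. u y)" by (simp add: set_lebesgue_integral_def)
      finally show ?thesis using \<eta>(2)[of ?z1] by (simp add: z2_def h_def)
    qed
    have "k * \<eta> \<le> vdiff h x0 * T"
    proof (rule le_of_perturbation[of 1])
      fix e :: real assume e: "0 < e" "e < 1"
      \<comment> \<open>Just above \<open>vdiff h x0\<close>, so that nonnegativity of
        \<open>vdiff h\<close> alone allows touching; \<open>e\<close> tends to 0
        afterwards.\<close>
      define \<delta> where "\<delta> = vdiff h x0 + e"
      have \<delta>: "0 < \<delta>" "vdiff h x0 < \<delta>" using vdiff_nonneg[OF f0 h, of x0] e by (auto simp: \<delta>_def)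
      have "\<exists>x\<in>ball x0 1. vdiff h x \<le> vdiff h x0 \<and> (\<forall>y. vdiff h x - vdiff h y \<le> \<delta> * (bump x0 1 x - bump x0 1 y))"
      proof (rule ball_touching_exists[OF cont_vdiff])
        show "vdiff h x0 - \<delta> < vdiff h y" for y using vdiff_nonneg[OF f0 h, of y] \<delta> by linarith
      qed (use \<delta> in auto)
      then obtain x where x: "x \<in> ball x0 1"
        and touch: "\<And>y. vdiff h x - vdiff h y \<le> \<delta> * (bump x0 1 x - bump x0 1 y)" by blast
      have pos: "1 < snd x" using dist_snd_le[of x0 x] x x0 by (simp add: dist_real_def)
      let ?G = "\<lambda>y. \<delta> * (bump x0 1 x - bump x0 1 y) - (vdiff h x - vdiff h y)"
      have far: "1 \<le> dist x y" "dist x y \<le> 2 * R + 5" "1 \<le> dist x0 y" if "y \<in> ?S" for y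
      proof -
        show "1 \<le> dist x y" using dist_snd_le[of x y] S_neg[OF that] pos by (simp add: dist_real_def)
        show "1 \<le> dist x0 y" using dist_snd_le[of x0 y] S_neg[OF that] x0 by (simp add: dist_real_def)
        have "dist x y \<le> dist x x0 + dist x0 y" "dist x0 y \<le> dist x0 z2 + dist z2 y" by (rule dist_triangle)+
        moreover have "dist x0 z2 = R + 3" using x0 R
          by (cases x0) (simp add: z2_def dist_Pair_Pair dist_real_def)
        ultimately show "dist x y \<le> 2 * R + 5" using x that by (simp add: dist_commute)
      qed
      have "y \<notin> ball x 1" if "y \<in> ?S" for y using far(1)[OF that] by simp
      then have S_far: "?S \<inter> ball x 1 = {}" by blast
      have "f (u (x + (0, h))) - f (u x) \<le> \<delta> * (1 powr (- 2 * s) * kernel_const TYPE('b \<times> real) s) -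
         (LINT y:?S|lborel. ?G y * frac_kernel s (x - y))"
        using pos \<delta> S_far x h
        by (intro pv_lap_touch[OF s dim vdiff_meas vdiff_abs_le vdiff_pv _ _ _ touch, where r=1]) auto
      moreover have "0 \<le> f (u (x + (0, h))) - f (u x)"
        using f_mono[of "u x" "u (x + (0, h))"] u_nonneg u_le vdiff_nonneg[OF f0 h, of x] by (simp add: vdiff_def)
      ultimately have le: "(LINT y:?S|lborel. ?G y * frac_kernel s (x - y)) \<le> \<delta> * T" by (simp add: T_def)
      have Gabs: "\<bar>?G y\<bar> \<le> \<delta> * 1 + 2 * M" for y
      proof -
        have "\<bar>bump x0 1 x - bump x0 1 y\<bar> \<le> 1"
          using bump_bounds[of x0 1 x] bump_bounds[of x0 1 y] by linarith
        then have "\<bar>\<delta> * (bump x0 1 x - bump x0 1 y)\<bar> \<le> \<delta> * 1"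
          unfolding abs_mult using \<delta> by (intro mult_mono) auto
        then show ?thesis using vdiff_abs_le[of h x] vdiff_abs_le[of h y] by linarith
      qed
      have iG: "set_integrable lborel ?S ?G" using Gabs by (intro set_integrable_bounded_set) auto
      have iGk: "set_integrable lborel ?S (\<lambda>y. ?G y * frac_kernel s (x - y))"
        using Gabs S_far by (intro set_integrable_frac_kernel[OF s dim, where r=1]) auto
      have iv: "set_integrable lborel ?S (vdiff h)"
        by (intro set_integrable_bounded_set[OF _ _ vdiff_meas vdiff_abs_le]) auto
      have "(LINT y:?S|lborel. vdiff h y) \<le> (LINT y:?S|lborel. ?G y)"
      proof (rule set_integral_mono[OF iv iG])
        fix y assume "y \<in> ?S"
        \<comment> \<open>At height 2 the unit ball around \<open>x0\<close> misses the lower ball,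
          so the bump is 0 there and cannot reduce the gap below \<open>vdiff h y\<close>.\<close>
        then have "bump x0 1 y = 0" using far(3)[of y] by (intro bump_zero) auto
        moreover have "vdiff h x \<le> \<delta> * bump x0 1 x" using touch[of x0] \<delta> by (simp add: algebra_simps)
        ultimately show "vdiff h y \<le> ?G y" by simp
      qed
      then have "k * \<eta> \<le> k * (LINT y:?S|lborel. ?G y)" using mass k by (intro mult_left_mono) auto
      also have "\<dots> \<le> (LINT y:?S|lborel. ?G y * frac_kernel s (x - y))"
      proof (rule kernel_integral_lower[OF _ iG iGk])
        fix y assume y: "y \<in> ?S"
        show "0 \<le> ?G y" using touch[of y] by simp
        have "x \<noteq> y" using far(1)[OF y] by auto
        then show "k \<le> frac_kernel s (x - y)"
          unfolding k_def using far(2)[OF y] s by (intro frac_kernel_ge) (auto simp: dist_norm)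
      qed simp
      also note le
      finally show "k * \<eta> \<le> vdiff h x0 * T + e * T" by (simp add: \<delta>_def algebra_simps)
    qed simp
    then have "k * \<eta> \<le> vdiff h x0 * (T + 1)" using vdiff_nonneg[OF f0 h, of x0] by (simp add: algebra_simps)
    then show ?thesis using T by (simp add: c_def pos_divide_le_eq)
  qed
  have "c \<le> u x" if x: "2 + h \<le> snd x" for x
  proof -
    define y where "y = (fst x, 2 :: real)"
    have "c \<le> u (y + (0, h))" using low[of y] u_nonneg[of y] by (simp add: y_def vdiff_def)
    also have "\<dots> \<le> u x"
    proof (cases "snd x = 2 + h")
      case True
      then have "x = y + (0, h)" by (cases x) (simp add: y_def)
      then show ?thesis by simp
    next
      case False
      then have "0 \<le> vdiff (snd x - (2 + h)) (y + (0, h))" using x by (intro vdiff_nonneg[OF f0]) simp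
      moreover have "y + (0, h) + (0, snd x - (2 + h)) = x" by (cases x) (simp add: y_def)
      ultimately show ?thesis by (simp add: vdiff_def)
    qed
    finally show ?thesis .
  qed
  then show ?thesis using c h by (intro exI[of _ c] conjI exI[of _ "2 + h"]) auto
qed

text \<open>Above \<open>H\<close> both \<open>u x\<close> and \<open>u (x + (0, 1))\<close> lie in
  \<open>[c, M]\<close>, where \<open>f\<close> has a positive minimal slope; the Liouville lemma
  then makes \<open>u\<close> 1-periodic vertically, so it is 0 at heights where it should be at
  least \<open>c\<close>.\<close>

lemma no_solution_negative:
  assumes f0: "f 0 < 0"
    and slope: "\<And>c. 0 < c \<Longrightarrow> \<exists>c0>0. \<forall>a b. c \<le> a \<longrightarrow> a \<le> b \<longrightarrow> b \<le> M \<longrightarrow> c0 * (b - a) \<le> f b - f a"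
  shows False
proof -
  obtain c H where c: "0 < c" and H: "0 < H" "\<And>x. H \<le> snd x \<Longrightarrow> c \<le> u x"
    using uniform_positivity[OF f0] by blast
  obtain c0 where c0: "0 < c0" "\<And>a b. c \<le> a \<Longrightarrow> a \<le> b \<Longrightarrow> b \<le> M \<Longrightarrow> c0 * (b - a) \<le> f b - f a"
    using slope[OF c] by blast
  have zero: "vdiff 1 y = 0" for y
  proof (rule half_space_eigenvalue_Liouville[OF s cont_vdiff vdiff_abs_le vdiff_nonneg[OF f0] c0(1)])
    fix x :: "'b \<times> real" assume x: "H < snd x"
    have "c0 * vdiff 1 x \<le> f (u (x + (0, 1))) - f (u x)"
      using c0(2)[of "u x" "u (x + (0, 1))"] H(2)[of x] x u_le vdiff_nonneg[OF f0, of 1 x] by (simp add: vdiff_def)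
    then show "\<exists>l. pv_lap s (vdiff 1) x l \<and> c0 * vdiff 1 x \<le> l"
      using vdiff_pv[of x 1] x H(1) by auto
  qed simp
  have "u (0, t + real n) = u (0, t)" for t n
  proof (induction n)
    case (Suc n)
    then show ?case using zero[of "(0, t + real n)"] by (simp add: vdiff_def add_ac)
  qed simp
  \<comment> \<open>Going down from \<open>H\<close> by the integer ceiling of \<open>H\<close>
    reaches height at most 0, where \<open>u\<close> vanishes.\<close>
  from this[of "H - real (nat \<lceil>H\<rceil>)" "nat \<lceil>H\<rceil>"] have "u (0, H) = 0"
    using u_zero[of "(0, H - real (nat \<lceil>H\<rceil>))"] by simp linarith
  then show False using H(2)[of "(0, H)"] c by simp
qed

end

section \<open>From the hypotheses on \<open>f\<close> to the two cases\<close>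

lemma C1_increment_bounds:
  fixes f :: "real \<Rightarrow> real"
  assumes "f C1_differentiable_on UNIV" "a \<le> b"
  shows "\<exists>L>0. \<forall>x\<in>{a..b}. \<forall>y\<in>{a..b}. \<bar>f x - f y\<bar> \<le> L * \<bar>x - y\<bar>"
    and "(\<And>t. t \<in> {a..b} \<Longrightarrow> 0 < deriv f t) \<Longrightarrow> \<exists>c>0. \<forall>x y. a \<le> x \<longrightarrow> x \<le> y \<longrightarrow> y \<le> b \<longrightarrow> c * (y - x) \<le> f y - f x"
proof -
  obtain D where D: "\<And>x. (f has_vector_derivative D x) (at x)" "continuous_on UNIV D"
    using assms(1) unfolding C1_differentiable_on_def by auto
  have D': "DERIV f x :> D x" for x
    using D(1) by (simp add: has_real_derivative_iff_has_vector_derivative)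
  have contD: "continuous_on {a..b} D" using D(2) by (rule continuous_on_subset) simp
  have mvt: "\<exists>z\<in>{x..y}. f y - f x = (y - x) * D z" if "x \<le> y" for x y :: real
  proof (cases "x = y")
    case False
    then have "x < y" using that by simp
    from MVT2[OF this, of f D] D' show ?thesis by (meson atLeastAtMost_iff less_imp_le)
  qed simp
  have "bounded (D ` {a..b})" using compact_continuous_image[OF contD] compact_imp_bounded by blast
  then obtain L where L: "0 < L" "\<And>t. t \<in> {a..b} \<Longrightarrow> \<bar>D t\<bar> \<le> L"
    unfolding bounded_pos by auto
  have ordered: "\<bar>f y - f x\<bar> \<le> L * (y - x)" if "a \<le> x" "x \<le> y" "y \<le> b" for x y
  proof -
    obtain z where z: "z \<in> {x..y}" "f y - f x = (y - x) * D z" using mvt[OF \<open>x \<le> y\<close>] by blast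
    have "\<bar>f y - f x\<bar> = (y - x) * \<bar>D z\<bar>" using z(2) that by (simp add: abs_mult)
    also have "\<dots> \<le> (y - x) * L" using L(2)[of z] z(1) that by (intro mult_left_mono) auto
    finally show ?thesis by (simp add: mult.commute)
  qed
  have "\<bar>f x - f y\<bar> \<le> L * \<bar>x - y\<bar>" if "x \<in> {a..b}" "y \<in> {a..b}" for x y
    using ordered[of x y] ordered[of y x] that by (cases "x \<le> y") (auto simp: abs_minus_commute)
  then show "\<exists>L>0. \<forall>x\<in>{a..b}. \<forall>y\<in>{a..b}. \<bar>f x - f y\<bar> \<le> L * \<bar>x - y\<bar>" using L(1) by blast
  assume pos: "\<And>t. t \<in> {a..b} \<Longrightarrow> 0 < deriv f t"
  obtain t0 where t0: "t0 \<in> {a..b}" "\<And>t. t \<in> {a..b} \<Longrightarrow> D t0 \<le> D t"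
    using continuous_attains_inf[of "{a..b}" D] contD assms(2) by auto
  have "0 < D t0" using pos[OF t0(1)] DERIV_imp_deriv[OF D'] by simp
  moreover have "D t0 * (y - x) \<le> f y - f x" if "a \<le> x" "x \<le> y" "y \<le> b" for x y
  proof -
    obtain z where z: "z \<in> {x..y}" "f y - f x = (y - x) * D z" using mvt[OF \<open>x \<le> y\<close>] by blast
    have "(y - x) * D t0 \<le> (y - x) * D z" using t0(2)[of z] z(1) that by (intro mult_left_mono) auto
    then show ?thesis using z(2) by (simp add: mult.commute)
  qed
  ultimately show "\<exists>c>0. \<forall>x y. a \<le> x \<longrightarrow> x \<le> y \<longrightarrow> y \<le> b \<longrightarrow> c * (y - x) \<le> f y - f x" by blast
qed

theorem theorem2:
  fixes s :: real and f :: "real \<Rightarrow> real"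
  assumes "0 < s" and "s < 1"
    and "f C1_differentiable_on UNIV"
    and "\<And>t. t > 0 \<Longrightarrow> deriv f t > 0"
    and "f 0 \<noteq> 0 \<or> (f 0 = 0 \<and> deriv f 0 > 0)"
  shows "\<not> (\<exists>u :: (real^'m::finite) \<times> real \<Rightarrow> real.
           bounded_classical_solution s f u \<and> (\<forall>x. u x \<ge> 0) \<and> (\<exists>x. u x \<noteq> 0))"
proof
  assume "\<exists>u :: (real^'m) \<times> real \<Rightarrow> real. bounded_classical_solution s f u \<and> (\<forall>x. u x \<ge> 0) \<and> (\<exists>x. u x \<noteq> 0)"
  then obtain u :: "(real^'m) \<times> real \<Rightarrow> real" where sol: "bounded_classical_solution s f u"
    and nn: "\<And>x. 0 \<le> u x" and nontriv: "\<exists>x. u x \<noteq> 0" by blast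
  have cont: "continuous_on UNIV u" and zero: "\<And>x. snd x \<le> 0 \<Longrightarrow> u x = 0"
    and pv: "\<And>x. 0 < snd x \<Longrightarrow> pv_lap s u x (f (u x))"
    using sol by (auto simp: bounded_classical_solution_def half_space_def has_frac_laplacian_imp_pv_lap)
  obtain M where M: "0 < M" "\<And>x. \<bar>u x\<bar> \<le> M"
    using sol unfolding bounded_classical_solution_def bounded_pos by auto
  have uM: "u x \<le> M" for x using M(2)[of x] by simp
  obtain L where L: "0 < L" "\<And>a b. a \<in> {0..M} \<Longrightarrow> b \<in> {0..M} \<Longrightarrow> \<bar>f a - f b\<bar> \<le> L * \<bar>a - b\<bar>"
    using C1_increment_bounds(1)[OF assms(3), of 0 M] M(1) by auto
  \<comment> \<open>The derivative may vanish at 0, so a uniform slope is claimed only on intervals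
    \<open>[c, M]\<close> with \<open>c > 0\<close>.\<close>
  have slope: "\<exists>c0>0. \<forall>a b. c \<le> a \<longrightarrow> a \<le> b \<longrightarrow> b \<le> M \<longrightarrow> c0 * (b - a) \<le> f b - f a" if "0 < c" for c
  proof (cases "c \<le> M")
    case True
    then show ?thesis using C1_increment_bounds(2)[OF assms(3) True] assms(4) that by auto
  next
    case False
    then show ?thesis by (intro exI[of _ 1]) auto
  qed
  have mono: "f a \<le> f b" if ab: "0 < a" "a \<le> b" "b \<le> M" for a b
  proof -
    obtain c0 where "0 < c0" "c0 * (b - a) \<le> f b - f a" using slope[OF ab(1)] ab by blast
    moreover from this have "0 \<le> c0 * (b - a)" using ab by simp
    ultimately show ?thesis by linarith
  qed
  \<comment> \<open>The endpoint 0, where the sign of the derivative is not given, is reached as a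
    right limit.\<close>
  have mono: "f a \<le> f b" if "0 \<le> a" "a \<le> b" "b \<le> M" for a b
  proof (cases "a = 0 \<and> 0 < b")
    case True
    have "isCont f 0" using assms(3) C1_differentiable_imp_continuous_on continuous_on_eq_continuous_at by blast
    then have "(f \<longlongrightarrow> f 0) (at_right 0)" by (simp add: isCont_def filterlim_at_split)
    moreover have "\<forall>\<^sub>F t in at_right 0. f t \<le> f b"
      using True that by (intro eventually_at_rightI[of 0 b] mono) auto
    ultimately show ?thesis using True by (intro tendsto_upperbound[of f _ "at_right 0"]) auto
  next
    case False
    then show ?thesis using mono[of a b] that by (cases "a = 0") auto
  qed
  show False
  proof (cases "f 0 < 0")
    case True
    interpret half_space_solution s f u M L
      by unfold_locales (use assms(1,2) cont nn uM zero pv L mono in auto)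
    show False by (rule no_solution_negative[OF True slope])
  next
    case False
    \<comment> \<open>If \<open>f 0 = 0\<close>, the derivative is positive on all of
      \<open>[0, M]\<close>, including 0. If \<open>f 0 > 0\<close>, already
      \<open>f t \<ge> f 0 \<ge> (f 0 / M) * t\<close>.\<close>
    have "\<exists>c>0. \<forall>t. 0 \<le> t \<longrightarrow> t \<le> M \<longrightarrow> c * t \<le> f t"
    proof (cases "f 0 = 0")
      case True
      then have "0 < deriv f t" if "t \<in> {0..M}" for t
        using assms(4,5) that by (cases "t = 0") auto
      then obtain c where "0 < c" "\<And>x y. 0 \<le> x \<Longrightarrow> x \<le> y \<Longrightarrow> y \<le> M \<Longrightarrow> c * (y - x) \<le> f y - f x"
        using C1_increment_bounds(2)[OF assms(3), of 0 M] M(1) by auto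
      from this(1) this(2)[of 0] True show ?thesis by (intro exI[of _ c]) auto
    next
      case ne: False
      then have "0 < f 0" using False by simp
      moreover have "f 0 / M * t \<le> f t" if "0 \<le> t" "t \<le> M" for t
      proof -
        have "f 0 / M * t \<le> f 0 / M * M" using that \<open>0 < f 0\<close> M(1) by (intro mult_left_mono) auto
        also have "\<dots> = f 0" using M(1) by simp
        also have "\<dots> \<le> f t" by (rule mono) (use that in auto)
        finally show ?thesis .
      qed
      ultimately show ?thesis using M(1) by (intro exI[of _ "f 0 / M"]) auto
    qed
    then obtain c where c: "0 < c" "\<And>t. 0 \<le> t \<Longrightarrow> t \<le> M \<Longrightarrow> c * t \<le> f t" by blast
    have "u y = 0" for y
    proof (rule half_space_eigenvalue_Liouville[OF assms(1,2) cont M(2) nn c(1)])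
      fix x :: "(real^'m) \<times> real" assume "0 < snd x"
      then show "\<exists>l. pv_lap s u x l \<and> c * u x \<le> l" using pv c(2)[OF nn uM] by blast
    qed
    then show False using nontriv by blast
  qed
qed

end
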